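(* Let $S$ be a simply connected almost-abelian Lie group of dimension $n$. (i) If $g\in\mathcal{C}_S$ is a local maximum of $F|_{\mathcal{C}_S}$, then $g$ is a Ricci soliton. (ii) $g\in\mathcal{C}_S$ is a global maximum of $F|_{\mathcal{C}_S}$ if and only if $g$ is a solvsoliton. (iii) Suppose that $S$ admits a Ricci soliton $g\in\mathcal{C}_S$ which is not a solvsoliton. Then $S$ admits Ricci solitons in $\mathcal{C}_S$ which are not local maxima of $F|_{\mathcal{C}_S}$. (iv) Assume that $S$ is of real type and does not admit a solvsoliton. Then $\sup F|_{\mathcal{C}_S}=F(g_0)$, where $g_0$ is the solvsoliton on the simply connected almost-abelian Lie group $S_0$ corresponding to the semisimple part $A_{S_0}$ of $A_S$.
   Context: A Lie group $S$ is almost-abelian if its Lie algebra $\mathfrak{s}$ has a codimension-one abelian ideal $\mathfrak{n}$. The matrix $A_S\in\mathfrak{gl}_{n-1}(\mathbb{R})$ attached to $S$ is the matrix of $\mathrm{ad}\,X|_{\mathfrak{n}}$ for any $X\in\mathfrak{s}\smallsetminus\mathfrak{n}$; it is defined up to conjugation and nonzero scaling, and determines the simply connected $S$ up to isomorphism; conversely, any matrix $A$ determines such a group. The semisimple part of a matrix is the one in its additive Jordan decomposition $A=A_s+A_n$, with $A_s$ semisimple (diagonalizable over $\mathbb{C}$), $A_n$ nilpotent, $[A_s,A_n]=0$. $\mathcal{C}_S$ is the set of all non-flat left-invariant Riemannian metrics on $S$, with the topology of the space of inner products on $\mathfrak{s}$. $F(g):=\mathrm{scal}_g^2/|\mathrm{Ric}_g|^2$,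 with $\mathrm{scal}_g$ the scalar curvature, $\mathrm{Ric}_g$ the Ricci operator and $|\mathrm{Ric}_g|^2=\mathrm{tr}\,\mathrm{Ric}_g^2$. A left-invariant metric $g$ on $S$ is a solvsoliton if $\mathrm{Ric}_g=cI+D$ for some $c\in\mathbb{R}$, $D\in\mathrm{Der}(\mathfrak{s})$; it is a Ricci soliton if its Ricci tensor equals $cg+\mathcal{L}_Xg$ for some $c\in\mathbb{R}$ and some complete vector field $X$ on $S$. $S$ is of real type if every $\mathrm{ad}\,X$, $X\in\mathfrak{s}$, all of whose eigenvalues lie in $i\mathbb{R}$ is nilpotent. *)

theory Defs
  imports "HOL-Analysis.Analysis"
begin

section \<open>Almost-abelian Lie algebras\<close>

text \<open>
  A finite-dimensional real Lie algebra is a bracket on a type of class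
  \<^class>\<open>euclidean_space\<close>. The inner product of that class is never used as a metric; it only
  supplies the vector space topology and a basis for computing traces.
\<close>

definition lie_algebra :: "('a::euclidean_space \<Rightarrow> 'a \<Rightarrow> 'a) \<Rightarrow> bool" where
  "lie_algebra br \<longleftrightarrow> bilinear br \<and> (\<forall>x. br x x = 0) \<and>
     (\<forall>x y z. br x (br y z) + br y (br z x) + br z (br x y) = 0)"

definition codim1_abelian_ideal :: "('a::euclidean_space \<Rightarrow> 'a \<Rightarrow> 'a) \<Rightarrow> 'a set \<Rightarrow> bool" where
  "codim1_abelian_ideal br N \<longleftrightarrow> subspace N \<and> dim N + 1 = DIM('a) \<and>
     (\<forall>x. \<forall>y\<in>N. br x y \<in> N) \<and> (\<forall>x\<in>N. \<forall>y\<in>N. br x y = 0)"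

definition derivation :: "('a::euclidean_space \<Rightarrow> 'a \<Rightarrow> 'a) \<Rightarrow> ('a \<Rightarrow> 'a) \<Rightarrow> bool" where
  "derivation br D \<longleftrightarrow> linear D \<and> (\<forall>x y. D (br x y) = br (D x) y + br x (D y))"

text \<open>
  The pair \<open>(u, v)\<close> stands for the vector \<open>u + i v\<close> of the complexification: the two equations are
  the real and imaginary part of \<open>T (u + i v) = z (u + i v)\<close>.
\<close>

definition complex_eigenvector :: "('a::real_vector \<Rightarrow> 'a) \<Rightarrow> complex \<Rightarrow> 'a \<times> 'a \<Rightarrow> bool" where
  "complex_eigenvector T z w \<longleftrightarrow> w \<noteq> 0 \<and>
     T (fst w) = Re z *\<^sub>R fst w - Im z *\<^sub>R snd w \<and>
     T (snd w) = Im z *\<^sub>R fst w + Re z *\<^sub>R snd w"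

definition complex_eigenvalue :: "('a::real_vector \<Rightarrow> 'a) \<Rightarrow> complex \<Rightarrow> bool" where
  "complex_eigenvalue T z \<longleftrightarrow> (\<exists>w. complex_eigenvector T z w)"

definition nilpotent_on :: "'a::real_vector set \<Rightarrow> ('a \<Rightarrow> 'a) \<Rightarrow> bool" where
  "nilpotent_on V T \<longleftrightarrow> (\<exists>k. \<forall>v\<in>V. (T ^^ k) v = 0)"

definition real_type :: "('a::euclidean_space \<Rightarrow> 'a \<Rightarrow> 'a) \<Rightarrow> bool" where
  "real_type br \<longleftrightarrow>
     (\<forall>x. (\<forall>z. complex_eigenvalue (br x) z \<longrightarrow> Re z = 0) \<longrightarrow> nilpotent_on UNIV (br x))"

text \<open>
  Diagonalizability over the complex numbers: the complexification of \<open>V\<close> is spanned by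
  eigenvectors. The real span suffices, as the set of eigenvectors and zero is stable under complex
  scalars.
\<close>

definition semisimple_on :: "'a::real_vector set \<Rightarrow> ('a \<Rightarrow> 'a) \<Rightarrow> bool" where
  "semisimple_on V T \<longleftrightarrow> V \<times> V \<subseteq> span {w \<in> V \<times> V. \<exists>z. complex_eigenvector T z w}"

text \<open>
  \<open>A = As + An\<close> on \<open>V\<close>. The values of \<open>As\<close> and \<open>An\<close> outside \<open>V\<close> are irrelevant, and linear maps of
  \<open>V\<close> are taken as restrictions of linear maps of the whole space.
\<close>

definition additive_jordan_decomposition ::
    "'a::real_vector set \<Rightarrow> ('a \<Rightarrow> 'a) \<Rightarrow> ('a \<Rightarrow> 'a) \<Rightarrow> ('a \<Rightarrow> 'a) \<Rightarrow> bool" where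
  "additive_jordan_decomposition V A As An \<longleftrightarrow>
     linear As \<and> linear An \<and> As ` V \<subseteq> V \<and> An ` V \<subseteq> V \<and>
     (\<forall>v\<in>V. A v = As v + An v) \<and> (\<forall>v\<in>V. As (An v) = An (As v)) \<and>
     semisimple_on V As \<and> nilpotent_on V An"

text \<open>The coordinate along \<open>X\<close> in the decomposition of the space as \<open>\<real>X \<oplus> N\<close>.\<close>

definition height :: "'a::real_vector set \<Rightarrow> 'a \<Rightarrow> 'a \<Rightarrow> real" where
  "height N X p = (THE t. p - t *\<^sub>R X \<in> N)"

text \<open>
  The Lie algebra \<open>\<real>X \<ltimes>\<^sub>A N\<close>: \<open>N\<close> is abelian and \<open>[X, v] = A v\<close> for \<open>v \<in> N\<close>. Note that the
  argument of \<open>A\<close> lies in \<open>N\<close>.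
\<close>

definition semidirect_bracket ::
    "'a::real_vector set \<Rightarrow> 'a \<Rightarrow> ('a \<Rightarrow> 'a) \<Rightarrow> 'a \<Rightarrow> 'a \<Rightarrow> 'a" where
  "semidirect_bracket N X A u v = A (height N X u *\<^sub>R v - height N X v *\<^sub>R u)"


section \<open>The simply connected group\<close>

definition exp_lin :: "('a::real_normed_vector \<Rightarrow> 'a) \<Rightarrow> 'a \<Rightarrow> 'a" where
  "exp_lin T v = (\<Sum>k. (T ^^ k) v /\<^sub>R fact k)"

text \<open>
  For a Lie algebra with codimension-one abelian ideal \<open>N\<close> and \<open>X \<notin> N\<close>, the simply connected Lie
  group is \<open>\<real> \<ltimes> N\<close> with \<open>(t, u) (s, v) = (t + s, u + exp (t ad X) v)\<close>. It is realised here on the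
  vector space \<open>\<real>X \<oplus> N\<close> itself, writing \<open>t X + u\<close> for \<open>(t, u)\<close>; since \<open>exp (t ad X)\<close> fixes \<open>X\<close>, the
  product of \<open>p\<close> and \<open>q\<close> is \<open>p + exp (t ad X) q\<close> with \<open>t\<close> the height of \<open>p\<close>. The identity is \<open>0\<close>.
\<close>

definition group_mult ::
    "('a::euclidean_space \<Rightarrow> 'a \<Rightarrow> 'a) \<Rightarrow> 'a set \<Rightarrow> 'a \<Rightarrow> 'a \<Rightarrow> 'a \<Rightarrow> 'a" where
  "group_mult br N X p q = p + exp_lin (\<lambda>v. height N X p *\<^sub>R br X v) q"

text \<open>
  For a Lie group structure \<open>m\<close> on a vector space, with identity \<open>0\<close>: the differential at the
  identity of the left translation by \<open>p\<close>, and the left-invariant (0,2)-tensor field with value \<open>b\<close>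
  at the identity.
\<close>

definition left_diff :: "('a::euclidean_space \<Rightarrow> 'a \<Rightarrow> 'a) \<Rightarrow> 'a \<Rightarrow> 'a \<Rightarrow> 'a" where
  "left_diff m p = frechet_derivative (m p) (at 0)"

definition left_inv_field ::
    "('a::euclidean_space \<Rightarrow> 'a \<Rightarrow> 'a) \<Rightarrow> ('a \<Rightarrow> 'a \<Rightarrow> real) \<Rightarrow> 'a \<Rightarrow> 'a \<Rightarrow> 'a \<Rightarrow> real" where
  "left_inv_field m b p u v = b (inv (left_diff m p) u) (inv (left_diff m p) v)"



subsection \<open>The group law has the given Lie algebra\<close>

lemma funpow_scaleR_linear:
  fixes T :: "'a::real_vector \<Rightarrow> 'a"
  assumes "linear T" shows "((\<lambda>v. t *\<^sub>R T v) ^^ k) v = t ^ k *\<^sub>R (T ^^ k) v"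
proof -
  show ?thesis by (induction k) (simp_all add: linear_scale[OF assms])
qed

lemma norm_funpow_linear:
  fixes T :: "'a::euclidean_space \<Rightarrow> 'a"
  assumes "linear T"
  obtains K where "K > 0" "\<And>k v. norm ((T ^^ k) v) \<le> K ^ k * norm v"
proof -
  obtain K where K: "K > 0" "\<And>v. norm (T v) \<le> K * norm v"
    using linear_bounded_pos[OF assms] by blast
  have "norm ((T ^^ k) v) \<le> K ^ k * norm v" for k v
  proof (induction k)
    case (Suc k)
    have "norm (T ((T ^^ k) v)) \<le> K * norm ((T ^^ k) v)" by (rule K)
    also have "\<dots> \<le> K * (K ^ k * norm v)" using Suc K(1) by (intro mult_left_mono) auto
    finally show ?case by simp
  qed simp
  with K(1) show thesis by (rule that)
qed

lemma summable_exp_lin: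
  fixes T :: "'a::euclidean_space \<Rightarrow> 'a"
  assumes "linear T" shows "summable (\<lambda>k. (T ^^ k) v /\<^sub>R fact k)"
proof -
  obtain K where K: "K > 0" "\<And>k v. norm ((T ^^ k) v) \<le> K ^ k * norm v"
    using norm_funpow_linear[OF assms] by blast
  show ?thesis
  proof (rule summable_comparison_test')
    show "summable (\<lambda>k. (K ^ k /\<^sub>R fact k) * norm v)"
      by (intro summable_mult2 summable_exp_generic)
    show "norm ((T ^^ k) v /\<^sub>R fact k) \<le> (K ^ k /\<^sub>R fact k) * norm v" if "k \<ge> 0" for k
      using K(2)[where k=k and v=v] by (simp add: divide_simps mult.commute)
  qed
qed

lemma linear_scaled: "linear T \<Longrightarrow> linear (\<lambda>v. t *\<^sub>R T v)" for t :: real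
  by (rule linear_compose_scale_right)

lemma has_vector_derivative_exp_lin:
  fixes T :: "'a::euclidean_space \<Rightarrow> 'a"
  assumes "linear T"
  shows "((\<lambda>t. exp_lin (\<lambda>v. t *\<^sub>R T v) v) has_vector_derivative
           T (exp_lin (\<lambda>v. t *\<^sub>R T v) v)) (at t)"
proof -
  let ?c = "\<lambda>b k. ((T ^^ k) v \<bullet> b) / fact k"
  have sm: "summable (\<lambda>k. (((\<lambda>v. s *\<^sub>R T v) ^^ k) v) /\<^sub>R fact k)" for s
    by (rule summable_exp_lin[OF linear_scaled[OF assms]])
  have s1: "exp_lin (\<lambda>v. s *\<^sub>R T v) v \<bullet> b = (\<Sum>k. ?c b k * s ^ k)" for b s
    unfolding exp_lin_def using bounded_linear.suminf[OF bounded_linear_inner_left[of b] sm]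
    by (simp add: funpow_scaleR_linear[OF assms] inner_scaleR_left mult.commute divide_inverse mult.left_commute)
  have sm': "summable (\<lambda>k. ?c b k * s ^ k)" for b s
    using bounded_linear.summable[OF bounded_linear_inner_left[of b] sm]
    by (simp add: funpow_scaleR_linear[OF assms] inner_scaleR_left mult.commute divide_inverse mult.left_commute)
  have T: "T (exp_lin (\<lambda>v. t *\<^sub>R T v) v) \<bullet> b = (\<Sum>k. diffs (?c b) k * t ^ k)" for b
  proof -
    have "bounded_linear T" using assms by (rule linear_conv_bounded_linear[THEN iffD1])
    then have bl: "bounded_linear (\<lambda>x. T x \<bullet> b)" by (rule bounded_linear_inner_left_comp)
    show ?thesis unfolding exp_lin_def bounded_linear.suminf[OF bl sm]
      by (rule suminf_cong)
        (simp add: funpow_scaleR_linear[OF assms] diffs_def linear_scale[OF assms] field_simps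
           del: of_nat_Suc)
  qed
  show ?thesis
    unfolding has_vector_derivative_def
  proof (subst has_derivative_componentwise_within, rule ballI)
    fix b :: 'a assume "b \<in> Basis"
    have "((\<lambda>s. \<Sum>k. ?c b k * s ^ k) has_real_derivative (\<Sum>k. diffs (?c b) k * t ^ k)) (at t)"
      by (rule termdiffs_strong_converges_everywhere) (rule sm')
    then show "((\<lambda>s. exp_lin (\<lambda>v. s *\<^sub>R T v) v \<bullet> b) has_derivative
       (\<lambda>h. (h *\<^sub>R T (exp_lin (\<lambda>v. t *\<^sub>R T v) v)) \<bullet> b)) (at t)"
      by (simp add: s1 T has_field_derivative_def mult.commute[of _ "suminf _"] cong: )
  qed
qed

lemma exp_lin_0: "exp_lin (\<lambda>v. 0 *\<^sub>R T v) v = v"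
proof -
  have "((\<lambda>v. 0 *\<^sub>R T v) ^^ k) v /\<^sub>R fact k = (if k = 0 then v else 0)" for k
    by (cases k) auto
  then show ?thesis unfolding exp_lin_def
    using sums_single[of 0 "\<lambda>_. v"] by (simp add: sums_unique[symmetric])
qed

lemma linear_exp_lin:
  fixes T :: "'a::euclidean_space \<Rightarrow> 'a"
  assumes "linear T" shows "linear (exp_lin T)"
proof -
  have l: "linear (T ^^ k)" for k
  proof (induction k)
    case 0 show ?case by (simp add: linear_id[unfolded id_def] id_def)
  next
    case (Suc k) then show ?case using linear_compose[OF Suc assms] by (simp add: o_def)
  qed
  show ?thesis
  proof (rule linearI)
    show "exp_lin T (x + y) = exp_lin T x + exp_lin T y" for x y
      unfolding exp_lin_def suminf_add[OF summable_exp_lin[OF assms] summable_exp_lin[OF assms]]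
      by (simp add: linear_add[OF l] scaleR_add_right)
    show "exp_lin T (r *\<^sub>R x) = r *\<^sub>R exp_lin T x" for r x
      unfolding exp_lin_def suminf_scaleR_right[OF summable_exp_lin[OF assms]]
      by (simp add: linear_scale[OF l] mult.commute)
  qed
qed

lemma linear_ode_unique_pos:
  fixes T :: "'a::euclidean_space \<Rightarrow> 'a"
  assumes "linear T" "\<And>t. (f has_vector_derivative T (f t)) (at t)" "f 0 = 0" "s \<ge> 0"
  shows "f s = 0"
proof -
  obtain K where K: "K > 0" "\<And>v. norm (T v) \<le> K * norm v"
    using linear_bounded_pos[OF assms(1)] by blast
  let ?h = "\<lambda>t. exp (- 2 * K * t) * (f t \<bullet> f t)"
  have "?h s \<le> ?h 0"
  proof (rule DERIV_nonpos_imp_nonincreasing[OF assms(4)])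
    fix t
    have d: "((\<lambda>t. f t \<bullet> f t) has_real_derivative (2 * (f t \<bullet> T (f t)))) (at t)"
      using has_derivative_inner[OF assms(2)[unfolded has_vector_derivative_def] assms(2)[unfolded has_vector_derivative_def], of t]
      by (auto simp: has_field_derivative_def inner_commute algebra_simps elim!: has_derivative_eq_rhs)
    have "(?h has_real_derivative (exp (- 2 * K * t) * (2 * (f t \<bullet> T (f t)) - 2 * K * (f t \<bullet> f t)))) (at t)"
      by (rule derivative_eq_intros d refl)+ (simp add: algebra_simps)
    moreover have "f t \<bullet> T (f t) \<le> K * (f t \<bullet> f t)"
    proof -
      have "f t \<bullet> T (f t) \<le> norm (f t) * norm (T (f t))" by (rule norm_cauchy_schwarz)
      also have "\<dots> \<le> norm (f t) * (K * norm (f t))" by (intro mult_left_mono K) auto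
      finally show ?thesis by (simp add: power2_norm_eq_inner[symmetric] power2_eq_square mult_ac)
    qed
    ultimately show "\<exists>y. (?h has_real_derivative y) (at t) \<and> y \<le> 0"
      by (intro exI conjI) (auto simp: mult_le_0_iff)
  qed
  then have "f s \<bullet> f s \<le> 0" using assms(3) by (simp add: mult_le_0_iff)
  then show ?thesis by (metis inner_eq_zero_iff inner_ge_zero order_antisym)
qed

lemma linear_ode_unique:
  fixes T :: "'a::euclidean_space \<Rightarrow> 'a"
  assumes T: "linear T" and d: "\<And>t. (f has_vector_derivative T (f t)) (at t)" and "f 0 = 0"
  shows "f s = 0"
proof (cases "s \<ge> 0")
  case True
  show ?thesis by (rule linear_ode_unique_pos[OF T d assms(3) True])
next
  case False
  have "((\<lambda>t. f (- t)) has_vector_derivative - T (f (- t))) (at t)" for t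
  proof -
    have "((uminus :: real \<Rightarrow> real) has_vector_derivative - 1) (at t)"
      by (auto intro!: derivative_eq_intros)
    from vector_diff_chain_at[OF this d] show ?thesis by (simp add: o_def)
  qed
  moreover have "linear (\<lambda>v. - T v)" using T by (rule linear_compose_neg)
  ultimately have "f (- (- s)) = 0"
    using linear_ode_unique_pos[of "\<lambda>v. - T v" "\<lambda>t. f (- t)" "- s"] assms(3) False by auto
  then show ?thesis by simp
qed

lemma exp_lin_add:
  fixes T :: "'a::euclidean_space \<Rightarrow> 'a"
  assumes T: "linear T"
  shows "exp_lin (\<lambda>v. (s + t) *\<^sub>R T v) v = exp_lin (\<lambda>v. s *\<^sub>R T v) (exp_lin (\<lambda>v. t *\<^sub>R T v) v)"
proof -
  let ?E = "\<lambda>s. exp_lin (\<lambda>v. s *\<^sub>R T v)"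
  have "((\<lambda>s. ?E (s + t) v) has_vector_derivative T (?E (r + t) v)) (at r)" for r
  proof -
    have "((\<lambda>s. s + t) has_vector_derivative 1) (at r)"
      by (auto intro!: derivative_eq_intros)
    from vector_diff_chain_at[OF this has_vector_derivative_exp_lin[OF T, of v "r + t"]]
    show ?thesis by (simp add: o_def)
  qed
  note d = has_vector_derivative_diff[OF this has_vector_derivative_exp_lin[OF T]]
  have "?E (s + t) v - ?E s (?E t v) = 0"
    by (rule linear_ode_unique[OF T, of "\<lambda>s. ?E (s + t) v - ?E s (?E t v)"])
      (use d in \<open>simp_all add: linear_diff[OF T] exp_lin_0 del: scaleR_zero_left\<close>)
  then show ?thesis by simp
qed

text \<open>
  \<open>group_mult\<close> is a group law, and the commutators of its left-invariant vector fields are given by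
  the original bracket.
\<close>

context
  fixes br :: "'a::euclidean_space \<Rightarrow> 'a \<Rightarrow> 'a" and N X
  assumes lie: "lie_algebra br" and ideal: "codim1_abelian_ideal br N" and X: "X \<notin> N"
begin

lemma br_linear: "linear (br u)" "linear (\<lambda>u. br u v)"
  using lie by (auto simp: lie_algebra_def bilinear_def)

lemma subspace_N: "subspace N" using ideal by (auto simp: codim1_abelian_ideal_def)

lemma ex_height: "\<exists>!t. p - t *\<^sub>R X \<in> N"
proof -
  have "dim (insert X N) = DIM('a)"
    using ideal X subspace_N by (simp add: dim_insert codim1_abelian_ideal_def span_eq_iff[THEN iffD2])
  then have "p \<in> span (insert X N)" by (simp add: dim_eq_full)
  then obtain t where "p - t *\<^sub>R X \<in> span N"
    by (auto simp: span_insert)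
  then have "p - t *\<^sub>R X \<in> N"
    using subspace_N by (simp add: span_eq_iff[THEN iffD2])
  moreover have "s = t" if "p - s *\<^sub>R X \<in> N" "p - t *\<^sub>R X \<in> N" for s t
  proof (rule ccontr)
    assume "s \<noteq> t"
    have "(p - t *\<^sub>R X) - (p - s *\<^sub>R X) \<in> N" using that subspace_N by (simp only: subspace_diff)
    moreover have "(p - t *\<^sub>R X) - (p - s *\<^sub>R X) = (s - t) *\<^sub>R X" by (simp add: algebra_simps)
    ultimately have "(s - t) *\<^sub>R X \<in> N" by simp
    then have "inverse (s - t) *\<^sub>R ((s - t) *\<^sub>R X) \<in> N" using subspace_N by (rule subspace_scale[rotated])
    with \<open>s \<noteq> t\<close> X show False by simp
  qed
  ultimately show ?thesis by blast
qed

lemma height_mem: "p - height N X p *\<^sub>R X \<in> N"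
  unfolding height_def by (rule theI'[OF ex_height])

lemma height_eqI: "p - t *\<^sub>R X \<in> N \<Longrightarrow> height N X p = t"
  using ex_height height_mem by blast

lemma linear_height: "linear (height N X)"
proof (rule linearI)
  show "height N X (x + y) = height N X x + height N X y" for x y
    by (rule height_eqI) (use subspace_add[OF subspace_N height_mem[of x] height_mem[of y]] in \<open>simp add: algebra_simps\<close>)
  show "height N X (r *\<^sub>R x) = r *\<^sub>R height N X x" for r x
    by (rule height_eqI) (use subspace_scale[OF subspace_N height_mem[of x], of r] in \<open>simp add: algebra_simps\<close>)
qed

lemma br_eq: "br u v = br X (height N X u *\<^sub>R v - height N X v *\<^sub>R u)"
proof -
  define a b where "a = u - height N X u *\<^sub>R X" and "b = v - height N X v *\<^sub>R X"
  have ab: "a \<in> N" "b \<in> N" "u = height N X u *\<^sub>R X + a" "v = height N X v *\<^sub>R X + b"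
    using height_mem by (auto simp: a_def b_def)
  have z: "br x x = 0" for x using lie by (simp add: lie_algebra_def)
  have s: "br x y = - br y x" for x y
    using z[of "x + y"] z[of x] z[of y] 
    by (simp add: linear_add[OF br_linear(1)] linear_add[OF br_linear(2)] eq_neg_iff_add_eq_0 add.commute)
  have "br u v = br (height N X u *\<^sub>R X + a) (height N X v *\<^sub>R X + b)" using ab(3,4) by simp
  also have "\<dots> = height N X u *\<^sub>R br X b - height N X v *\<^sub>R br X a"
    using ab(1,2) ideal z s[of a X]
    by (simp add: linear_add[OF br_linear(1)] linear_add[OF br_linear(2)]
        linear_scale[OF br_linear(1)] linear_scale[OF br_linear(2)] codim1_abelian_ideal_def)
  also have "\<dots> = br X (height N X u *\<^sub>R v - height N X v *\<^sub>R u)"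
    by (simp add: a_def b_def linear_diff[OF br_linear(1)] linear_scale[OF br_linear(1)] z)
  finally show ?thesis .
qed

lemma height_br: "height N X (br u v) = 0"
proof -
  have "height N X u *\<^sub>R v - height N X v *\<^sub>R u
       = height N X u *\<^sub>R (v - height N X v *\<^sub>R X) - height N X v *\<^sub>R (u - height N X u *\<^sub>R X)"
    by (simp add: algebra_simps)
  then have "height N X u *\<^sub>R v - height N X v *\<^sub>R u \<in> N"
    using height_mem subspace_N by (simp add: subspace_diff subspace_scale)
  then have "br u v \<in> N"
    using ideal by (subst br_eq) (auto simp: codim1_abelian_ideal_def)
  then show ?thesis by (intro height_eqI) simp
qed

lemma height_exp_lin: "height N X (exp_lin (\<lambda>v. t *\<^sub>R br X v) q) = height N X q"
proof -
  have bl: "bounded_linear (height N X)"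
    using linear_height by (simp add: linear_conv_bounded_linear)
  have "height N X (((\<lambda>v. t *\<^sub>R br X v) ^^ k) q /\<^sub>R fact k) = (if k = 0 then height N X q else 0)" for k
    by (cases k) (auto simp: linear_scale[OF linear_height] height_br)
  then have "(\<lambda>k. height N X (((\<lambda>v. t *\<^sub>R br X v) ^^ k) q /\<^sub>R fact k)) sums height N X q"
    using sums_single[of 0 "\<lambda>_. height N X q"] by simp
  then show ?thesis
    unfolding exp_lin_def
    by (simp only: bounded_linear.suminf[OF bl summable_exp_lin[OF linear_scaled[OF br_linear(1)]]]
        sums_unique[symmetric])
qed

lemma height_group_mult: "height N X (group_mult br N X p q) = height N X p + height N X q"
  by (simp add: group_mult_def linear_add[OF linear_height] height_exp_lin)

lemma group_mult_assoc:
  "group_mult br N X (group_mult br N X p q) r = group_mult br N X p (group_mult br N X q r)"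
  unfolding group_mult_def
  by (simp add: linear_add[OF linear_exp_lin[OF linear_scaled[OF br_linear(1)]]]
     linear_add[OF linear_height] height_exp_lin exp_lin_add[OF br_linear(1)] add.assoc)

lemma group_mult_identity: "group_mult br N X 0 q = q" "group_mult br N X p 0 = p"
  by (simp_all add: group_mult_def linear_0[OF linear_height] exp_lin_0
     linear_0[OF linear_exp_lin[OF linear_scaled[OF br_linear(1)]]] del: scaleR_zero_left)

lemma group_mult_inverse: "\<exists>q. group_mult br N X p q = 0 \<and> group_mult br N X q p = 0"
proof -
  have ex: "\<exists>q. group_mult br N X p q = 0" for p
  proof
    let ?t = "height N X p"
    have "exp_lin (\<lambda>v. ?t *\<^sub>R br X v) (exp_lin (\<lambda>v. (- ?t) *\<^sub>R br X v) (- p)) = - p"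
      using exp_lin_add[OF br_linear(1), where s = ?t and t = "- ?t"]
      by (simp only: add.right_inverse exp_lin_0)
    then show "group_mult br N X p (exp_lin (\<lambda>v. (- ?t) *\<^sub>R br X v) (- p)) = 0"
      by (simp only: group_mult_def add.right_inverse)
  qed
  then obtain q r where "group_mult br N X p q = 0" "group_mult br N X q r = 0" by metis
  then show ?thesis
    by (metis group_mult_assoc group_mult_identity)
qed

lemma left_diff_group_mult:
  "left_diff (group_mult br N X) p = exp_lin (\<lambda>v. height N X p *\<^sub>R br X v)"
proof -
  let ?E = "exp_lin (\<lambda>v. height N X p *\<^sub>R br X v)"
  have "bounded_linear ?E"
    using linear_exp_lin[OF linear_scaled[OF br_linear(1)]] by (simp add: linear_conv_bounded_linear)
  then have "(?E has_derivative ?E) (at 0)" by (rule bounded_linear_imp_has_derivative)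
  then have "(group_mult br N X p has_derivative ?E) (at 0)"
    unfolding group_mult_def [abs_def] by (auto intro!: derivative_eq_intros)
  then show ?thesis unfolding left_diff_def by (rule frechet_derivative_at[symmetric])
qed

text \<open>The commutator \<open>dV(U) - dU(V)\<close> of the left-invariant fields extending \<open>u\<close> and \<open>v\<close>.\<close>

lemma left_invariant_commutator:
  defines "L \<equiv> \<lambda>w p. left_diff (group_mult br N X) p w"
  shows "frechet_derivative (L v) (at p) (L u p) - frechet_derivative (L u) (at p) (L v p)
    = L (br u v) p"
proof -
  let ?T = "br X" and ?h = "height N X"
  let ?E = "\<lambda>t. exp_lin (\<lambda>v. t *\<^sub>R ?T v)"
  have bl: "bounded_linear ?h" using linear_height by (simp add: linear_conv_bounded_linear)
  have L: "L w = (\<lambda>p. ?E (?h p) w)" for w by (simp add: L_def left_diff_group_mult)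
  have D: "frechet_derivative (L w) (at p) = (\<lambda>y. ?h y *\<^sub>R ?T (?E (?h p) w))" for w
  proof -
    have "((\<lambda>p. ?E (?h p) w) has_derivative (\<lambda>y. ?h y *\<^sub>R ?T (?E (?h p) w))) (at p)"
      using has_derivative_compose[OF bounded_linear_imp_has_derivative[OF bl]
        has_vector_derivative_exp_lin[OF br_linear(1), unfolded has_vector_derivative_def]] .
    then show ?thesis unfolding L by (rule frechet_derivative_at[symmetric])
  qed
  have c: "?T (?E t w) = ?E t (?T w)" for t w
  proof -
    have bT: "bounded_linear ?T" using br_linear(1) by (simp add: linear_conv_bounded_linear)
    have "?T (((\<lambda>v. t *\<^sub>R ?T v) ^^ k) w) = ((\<lambda>v. t *\<^sub>R ?T v) ^^ k) (?T w)" for k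
      by (simp add: funpow_scaleR_linear[OF br_linear(1)] linear_scale[OF br_linear(1)] funpow_swap1)
    then show ?thesis
      unfolding exp_lin_def bounded_linear.suminf[OF bT summable_exp_lin[OF linear_scaled[OF br_linear(1)]]]
      by (simp add: linear_scale[OF br_linear(1)])
  qed
  have lE: "linear (?E t)" for t by (rule linear_exp_lin[OF linear_scaled[OF br_linear(1)]])
  show ?thesis unfolding D unfolding L height_exp_lin c br_eq[of u v]
    by (simp add: linear_diff[OF lE] linear_scale[OF lE] linear_diff[OF br_linear(1)] linear_scale[OF br_linear(1)])
qed

end


section \<open>Left-invariant metrics and their curvature\<close>

text \<open>
  A left-invariant metric is an inner product on the Lie algebra, regarded as a function of two
  arguments. The topology of the function type (pointwise convergence) induces on the
  finite-dimensional space of bilinear forms its usual topology.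
\<close>

definition inner_product :: "('a::euclidean_space \<Rightarrow> 'a \<Rightarrow> real) \<Rightarrow> bool" where
  "inner_product g \<longleftrightarrow> bilinear g \<and> (\<forall>x y. g x y = g y x) \<and> (\<forall>x. x \<noteq> 0 \<longrightarrow> g x x > 0)"

text \<open>The Levi-Civita connection on left-invariant fields, given by the Koszul formula.\<close>

definition levi_civita ::
    "('a::euclidean_space \<Rightarrow> 'a \<Rightarrow> 'a) \<Rightarrow> ('a \<Rightarrow> 'a \<Rightarrow> real) \<Rightarrow> 'a \<Rightarrow> 'a \<Rightarrow> 'a" where
  "levi_civita br g x y =
     (THE w. \<forall>z. 2 * g w z = g (br x y) z - g (br y z) x + g (br z x) y)"

definition curvature ::
    "('a::euclidean_space \<Rightarrow> 'a \<Rightarrow> 'a) \<Rightarrow> ('a \<Rightarrow> 'a \<Rightarrow> real) \<Rightarrow> 'a \<Rightarrow> 'a \<Rightarrow> 'a \<Rightarrow> 'a" where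
  "curvature br g x y z =
     levi_civita br g x (levi_civita br g y z) - levi_civita br g y (levi_civita br g x z)
       - levi_civita br g (br x y) z"

definition flat :: "('a::euclidean_space \<Rightarrow> 'a \<Rightarrow> 'a) \<Rightarrow> ('a \<Rightarrow> 'a \<Rightarrow> real) \<Rightarrow> bool" where
  "flat br g \<longleftrightarrow> (\<forall>x y z. curvature br g x y z = 0)"

definition endo_trace :: "('a::euclidean_space \<Rightarrow> 'a) \<Rightarrow> real" where
  "endo_trace T = (\<Sum>b\<in>Basis. T b \<bullet> b)"

definition ricci_tensor ::
    "('a::euclidean_space \<Rightarrow> 'a \<Rightarrow> 'a) \<Rightarrow> ('a \<Rightarrow> 'a \<Rightarrow> real) \<Rightarrow> 'a \<Rightarrow> 'a \<Rightarrow> real" where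
  "ricci_tensor br g y z = endo_trace (\<lambda>x. curvature br g x y z)"

definition ricci_operator ::
    "('a::euclidean_space \<Rightarrow> 'a \<Rightarrow> 'a) \<Rightarrow> ('a \<Rightarrow> 'a \<Rightarrow> real) \<Rightarrow> 'a \<Rightarrow> 'a" where
  "ricci_operator br g y = (THE w. \<forall>z. g w z = ricci_tensor br g y z)"

definition scalar_curvature ::
    "('a::euclidean_space \<Rightarrow> 'a \<Rightarrow> 'a) \<Rightarrow> ('a \<Rightarrow> 'a \<Rightarrow> real) \<Rightarrow> real" where
  "scalar_curvature br g = endo_trace (ricci_operator br g)"

definition ricci_pinching ::
    "('a::euclidean_space \<Rightarrow> 'a \<Rightarrow> 'a) \<Rightarrow> ('a \<Rightarrow> 'a \<Rightarrow> real) \<Rightarrow> real" where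
  "ricci_pinching br g =
     (scalar_curvature br g)\<^sup>2 / endo_trace (ricci_operator br g \<circ> ricci_operator br g)"

definition nonflat_metrics ::
    "('a::euclidean_space \<Rightarrow> 'a \<Rightarrow> 'a) \<Rightarrow> ('a \<Rightarrow> 'a \<Rightarrow> real) set" where
  "nonflat_metrics br = {g. inner_product g \<and> \<not> flat br g}"


section \<open>Solitons\<close>

definition solvsoliton ::
    "('a::euclidean_space \<Rightarrow> 'a \<Rightarrow> 'a) \<Rightarrow> ('a \<Rightarrow> 'a \<Rightarrow> real) \<Rightarrow> bool" where
  "solvsoliton br g \<longleftrightarrow> inner_product g \<and>
     (\<exists>c D. derivation br D \<and> (\<forall>x. ricci_operator br g x = c *\<^sub>R x + D x))"

text \<open>Iterated directional derivatives of a map between Euclidean spaces.\<close>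

primrec C_k :: "nat \<Rightarrow> ('a::euclidean_space \<Rightarrow> 'b::euclidean_space) \<Rightarrow> bool" where
  "C_k 0 f \<longleftrightarrow> continuous_on UNIV f"
| "C_k (Suc k) f \<longleftrightarrow> (\<forall>x. f differentiable at x) \<and>
     (\<forall>v. C_k k (\<lambda>x. frechet_derivative f (at x) v))"

definition smooth :: "('a::euclidean_space \<Rightarrow> 'b::euclidean_space) \<Rightarrow> bool" where
  "smooth f \<longleftrightarrow> (\<forall>k. C_k k f)"

definition complete_vector_field :: "('a::euclidean_space \<Rightarrow> 'a) \<Rightarrow> bool" where
  "complete_vector_field Y \<longleftrightarrow> smooth Y \<and>
     (\<forall>p. \<exists>\<gamma>. \<gamma> 0 = p \<and> (\<forall>t. (\<gamma> has_vector_derivative Y (\<gamma> t)) (at t)))"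

text \<open>
  \<open>(L\<^sub>Y G)(u, v) = Y (G (u, v)) - G ([Y, u], v) - G (u, [Y, v])\<close> with \<open>u\<close>, \<open>v\<close> extended to constant
  fields, for which \<open>[Y, u] = - dY(u)\<close>.
\<close>

definition lie_derivative ::
    "('a::euclidean_space \<Rightarrow> 'a) \<Rightarrow> ('a \<Rightarrow> 'a \<Rightarrow> 'a \<Rightarrow> real) \<Rightarrow> 'a \<Rightarrow> 'a \<Rightarrow> 'a \<Rightarrow> real" where
  "lie_derivative Y G p u v =
     frechet_derivative (\<lambda>q. G q u v) (at p) (Y p)
       + G p (frechet_derivative Y (at p) u) v + G p u (frechet_derivative Y (at p) v)"

definition ricci_soliton ::
    "('a::euclidean_space \<Rightarrow> 'a \<Rightarrow> 'a) \<Rightarrow> 'a set \<Rightarrow> 'a \<Rightarrow> ('a \<Rightarrow> 'a \<Rightarrow> real) \<Rightarrow> bool" where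
  "ricci_soliton br N X g \<longleftrightarrow> inner_product g \<and>
     (\<exists>c Y. complete_vector_field Y \<and>
        (\<forall>p u v. left_inv_field (group_mult br N X) (ricci_tensor br g) p u v =
            c * left_inv_field (group_mult br N X) g p u v
            + lie_derivative Y (left_inv_field (group_mult br N X) g) p u v))"


section \<open>Extrema on the set of non-flat metrics\<close>

definition local_maximum_on :: "'b::topological_space set \<Rightarrow> ('b \<Rightarrow> real) \<Rightarrow> 'b \<Rightarrow> bool" where
  "local_maximum_on C F g \<longleftrightarrow> g \<in> C \<and> (\<forall>\<^sub>F h in at g within C. F h \<le> F g)"

definition global_maximum_on :: "'b set \<Rightarrow> ('b \<Rightarrow> real) \<Rightarrow> 'b \<Rightarrow> bool" where
  "global_maximum_on C F g \<longleftrightarrow> g \<in> C \<and> (\<forall>h\<in>C. F h \<le> F g)"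

end

theory Submission
  imports Defs
begin

text \<open>
  Let \<open>\<nu>\<close> be a unit normal of \<open>N\<close> and \<open>A\<close> the matrix of \<open>ad \<nu>\<close> on \<open>N\<close> in an orthonormal basis, with
  symmetric part \<open>S\<close>. Then \<open>Ric = (- |S|\<^sup>2) \<oplus> ([A, A\<^sup>t] / 2 - (tr A) S)\<close>, so that \<open>F\<close> is a function of
  \<open>\<tau> = |S|\<^sup>2\<close>, \<open>tr A\<close> and \<open>M = [A, A\<^sup>t]\<close>, and changing the metric means conjugating \<open>A\<close>.

  At a local maximum the first variation gives \<open>[C, A\<^sup>t] = 0\<close> for \<open>C = [M, A] - \<rho> A\<close>, and the second
  variation in the direction \<open>M\<close> gives \<open>|[A, C]| \<le> (tr A)\<^sup>2 |M|\<close>. If \<open>tr A \<noteq> 0\<close>, comparing this with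
  \<open>tr [M, A]\<^sup>2 = \<langle>[A, C], M\<rangle>\<close> forces \<open>M = 0\<close>. If \<open>tr A = 0\<close>, then \<open>C\<close> commutes with \<open>A\<close> as well, and
  \<open>A = B + K\<close> with \<open>K\<close> skew, commuting with \<open>B\<close> and \<open>B\<^sup>t\<close>, and \<open>[[B, B\<^sup>t], B] = r B\<close>. Both kinds of metrics
  are Ricci solitons, as \<open>K\<close> does not change the metric up to isometry; the metric is a solvsoliton
  if and only if \<open>A\<close> is normal or \<open>K = 0\<close>. If \<open>K \<noteq> 0\<close>, then \<open>F\<close> has the same value at the metrics with
  matrix \<open>t B + K\<close>, \<open>t > 0\<close>, but these are not local maxima for large \<open>t\<close>: some symmetric \<open>P\<close> commutes
  with \<open>B\<close> and \<open>B\<^sup>t\<close> but not with \<open>K\<close>, and \<open>F\<close> increases in its direction.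

  Solvsolitons are global maxima by the Cauchy-Schwarz inequality against a symmetric \<open>R\<close>
  which has the eigenvalues of \<open>S\<close> (or of \<open>M\<close>) and, with respect to the other metric, the same flag
  of sums of eigenspaces. The same argument bounds \<open>F\<close> by its value for the semisimple part of \<open>A\<close>, and
  rescaling along the powers of the nilpotent part approaches this value.
\<close>

section \<open>The algebra of endomorphisms\<close>

text \<open>Endomorphisms of the ideal are extended by zero to the normal line. Thus all metrics are
  described in one algebra with one inner product: a change of metric is a conjugation by some
  \<open>h\<close> with inverse \<open>k\<close>, and a rescaling of the normal is a factor which
  \<open>pinch\<close> ignores. No classification of Ricci solitons is needed for (iii): a Ricci
  soliton that is not a solvsoliton either fails to be a local maximum, or has K \<noteq> 0 and can
  be deformed. As the deformation keeps F, it also shows that such a metric is no global maximum,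
  which is the harder half of (ii). The bound on [A, C] gives commutation only when tr A = 0, so the
  trace has to be shown to vanish before A can be split. In (iv), real type provides an eigenvalue:
  a nilpotent matrix always admits a nilsoliton, so without a solvsoliton A is not nilpotent and has
  an eigenvalue with nonzero real part. The semisimple part inherits it, which makes its solvsoliton
  normal and non-flat. The nilpotent part L satisfies tr L = tr (L S) = 0 there, so it is invisible
  to the Cauchy-Schwarz argument.\<close>

typedef (overloaded) 'a endo = "{f :: 'a::euclidean_space \<Rightarrow> 'a. linear f}" morphisms app Endo
  by (auto intro: exI[of _ id] linear_id)

setup_lifting type_definition_endo

lemma linear_app: "linear (app a)"
  using app by blast

lemma app_Endo: "linear f \<Longrightarrow> app (Endo f) = f"
  by (simp add: Endo_inverse)

lemma endo_eqI: "(\<And>x. app a x = app b x) \<Longrightarrow> a = b"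
  by (simp add: app_inject[symmetric] fun_eq_iff)

instantiation endo :: (euclidean_space) real_algebra_1
begin

lift_definition zero_endo :: "'a endo" is "\<lambda>x. 0" by (rule linear_zero)
lift_definition one_endo :: "'a endo" is "\<lambda>x. x" by (rule linear_ident)
lift_definition plus_endo :: "'a endo \<Rightarrow> 'a endo \<Rightarrow> 'a endo" is "\<lambda>f g x. f x + g x"
  by (rule linear_compose_add)
lift_definition minus_endo :: "'a endo \<Rightarrow> 'a endo \<Rightarrow> 'a endo" is "\<lambda>f g x. f x - g x"
  by (rule linear_compose_sub)
lift_definition uminus_endo :: "'a endo \<Rightarrow> 'a endo" is "\<lambda>f x. - f x"
  by (rule linear_compose_neg)
lift_definition times_endo :: "'a endo \<Rightarrow> 'a endo \<Rightarrow> 'a endo" is "\<lambda>f g x. f (g x)"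
  using linear_compose by (auto simp: o_def)
lift_definition scaleR_endo :: "real \<Rightarrow> 'a endo \<Rightarrow> 'a endo" is "\<lambda>r f x. r *\<^sub>R f x"
  by (rule linear_scaled)

instance
proof
  show "(0::'a endo) \<noteq> 1"
    by transfer (metis SOME_Basis norm_Basis norm_zero zero_neq_one)
qed (transfer; auto simp: linear_add linear_scale algebra_simps)+

end

lemma app_simps [simp]:
  "app 0 x = 0" "app 1 x = x" "app (a + b) x = app a x + app b x" "app (a - b) x = app a x - app b x"
  "app (- a) x = - app a x" "app (a * b) x = app a (app b x)" "app (r *\<^sub>R a) x = r *\<^sub>R app a x"
  by (transfer; simp)+

lemma app_linear [simp]:
  "app a 0 = 0" "app a (x + y) = app a x + app a y" "app a (x - y) = app a x - app a y"
  "app a (- x) = - app a x" "app a (r *\<^sub>R x) = r *\<^sub>R app a x"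
  by (simp_all add: linear_0 linear_add linear_diff linear_neg linear_scale linear_app)

lemma app_sum: "app a (\<Sum>i\<in>I. f i) = (\<Sum>i\<in>I. app a (f i))"
  by (rule linear_sum[OF linear_app])

lemma app_sum_left: "app (\<Sum>i\<in>I. f i) x = (\<Sum>i\<in>I. app (f i) x)"
  by (induction I rule: infinite_finite_induct) auto

lift_definition tp :: "'a::euclidean_space endo \<Rightarrow> 'a endo" is adjoint
  by (rule adjoint_linear)

lemma app_tp: "app (tp a) x \<bullet> y = x \<bullet> app a y"
  by transfer (simp add: adjoint_clauses)

lemma app_tp': "x \<bullet> app (tp a) y = app a x \<bullet> y"
  by transfer (simp add: adjoint_clauses)

lemma tp_eqI:
  assumes "\<And>x y. app a x \<bullet> y = x \<bullet> app b y" shows "tp a = b"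
proof (rule endo_eqI)
  fix x
  have "(app (tp a) x - app b x) \<bullet> y = 0" for y
    using assms[of y x] by (simp add: inner_diff_left app_tp) (metis inner_commute)
  then show "app (tp a) x = app b x" by (metis eq_iff_diff_eq_0 inner_eq_zero_iff)
qed

lemma tp_simps [simp]:
  "tp (tp a) = a" "tp 0 = 0" "tp 1 = 1" "tp (a + b) = tp a + tp b" "tp (a - b) = tp a - tp b"
  "tp (- a) = - tp a" "tp (a * b) = tp b * tp a" "tp (r *\<^sub>R a) = r *\<^sub>R tp a"
  by (rule tp_eqI; simp add: app_tp app_tp' inner_simps)+

lemma norm_square_Basis: "(norm x)\<^sup>2 = (\<Sum>b\<in>Basis. (x \<bullet> b)\<^sup>2)"
  unfolding power2_norm_eq_inner euclidean_inner[of x x] by (simp add: power2_eq_square)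

section \<open>Trace and Frobenius inner product\<close>

definition tr :: "'a::euclidean_space endo \<Rightarrow> real" where
  "tr a = endo_trace (app a)"

lemma tr_alt: "tr a = (\<Sum>b\<in>Basis. app a b \<bullet> b)"
  by (simp add: tr_def endo_trace_def)

lemma tr_simps [simp]:
  "tr 0 = 0" "tr (a + b) = tr a + tr b" "tr (a - b) = tr a - tr b" "tr (- a) = - tr a"
  "tr (r *\<^sub>R a) = r * tr a" "tr (tp a) = tr a"
  by (simp_all add: tr_alt inner_simps sum.distrib sum_subtractf sum_negf sum_distrib_left app_tp)
    (simp add: inner_commute)

lemma tr_mult_alt: "tr (a * b) = (\<Sum>i\<in>Basis. \<Sum>j\<in>Basis. (app b i \<bullet> j) * (app a j \<bullet> i))"
proof -
  have "app a (app b i) \<bullet> i = (\<Sum>j\<in>Basis. (app b i \<bullet> j) * (app a j \<bullet> i))" for i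
  proof -
    have "app a (app b i) = app a (\<Sum>j\<in>Basis. (app b i \<bullet> j) *\<^sub>R j)"
      by (simp add: euclidean_representation)
    then show ?thesis by (simp add: app_sum inner_sum_left)
  qed
  then show ?thesis by (simp add: tr_alt)
qed

lemma tr_commute: "tr (a * b) = tr (b * a)"
  unfolding tr_mult_alt by (subst sum.swap) (simp add: mult.commute)

instantiation endo :: (euclidean_space) real_inner
begin

definition inner_endo_def: "inner a b = tr (a * tp b)" for a b :: "'a endo"
definition norm_endo_def: "norm a = sqrt (inner a a)" for a :: "'a endo"
definition dist_endo_def: "dist a b = norm (a - b)" for a b :: "'a endo"
definition sgn_endo_def: "sgn a = a /\<^sub>R norm a" for a :: "'a endo"
definition uniformity_endo_def:
  "uniformity = (INF e\<in>{0 <..}. principal {(a, b :: 'a endo). dist a b < e})"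
definition open_endo_def:
  "open U \<longleftrightarrow> (\<forall>a\<in>U. eventually (\<lambda>(a', b). a' = a \<longrightarrow> b \<in> U) uniformity)" for U :: "'a endo set"

lemma inner_endo_self: "inner a a = (\<Sum>b\<in>Basis. (norm (app a b))\<^sup>2)" for a :: "'a endo"
  unfolding inner_endo_def tr_commute[of a]
  by (simp add: tr_alt app_tp power2_norm_eq_inner)

instance
proof
  fix a b c :: "'a endo" and r :: real
  show "inner a b = inner b a"
    unfolding inner_endo_def by (metis tp_simps(1) tp_simps(7) tr_simps(6))
  show "inner (a + b) c = inner a c + inner b c" "inner (r *\<^sub>R a) b = r * inner a b"
    by (simp_all add: inner_endo_def algebra_simps)
  show "0 \<le> inner a a" by (simp add: inner_endo_self sum_nonneg)
  show "(inner a a = 0) = (a = 0)"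
  proof
    assume "inner a a = 0"
    then have z: "\<forall>b\<in>Basis. app a b = 0"
      by (simp add: inner_endo_self sum_nonneg_eq_0_iff)
    show "a = 0"
    proof (rule endo_eqI)
      fix x
      have "app a x = app a (\<Sum>j\<in>Basis. (x \<bullet> j) *\<^sub>R j)" by (simp add: euclidean_representation)
      then show "app a x = app 0 x" using z by (simp add: app_sum)
    qed
  qed (simp add: inner_endo_def)
qed (simp_all add: norm_endo_def dist_endo_def sgn_endo_def uniformity_endo_def open_endo_def)

end

lemma norm_square_endo: "(norm a)\<^sup>2 = (\<Sum>b\<in>Basis. (norm (app a b))\<^sup>2)"
  for a :: "'a::euclidean_space endo"
  unfolding power2_norm_eq_inner[of a] by (rule inner_endo_self)

lemma inner_tp_tp [simp]: "inner (tp a) (tp b) = inner a b" for a :: "'a::euclidean_space endo"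
  by (metis inner_commute inner_endo_def tp_simps(1) tr_commute)

lemma norm_tp [simp]: "norm (tp a) = norm a" for a :: "'a::euclidean_space endo"
  by (simp add: norm_endo_def)

lemma norm_app_le: "norm (app a x) \<le> norm a * norm x"
proof -
  have "(norm (app a x))\<^sup>2 = (\<Sum>b\<in>Basis. (app a x \<bullet> b)\<^sup>2)"
    by (simp add: norm_square_Basis)
  also have "\<dots> = (\<Sum>b\<in>Basis. (x \<bullet> app (tp a) b)\<^sup>2)"
    by (simp add: app_tp')
  also have "\<dots> \<le> (\<Sum>b\<in>Basis. (norm x)\<^sup>2 * (norm (app (tp a) b))\<^sup>2)"
    by (intro sum_mono) (metis Cauchy_Schwarz_ineq power2_norm_eq_inner)
  also have "\<dots> = (norm (tp a) * norm x)\<^sup>2"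
    by (simp only: power_mult_distrib norm_square_endo[of "tp a"] sum_distrib_right mult.commute[of "(norm x)\<^sup>2"])
  finally show ?thesis by (rule power2_le_imp_le[OF ord_le_eq_trans]) (simp_all add: power_mult_distrib)
qed

text \<open>The class does not prescribe the norm of the unit: in the Frobenius norm the identity
  has norm sqrt DIM.\<close>

instance endo :: (euclidean_space) real_normed_algebra
proof
  fix a b :: "'a endo"
  have "(norm (a * b))\<^sup>2 = (\<Sum>i\<in>Basis. (norm (app a (app b i)))\<^sup>2)"
    unfolding norm_square_endo[of "a * b"] by simp
  also have "\<dots> \<le> (\<Sum>i\<in>Basis. (norm a)\<^sup>2 * (norm (app b i))\<^sup>2)"
    by (intro sum_mono) (metis norm_app_le norm_ge_zero power_mono power_mult_distrib)
  also have "\<dots> = (norm a * norm b)\<^sup>2"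
    by (simp only: power_mult_distrib norm_square_endo[of b] sum_distrib_left)
  finally show "norm (a * b) \<le> norm a * norm b" by (rule power2_le_imp_le) simp
qed

lemma abs_tr_le: "\<bar>tr a\<bar> \<le> norm (1::'a endo) * norm a" for a :: "'a::euclidean_space endo"
proof -
  have "tr a = inner a 1" by (simp add: inner_endo_def)
  then show ?thesis by (metis Cauchy_Schwarz_ineq2 mult.commute)
qed

lemma bounded_linear_tr: "bounded_linear tr"
  by (rule bounded_linear_intro[of _ "norm (1::'a::euclidean_space endo)"])
    (use abs_tr_le in \<open>auto simp: mult.commute\<close>)

lemma bounded_linear_tp: "bounded_linear tp"
  by (rule bounded_linear_intro[of _ 1]) auto

lift_definition outer :: "'a::euclidean_space \<Rightarrow> 'a \<Rightarrow> 'a endo" is "\<lambda>u v x. (x \<bullet> v) *\<^sub>R u"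
  by (rule linearI) (auto simp: inner_simps algebra_simps)

lemma app_outer [simp]: "app (outer u v) x = (x \<bullet> v) *\<^sub>R u"
  by transfer simp

lemma bounded_linear_outer: "bounded_linear (\<lambda>u. outer u v)"
proof -
  have "linear (\<lambda>u. outer u v)"
    by (rule linearI; rule endo_eqI) (auto simp: algebra_simps)
  moreover have "norm (outer u v) \<le> norm u * norm v" for u
  proof -
    have "(norm (outer u v))\<^sup>2 = (\<Sum>b\<in>Basis. (b \<bullet> v)\<^sup>2 * (norm u)\<^sup>2)"
      unfolding norm_square_endo by (simp add: power_mult_distrib)
    also have "\<dots> = (norm u * norm v)\<^sup>2"
      by (simp add: sum_distrib_right[symmetric] norm_square_Basis[of v]
          power_mult_distrib inner_commute[of v] mult.commute[of "(norm u)\<^sup>2"])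
    finally have "norm (outer u v) = norm u * norm v" by (simp add: power2_eq_iff_nonneg)
    then show ?thesis by simp
  qed
  ultimately show ?thesis
    by (metis bounded_linear_axioms.intro bounded_linear.intro)
qed

lemma endo_eq_sum_outer: "a = (\<Sum>b\<in>Basis. outer (app a b) b)"
proof (rule endo_eqI)
  fix x
  have "app a x = app a (\<Sum>j\<in>Basis. (x \<bullet> j) *\<^sub>R j)" by (simp add: euclidean_representation)
  then show "app a x = app (\<Sum>b\<in>Basis. outer (app a b) b) x"
    by (simp add: app_sum app_sum_left)
qed

text \<open>An endomorphism is a finite sum of rank-one maps, each depending linearly on one of its
  values, so differentiability at every vector gives differentiability in norm.\<close>

lemma has_vector_derivative_endoI:
  fixes P :: "real \<Rightarrow> 'a::euclidean_space endo"
  assumes "\<And>v. ((\<lambda>t. app (P t) v) has_vector_derivative app P' v) (at t)"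
  shows "(P has_vector_derivative P') (at t)"
proof -
  have "((\<lambda>t. \<Sum>b\<in>Basis. outer (app (P t) b) b) has_vector_derivative
     (\<Sum>b\<in>Basis. outer (app P' b) b)) (at t)"
    by (intro has_vector_derivative_sum bounded_linear.has_vector_derivative[OF bounded_linear_outer] assms)
  then show ?thesis by (simp add: endo_eq_sum_outer[symmetric])
qed

section \<open>Commutators and symmetric parts\<close>

definition cm :: "'a::euclidean_space endo \<Rightarrow> 'a endo \<Rightarrow> 'a endo" where
  "cm a b = a * b - b * a"

definition sy :: "'a::euclidean_space endo \<Rightarrow> 'a endo" where
  "sy a = (1/2) *\<^sub>R (a + tp a)"

lemma cm_linear:
  "cm (a + b) c = cm a c + cm b c" "cm (a - b) c = cm a c - cm b c" "cm (- a) c = - cm a c"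
  "cm a (b + c) = cm a b + cm a c" "cm a (b - c) = cm a b - cm a c" "cm a (- b) = - cm a b"
  "cm (r *\<^sub>R a) c = r *\<^sub>R cm a c" "cm a (r *\<^sub>R c) = r *\<^sub>R cm a c"
  "cm 0 a = 0" "cm a 0 = 0" "cm a a = 0"
  by (simp_all add: cm_def algebra_simps)

lemma tp_cm: "tp (cm a b) = cm (tp b) (tp a)"
  by (simp add: cm_def)

lemma cm_swap: "cm a b = - cm b a"
  by (simp add: cm_def)

lemma cm_jacobi: "cm a (cm b c) = cm (cm a b) c + cm b (cm a c)"
  by (simp add: cm_def algebra_simps)

lemma tr_cm [simp]: "tr (cm a b) = 0"
  by (simp add: cm_def tr_commute)

lemma tr_cm_mult: "tr (cm a b * c) = tr (a * cm b c)"
  by (simp add: cm_def algebra_simps) (metis mult.assoc tr_commute)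

text \<open>For the Frobenius product the adjoint of the commutator with \<open>a\<close> is the
  commutator with \<open>tp a\<close>. Together with the Jacobi identity this carries most
  computations below.\<close>

lemma inner_cm_left: "inner (cm x a) b = inner x (cm b (tp a))"
proof -
  have "tr (a * x * tp b) = tr (x * (tp b * a))" by (metis mult.assoc tr_commute)
  then show ?thesis by (simp add: inner_endo_def cm_def algebra_simps)
qed

lemma inner_cm_right: "inner (cm x a) b = inner a (cm (tp x) b)"
proof -
  have "tr (a * x * tp b) = tr (a * (x * tp b))" "tr (x * a * tp b) = tr (a * (tp b * x))"
    by (metis mult.assoc tr_commute)+
  then show ?thesis by (simp add: inner_endo_def cm_def algebra_simps)
qed

lemma inner_tp_left: "inner (tp a) b = inner a (tp b)" for a :: "'a::euclidean_space endo"
  by (metis inner_tp_tp tp_simps(1))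

lemma tp_sy [simp]: "tp (sy a) = sy a"
  by (simp add: sy_def add.commute)

lemma inner_sy: "tp b = b \<Longrightarrow> inner (sy a) b = inner a b"
  by (simp add: sy_def inner_simps inner_tp_left)

lemma norm_sy_le: "norm (sy a) \<le> norm a"
proof -
  have "norm (sy a) = (1/2) * norm (a + tp a)" by (simp add: sy_def)
  also have "\<dots> \<le> (1/2) * (norm a + norm (tp a))" by (intro mult_left_mono norm_triangle_ineq) auto
  finally show ?thesis by simp
qed

section \<open>The pinching functional as a function of the matrix\<close>

definition tau :: "'a::euclidean_space endo \<Rightarrow> real" where
  "tau a = (norm (sy a))\<^sup>2"

text \<open>The moment map of the conjugation action: |A|^2 / 2 has derivative
  \<open>inner E (mom A)\<close> in a symmetric direction E.\<close>

definition mom :: "'a::euclidean_space endo \<Rightarrow> 'a endo" where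
  "mom a = cm a (tp a)"

text \<open>The numerator is scal^2, as scal = - (tau + (tr A)^2), and the denominator is
  |Ric|^2.\<close>

definition pinch :: "'a::euclidean_space endo \<Rightarrow> real" where
  "pinch a = (tau a + (tr a)\<^sup>2)\<^sup>2 / (tau a * (tau a + (tr a)\<^sup>2) + (norm (mom a))\<^sup>2 / 4)"

text \<open>Of the two summands only the norm changes under conjugation.\<close>

lemma tau_alt: "tau a = (1/2) * (tr (a * a) + (norm a)\<^sup>2)"
proof -
  have "inner (sy a) (sy a) = inner (sy a) a" by (metis inner_commute inner_sy tp_sy)
  also have "\<dots> = (1/2) * (inner a a + inner (tp a) a)" by (simp add: sy_def inner_simps)
  also have "inner (tp a) a = tr (a * a)"
    by (metis inner_commute inner_endo_def tp_simps(1))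
  finally show ?thesis by (simp add: tau_def power2_norm_eq_inner)
qed

lemma tp_mom [simp]: "tp (mom a) = mom a"
  by (simp add: mom_def tp_cm)

lemma tau_nonneg [simp]: "tau a \<ge> 0" by (simp add: tau_def)

lemma tau_pos_iff: "tau a > 0 \<longleftrightarrow> sy a \<noteq> 0" by (simp add: tau_def)

lemma pinch_traceless:
  assumes "tr A = 0" "tau A = x / 2" "x > 0"
  shows "pinch A = 1 / (1 + (norm (mom A))\<^sup>2 / x\<^sup>2)"
proof -
  define y where "y = (norm (mom A))\<^sup>2"
  have "x * x + y > 0" using assms(3) by (simp add: y_def add_pos_nonneg)
  then have "(x / 2)\<^sup>2 / (x / 2 * (x / 2) + y / 4) = 1 / (1 + y / x\<^sup>2)"
    using assms(3) by (simp add: field_simps power2_eq_square)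
  then show ?thesis unfolding pinch_def assms(1,2) zero_power2 add_0_right y_def .
qed

lemma mom_scaleR: "mom (r *\<^sub>R a) = r\<^sup>2 *\<^sub>R mom a"
  by (simp add: mom_def cm_linear power2_eq_square)

lemma tau_scaleR: "tau (r *\<^sub>R a) = r\<^sup>2 * tau a"
proof -
  have "sy (r *\<^sub>R a) = r *\<^sub>R sy a" by (simp add: sy_def algebra_simps)
  then show ?thesis by (simp add: tau_def power_mult_distrib)
qed

text \<open>Numerator and denominator are homogeneous of degree 4. This absorbs the factor by which
  the unit normals of two metrics differ modulo the ideal.\<close>

lemma pinch_scaleR:
  assumes "r \<noteq> 0" shows "pinch (r *\<^sub>R a) = pinch a"
proof -
  have "tau (r *\<^sub>R a) + (tr (r *\<^sub>R a))\<^sup>2 = r\<^sup>2 * (tau a + (tr a)\<^sup>2)"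
    by (simp add: tau_scaleR power_mult_distrib algebra_simps)
  moreover have "(norm (mom (r *\<^sub>R a)))\<^sup>2 = (r\<^sup>2)\<^sup>2 * (norm (mom a))\<^sup>2"
    by (simp add: mom_scaleR power_mult_distrib)
  ultimately have "pinch (r *\<^sub>R a) = ((r\<^sup>2)\<^sup>2 * (tau a + (tr a)\<^sup>2)\<^sup>2) /
      (r\<^sup>2 * tau a * (r\<^sup>2 * (tau a + (tr a)\<^sup>2)) + (r\<^sup>2)\<^sup>2 * (norm (mom a))\<^sup>2 / 4)"
    unfolding pinch_def by (simp only: tau_scaleR power_mult_distrib)
  also have "r\<^sup>2 * tau a * (r\<^sup>2 * (tau a + (tr a)\<^sup>2)) + (r\<^sup>2)\<^sup>2 * (norm (mom a))\<^sup>2 / 4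
      = (r\<^sup>2)\<^sup>2 * (tau a * (tau a + (tr a)\<^sup>2) + (norm (mom a))\<^sup>2 / 4)"
    by algebra
  also have "(r\<^sup>2)\<^sup>2 * (tau a + (tr a)\<^sup>2)\<^sup>2 / \<dots> = pinch a"
    unfolding pinch_def using assms by (subst mult_divide_mult_cancel_left) auto
  finally show ?thesis .
qed

section \<open>Variation along one-parameter groups\<close>

definition expo :: "'a::euclidean_space endo \<Rightarrow> real \<Rightarrow> 'a endo" where
  "expo E t = Endo (exp_lin (\<lambda>v. t *\<^sub>R app E v))"

lemma app_expo: "app (expo E t) = exp_lin (\<lambda>v. t *\<^sub>R app E v)"
  unfolding expo_def by (rule app_Endo) (intro linear_exp_lin linear_scaled linear_app)

lemma expo_deriv_app:
  "((\<lambda>t. app (expo E t) v) has_vector_derivative app E (app (expo E t) v)) (at t)"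
  unfolding app_expo by (rule has_vector_derivative_exp_lin[OF linear_app])

lemma expo_deriv: "(expo E has_vector_derivative E * expo E t) (at t)"
  by (rule has_vector_derivative_endoI) (simp add: expo_deriv_app)

lemma expo_0 [simp]: "expo E 0 = 1"
  by (rule endo_eqI) (simp only: app_expo exp_lin_0 app_simps)

lemma expo_add: "expo E (s + t) = expo E s * expo E t"
  by (rule endo_eqI) (simp add: app_expo exp_lin_add[OF linear_app])

lemma expo_inverse: "expo E t * expo E (- t) = 1" "expo E (- t) * expo E t = 1"
  by (simp_all add: expo_add[symmetric])

text \<open>The hypothesis says [E, B] = c B; applied to a vector, both sides solve f' = E f with
  the same initial value.\<close>

lemma expo_intertwine:
  assumes "E * B = B * (E + c *\<^sub>R 1)"
  shows "expo E t * B = exp (c * t) *\<^sub>R (B * expo E t)"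
proof (rule endo_eqI)
  fix v
  let ?f = "\<lambda>t. app (expo E t) (app B v) - exp (c * t) *\<^sub>R app B (app (expo E t) v)"
  have "?f t = 0"
  proof (rule linear_ode_unique[OF linear_app])
    fix s
    have d1: "((\<lambda>t. app B (app (expo E t) v)) has_vector_derivative app B (app E (app (expo E s) v))) (at s)"
      by (intro bounded_linear.has_vector_derivative[OF _ expo_deriv_app])
        (simp add: linear_conv_bounded_linear[symmetric] linear_app)
    have d2: "((\<lambda>t. exp (c * t)) has_real_derivative c * exp (c * s)) (at s)"
      by (auto intro!: derivative_eq_intros)
    have d3: "((\<lambda>t. exp (c * t) *\<^sub>R app B (app (expo E t) v)) has_vector_derivative
        exp (c * s) *\<^sub>R app B (app E (app (expo E s) v)) + (c * exp (c * s)) *\<^sub>R app B (app (expo E s) v)) (at s)"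
      by (rule has_vector_derivative_scaleR[OF d2 d1])
    have EB: "app E (app B w) = app B (app E w) + c *\<^sub>R app B w" for w
      using arg_cong[OF assms, of "\<lambda>z. app z w"] by simp
    from has_vector_derivative_diff[OF expo_deriv_app d3]
    show "(?f has_vector_derivative app E (?f s)) (at s)"
      by (rule has_vector_derivative_eq_rhs) (simp add: EB algebra_simps)
  qed simp
  then show "app (expo E t * B) v = app (exp (c * t) *\<^sub>R (B * expo E t)) v" by simp
qed

lemma expo_commute: "E * B = B * E \<Longrightarrow> expo E t * B = B * expo E t"
  using expo_intertwine[of E B 0] by simp

lemma tp_expo:
  assumes "tp E = E" shows "tp (expo E t) = expo E t"
proof (rule tp_eqI)
  fix x y
  \<comment> \<open>This function of \<open>s\<close> is constant, and its values at
    \<open>t\<close> and 0 are the two sides of the claim.\<close>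
  let ?f = "\<lambda>s. app (expo E s) x \<bullet> app (expo E (t - s)) y"
  have d: "((\<lambda>s. app (expo E (t - s)) y) has_vector_derivative - app E (app (expo E (t - s)) y)) (at s)" for s
  proof -
    have "((\<lambda>s. t - s) has_vector_derivative - 1) (at s)"
      by (auto intro!: derivative_eq_intros)
    from vector_diff_chain_at[OF this expo_deriv_app] show ?thesis by (simp add: o_def)
  qed
  have "(?f has_real_derivative 0) (at s)" for s
  proof -
    have sE: "app E u \<bullet> v = u \<bullet> app E v" for u v using app_tp[of E u v] assms by simp
    have "(?f has_vector_derivative app (expo E s) x \<bullet> - app E (app (expo E (t - s)) y)
      + app E (app (expo E s) x) \<bullet> app (expo E (t - s)) y) (at s)"
      by (rule bounded_bilinear.has_vector_derivative[OF bounded_bilinear_inner expo_deriv_app d])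
    then show ?thesis by (simp add: has_real_derivative_iff_has_vector_derivative sE)
  qed
  then have "?f t = ?f 0"
    by (intro DERIV_isconst_all) auto
  then show "app (expo E t) x \<bullet> y = x \<bullet> app (expo E t) y" by simp
qed

definition orbit :: "'a::euclidean_space endo \<Rightarrow> 'a endo \<Rightarrow> real \<Rightarrow> 'a endo" where
  "orbit E A t = expo E t * A * expo E (- t)"

lemma orbit_0 [simp]: "orbit E A 0 = A" by (simp add: orbit_def)

lemma orbit_deriv: "(orbit E A has_vector_derivative cm E (orbit E A t)) (at t)"
proof -
  have d: "((\<lambda>s. expo E (- s)) has_vector_derivative - (E * expo E (- t))) (at t)"
  proof -
    have "(uminus has_vector_derivative - 1) (at t)"
      by (auto intro!: derivative_eq_intros)
    from vector_diff_chain_at[OF this expo_deriv] show ?thesis by (simp add: o_def)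
  qed
  have "((\<lambda>t. expo E t * A) has_vector_derivative E * expo E t * A) (at t)"
    by (rule bounded_linear.has_vector_derivative[OF bounded_linear_mult_left expo_deriv])
  from has_vector_derivative_mult[OF this d]
  have "(orbit E A has_vector_derivative expo E t * A * - (E * expo E (- t)) + E * expo E t * A * expo E (- t)) (at t)"
    unfolding orbit_def[abs_def] .
  moreover have "expo E (- t) * E = E * expo E (- t)" by (rule expo_commute) simp
  ultimately show ?thesis by (simp add: cm_def orbit_def mult.assoc)
qed

lemma tr_orbit_mult: "tr (orbit E A t * orbit E B t) = tr (A * B)"
proof -
  have "orbit E A t * orbit E B t = expo E t * (A * B) * expo E (- t)"
    by (simp add: orbit_def mult.assoc) (metis expo_inverse(2) mult.assoc mult_1)
  then show ?thesis by (metis expo_inverse(2) mult.assoc mult_1 tr_commute)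
qed

lemma tr_orbit: "tr (orbit E A t) = tr A"
  by (metis expo_inverse(2) mult.assoc mult_1 tr_commute orbit_def)


lemma second_derivative_test:
  fixes H :: "real \<Rightarrow> real"
  assumes H: "\<And>t. (H has_real_derivative H1 t) (at t)" and D: "(H1 has_real_derivative D) (at 0)"
    and min: "\<forall>\<^sub>F t in at 0. H 0 \<le> H t"
  shows "H1 0 = 0" "D \<ge> 0"
proof -
  obtain e where e: "e > 0" "\<And>t. \<bar>t\<bar> < e \<Longrightarrow> H 0 \<le> H t"
  proof -
    obtain e where "e > 0" "\<forall>t. t \<noteq> 0 \<and> \<bar>t\<bar> < e \<longrightarrow> H 0 \<le> H t"
      using min by (auto simp: eventually_at dist_real_def)
    then show thesis by (metis order_refl that)
  qed
  show "H1 0 = 0"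
    by (rule DERIV_local_min[OF H e(1)]) (use e(2) in auto)
  show "D \<ge> 0"
  proof (rule ccontr)
    assume "\<not> D \<ge> 0"
    then have "D < 0" by simp
    from DERIV_neg_dec_right[OF D this] obtain d where d: "d > 0" "\<And>h. 0 < h \<Longrightarrow> h < d \<Longrightarrow> H1 h < 0"
      using \<open>H1 0 = 0\<close> by auto
    define h where "h = min d e / 2"
    have h: "0 < h" "h < d" "h < e" using d e by (auto simp: h_def)
    have "H h < H 0"
    proof (rule DERIV_neg_imp_decreasing_open[OF h(1)])
      show "\<exists>y. (H has_real_derivative y) (at x) \<and> y < 0" if "0 < x" "x < h" for x
        using H d(2)[of x] that h by force
      show "continuous_on {0..h} H"
        by (rule DERIV_continuous_on) (use H has_field_derivative_at_within in blast)
    qed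
    with e(2)[of h] h show False by auto
  qed
qed

lemma has_vector_derivative_cm:
  assumes "(P has_vector_derivative P') (at t)" "(R has_vector_derivative R') (at t)"
  shows "((\<lambda>t. cm (P t) (R t)) has_vector_derivative cm P' (R t) + cm (P t) R') (at t)"
  unfolding cm_def
  by (rule has_vector_derivative_eq_rhs[OF has_vector_derivative_diff[OF
        has_vector_derivative_mult[OF assms] has_vector_derivative_mult[OF assms(2,1)]]]) simp

lemma has_real_derivative_inner_endo:
  fixes P R :: "real \<Rightarrow> 'a::euclidean_space endo"
  assumes "(P has_vector_derivative P') (at t)" "(R has_vector_derivative R') (at t)"
  shows "((\<lambda>t. inner (P t) (R t)) has_real_derivative inner (P t) R' + inner P' (R t)) (at t)"
  using bounded_bilinear.has_vector_derivative[OF bounded_bilinear_inner assms]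
  by (simp add: has_real_derivative_iff_has_vector_derivative)

definition dmom :: "'a::euclidean_space endo \<Rightarrow> 'a endo \<Rightarrow> 'a endo" where
  "dmom E A = cm (cm E A) (tp A) + cm A (tp (cm E A))"

context
  fixes E A :: "'a::euclidean_space endo"
  assumes E: "tp E = E"
begin

lemma mom_orbit_deriv:
  "((\<lambda>t. mom (orbit E A t)) has_vector_derivative dmom E (orbit E A t)) (at t)"
  unfolding mom_def dmom_def
  by (intro has_vector_derivative_cm orbit_deriv
      bounded_linear.has_vector_derivative[OF bounded_linear_tp])

lemma tau_orbit_deriv:
  "((\<lambda>t. tau (orbit E A t)) has_real_derivative inner (cm E (orbit E A t)) (orbit E A t)) (at t)"
proof -
  have "tau (orbit E A t) = (1/2) * (tr (A * A) + inner (orbit E A t) (orbit E A t))" for t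
    by (simp add: tau_alt tr_orbit_mult power2_norm_eq_inner)
  moreover have "((\<lambda>t. (1/2) * (tr (A * A) + inner (orbit E A t) (orbit E A t)))
      has_real_derivative inner (cm E (orbit E A t)) (orbit E A t)) (at t)"
    by (rule derivative_eq_intros has_real_derivative_inner_endo orbit_deriv refl)+
      (simp add: inner_commute)
  ultimately show ?thesis by (simp only:)
qed

lemma tau_orbit_deriv2:
  "((\<lambda>t. inner (cm E (orbit E A t)) (orbit E A t)) has_real_derivative 2 * (norm (cm E A))\<^sup>2) (at 0)"
proof -
  have d: "((\<lambda>t. cm E (orbit E A t)) has_vector_derivative cm E (cm E A)) (at 0)"
    by (rule has_vector_derivative_eq_rhs[OF has_vector_derivative_cm[OF has_vector_derivative_const orbit_deriv]])
      (simp add: cm_linear)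
  show ?thesis
    using has_real_derivative_inner_endo[OF d orbit_deriv[of E A 0]]
    by (simp add: inner_cm_right[of E "cm E A"] E power2_norm_eq_inner)
qed

lemma mom_norm_orbit_deriv:
  "((\<lambda>t. (norm (mom (orbit E A t)))\<^sup>2 / 4) has_real_derivative
     inner (cm E (orbit E A t)) (cm (mom (orbit E A t)) (orbit E A t))) (at t)"
proof -
  have i: "inner (mom B) (dmom E B) = 2 * inner (cm E B) (cm (mom B) B)" for B
  proof -
    have "dmom E B = cm (cm E B) (tp B) + tp (cm (cm E B) (tp B))"
      by (simp add: dmom_def tp_cm)
    then have "inner (dmom E B) (mom B) = 2 * inner (cm (cm E B) (tp B)) (mom B)"
      by (simp add: inner_add_left inner_tp_left)
    also have "inner (cm (cm E B) (tp B)) (mom B) = inner (cm E B) (cm (mom B) B)"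
      using inner_cm_left[of "cm E B" "tp B" "mom B"] by simp
    finally show ?thesis by (simp add: inner_commute)
  qed
  have "((\<lambda>t. inner (mom (orbit E A t)) (mom (orbit E A t)) / 4) has_real_derivative
     (inner (mom (orbit E A t)) (dmom E (orbit E A t)) + inner (dmom E (orbit E A t)) (mom (orbit E A t))) / 4) (at t)"
    by (intro DERIV_cdivide has_real_derivative_inner_endo mom_orbit_deriv)
  then show ?thesis by (simp add: power2_norm_eq_inner i inner_commute[of "dmom E _"])
qed

lemma mom_norm_orbit_deriv2:
  "((\<lambda>t. inner (cm E (orbit E A t)) (cm (mom (orbit E A t)) (orbit E A t))) has_real_derivative
     inner (cm E (cm E A)) (cm (mom A) A)
       + inner (cm E A) (cm (dmom E A) A + cm (mom A) (cm E A))) (at 0)"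
proof -
  have d: "((\<lambda>t. cm E (orbit E A t)) has_vector_derivative cm E (cm E A)) (at 0)"
    by (rule has_vector_derivative_eq_rhs[OF has_vector_derivative_cm[OF has_vector_derivative_const orbit_deriv]])
      (simp add: cm_linear)
  show ?thesis
    using has_real_derivative_inner_endo[OF d has_vector_derivative_cm[OF mom_orbit_deriv orbit_deriv[of E A 0]]]
    by (simp add: add.commute)
qed

text \<open>Differentiating the quotient is avoided: F(A) |Ric|^2 - scal^2, taken along the orbit,
  vanishes at 0 and is nonnegative nearby, so its first derivative is zero and its second is
  nonnegative. \<open>T1\<close>, \<open>T2\<close> are the derivatives of \<open>tau\<close>, and
  \<open>Q1\<close>, \<open>Q2\<close> those of |M|^2 / 4; the trace is constant.\<close>

lemma second_order_condition:
  assumes A: "sy A \<noteq> 0" and lm: "\<forall>\<^sub>F t in at 0. pinch (orbit E A t) \<le> pinch A"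
  defines "b \<equiv> tau A + (tr A)\<^sup>2"
    and "T1 \<equiv> inner (cm E A) A" and "T2 \<equiv> 2 * (norm (cm E A))\<^sup>2"
    and "Q1 \<equiv> inner (cm E A) (cm (mom A) A)"
    and "Q2 \<equiv> inner (cm E (cm E A)) (cm (mom A) A)
       + inner (cm E A) (cm (dmom E A) A + cm (mom A) (cm E A))"
  shows "pinch A * ((tau A + b) * T1 + Q1) = 2 * b * T1"
    and "pinch A * (2 * T1\<^sup>2 + (tau A + b) * T2 + Q2) \<ge> 2 * T1\<^sup>2 + 2 * b * T2"
proof -
  let ?A = "orbit E A" and ?F = "pinch A" and ?a = "(tr A)\<^sup>2"
  let ?T = "\<lambda>t. tau (?A t)" and ?Q = "\<lambda>t. (norm (mom (?A t)))\<^sup>2 / 4"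
  let ?H = "\<lambda>t. ?F * (?T t * (?T t + ?a) + ?Q t) - (?T t + ?a)\<^sup>2"
  let ?T1 = "\<lambda>t. inner (cm E (?A t)) (?A t)" and ?Q1 = "\<lambda>t. inner (cm E (?A t)) (cm (mom (?A t)) (?A t))"
  let ?H1 = "\<lambda>t. ?F * ((2 * ?T t + ?a) * ?T1 t + ?Q1 t) - 2 * (?T t + ?a) * ?T1 t"
  let ?D = "?F * (2 * T1\<^sup>2 + (2 * tau A + ?a) * T2 + Q2) - 2 * T1\<^sup>2 - 2 * (tau A + ?a) * T2"
  have T0: "tau A > 0" using A by (simp add: tau_pos_iff)
  have d1: "(?H has_real_derivative ?H1 t) (at t)" for t
    by (rule derivative_eq_intros tau_orbit_deriv mom_norm_orbit_deriv refl)+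
      (simp add: algebra_simps power2_eq_square)
  have d2: "(?H1 has_real_derivative ?D) (at 0)"
    by (rule derivative_eq_intros tau_orbit_deriv tau_orbit_deriv2 mom_norm_orbit_deriv2 refl)+
      (simp add: T1_def T2_def Q2_def Q1_def algebra_simps power2_eq_square)
  have H0: "?H 0 = 0"
  proof -
    have "tau A * (tau A + ?a) + (norm (mom A))\<^sup>2 / 4 > 0"
      using T0 by (intro add_pos_nonneg mult_pos_pos) auto
    then show ?thesis by (simp add: pinch_def)
  qed
  \<comment> \<open>Positivity of \<open>tau\<close> persists for small t, which allows clearing the
    denominator.\<close>
  have "?T \<midarrow>0\<rightarrow> tau A"
    using DERIV_isCont[OF tau_orbit_deriv[of 0]] by (simp add: isCont_def)
  then have "\<forall>\<^sub>F t in at 0. ?T t > 0" using T0 by (rule order_tendstoD)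
  with lm have "\<forall>\<^sub>F t in at 0. ?H 0 \<le> ?H t"
  proof eventually_elim
    case (elim t)
    have p: "?T t * (?T t + ?a) + ?Q t > 0"
      using elim(2) by (intro add_pos_nonneg mult_pos_pos) auto
    have "(?T t + ?a)\<^sup>2 / (?T t * (?T t + ?a) + ?Q t) \<le> ?F"
      using elim(1) unfolding pinch_def[of "?A t"] by (simp add: tr_orbit)
    then have "(?T t + ?a)\<^sup>2 \<le> ?F * (?T t * (?T t + ?a) + ?Q t)"
      using p by (simp add: divide_le_eq)
    then show ?case using H0 by simp
  qed
  from second_derivative_test[OF d1 d2 this]
  show "?F * ((tau A + b) * T1 + Q1) = 2 * b * T1"
    and "?F * (2 * T1\<^sup>2 + (tau A + b) * T2 + Q2) \<ge> 2 * T1\<^sup>2 + 2 * b * T2"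
    by (simp_all add: b_def T1_def Q1_def algebra_simps)
qed

end

section \<open>Local maxima\<close>

text \<open>These are the endomorphisms of the hyperplane orthogonal to \<open>e\<close>, extended
  by zero.\<close>

definition adm :: "'a::euclidean_space \<Rightarrow> 'a endo \<Rightarrow> bool" where
  "adm e a \<longleftrightarrow> app a e = 0 \<and> app (tp a) e = 0"

lemma adm_intros [intro]:
  "adm e a \<Longrightarrow> adm e b \<Longrightarrow> adm e (a + b)" "adm e a \<Longrightarrow> adm e b \<Longrightarrow> adm e (a - b)"
  "adm e a \<Longrightarrow> adm e (- a)" "adm e a \<Longrightarrow> adm e b \<Longrightarrow> adm e (a * b)"
  "adm e a \<Longrightarrow> adm e (r *\<^sub>R a)" "adm e a \<Longrightarrow> adm e (tp a)" "adm e a \<Longrightarrow> adm e b \<Longrightarrow> adm e (cm a b)"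
  "adm e a \<Longrightarrow> adm e (mom a)" "adm e a \<Longrightarrow> adm e (sy a)" "adm e 0"
  by (auto simp: adm_def cm_def mom_def sy_def)

lemma expo_fixes:
  assumes "adm e E" shows "app (expo E t) e = e"
proof -
  have "app (expo E t) e - e = 0"
  proof (rule linear_ode_unique[OF linear_app])
    show "((\<lambda>t. app (expo E t) e - e) has_vector_derivative app E (app (expo E s) e - e)) (at s)" for s
      using has_vector_derivative_diff[OF expo_deriv_app has_vector_derivative_const] assms
      by (simp add: adm_def)
  qed simp
  then show ?thesis by simp
qed

text \<open>Eigenspaces of the commutator with \<open>M\<close> are orthogonal for the trace form
  unless their eigenvalues add up to zero.\<close>

lemma tr_eigen_mult:
  assumes "cm M B = r *\<^sub>R B" "cm M Z = 0" "r \<noteq> 0"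
  shows "tr (B * Z) = 0"
proof -
  have "r * tr (B * Z) = tr (cm M B * Z)" using assms(1) by simp
  also have "\<dots> = tr (M * cm B Z)" by (rule tr_cm_mult)
  also have "\<dots> = - tr (M * cm Z B)" by (subst cm_swap) simp
  also have "\<dots> = - tr (cm M Z * B)" by (simp add: tr_cm_mult)
  finally show ?thesis using assms by simp
qed

lemma tr_eigen_square:
  assumes "cm M B = r *\<^sub>R B" "r \<noteq> 0"
  shows "tr (B * B) = 0"
proof -
  have "r * tr (B * B) = tr (cm M B * B)" using assms(1) by simp
  also have "\<dots> = 0" by (simp add: tr_cm_mult cm_linear)
  finally show ?thesis using assms by simp
qed

lemma tr_eigen:
  assumes "cm M B = r *\<^sub>R B" "r \<noteq> 0"
  shows "tr B = 0"
  using assms tr_cm[of M B] by simp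

lemma inner_cm_self_mom: "inner (cm (mom A) A) A = (norm (mom A))\<^sup>2"
  using inner_cm_right[of "mom A" A A] inner_cm_left[of "mom A" A A]
  by (simp add: power2_norm_eq_inner mom_def)

text \<open>Local maximality as it is used: along curves exp(t E) that fix the normal. Skew
  directions only rotate \<open>A\<close> and leave \<open>pinch\<close> constant, hence
  \<open>E\<close> is symmetric.\<close>

definition local_max_direction :: "'a::euclidean_space \<Rightarrow> 'a endo \<Rightarrow> bool" where
  "local_max_direction e A \<longleftrightarrow> (\<forall>E. tp E = E \<longrightarrow> adm e E \<longrightarrow> (\<forall>\<^sub>F t in at 0. pinch (orbit E A t) \<le> pinch A))"

section \<open>First and second variation at a local maximum\<close>

context
  fixes A :: "'a::euclidean_space endo" and e
  assumes adm: "adm e A" and nz: "sy A \<noteq> 0" and lm: "local_max_direction e A"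
begin

private definition "M = mom A"
private definition "W = cm M A"
private definition "q = (norm M)\<^sup>2 / 4"
private definition "b = tau A + (tr A)\<^sup>2"
text \<open>The solution of F (tau + b + rho) = 2 b, which turns the first-order condition into
  \<langle>[E, A], W\<rangle> = rho \<langle>E, M\<rangle>.\<close>

private definition "rho = 2 * q / b - (tr A)\<^sup>2"
private definition "C = W - rho *\<^sub>R A"

private lemma T0: "tau A > 0" using nz by (simp add: tau_pos_iff)
private lemma b0: "b > 0" unfolding b_def using T0 by (intro add_pos_nonneg) auto
private lemma den: "tau A * b + q > 0"
  using T0 b0 by (auto simp: q_def intro!: add_pos_nonneg mult_pos_pos)
private lemma F: "pinch A = b\<^sup>2 / (tau A * b + q)"
  by (simp add: pinch_def b_def q_def M_def)
private lemma F0: "pinch A > 0" unfolding F using b0 den by simp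

private lemma rho: "pinch A * (tau A + b + rho) = 2 * b"
proof -
  have a: "(tr A)\<^sup>2 = b - tau A" by (simp add: b_def)
  have "tau A + b + rho = 2 * (tau A * b + q) / b"
    using b0 unfolding rho_def a by (simp add: field_simps)
  moreover have "b\<^sup>2 / d * (2 * d / b) = 2 * b" if "d > 0" for d
    using that b0 by (simp add: power2_eq_square)
  from this[OF den] have "pinch A * (2 * (tau A * b + q) / b) = 2 * b" by (simp only: F)
  ultimately show ?thesis by (simp only:)
qed

private lemma first_order:
  assumes "tp E = E" "adm e E" shows "inner (cm E A) W = rho * inner E M"
proof -
  have T1: "inner (cm E A) A = inner E M" by (simp add: inner_cm_left mom_def M_def)
  have "\<forall>\<^sub>F t in at 0. pinch (orbit E A t) \<le> pinch A"
    using lm assms by (auto simp: local_max_direction_def)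
  from second_order_condition(1)[OF assms(1) nz this]
  have "pinch A * ((tau A + b) * inner E M + inner (cm E A) W)
      = pinch A * (tau A + b + rho) * inner E M"
    unfolding rho T1 by (simp add: b_def W_def M_def)
  then have "pinch A * inner (cm E A) W = pinch A * (rho * inner E M)"
    by (simp add: algebra_simps)
  then show ?thesis using F0 by simp
qed

private lemma tpM: "tp M = M" by (simp add: M_def)
private lemma adms: "adm e M" "adm e W" using adm by (auto simp: M_def W_def)

text \<open>The gradient [W, A^t] - rho M is itself an allowed direction, and the first-order
  condition in this direction says that its norm is zero. Its symmetry is the Jacobi identity for
  [M, [A, A^t]] = [M, M] = 0.\<close>

private lemma critical: "cm W (tp A) = rho *\<^sub>R M"
proof -
  let ?D = "cm W (tp A) - rho *\<^sub>R M"
  have "cm (tp A) W + cm A (tp W) = 0"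
  proof -
    have "cm M (cm A (tp A)) = cm (cm M A) (tp A) + cm A (cm M (tp A))" by (rule cm_jacobi)
    then have "0 = cm W (tp A) + cm A (cm M (tp A))"
      by (simp add: W_def M_def mom_def cm_linear)
    moreover have "tp W = - cm M (tp A)" by (simp add: W_def tp_cm tpM) (rule cm_swap)
    moreover have "cm W (tp A) = - cm (tp A) W" by (rule cm_swap)
    ultimately show ?thesis by (simp add: cm_linear algebra_simps)
  qed
  then have "cm A (tp W) = - cm (tp A) W" by (simp only: eq_neg_iff_add_eq_0 add.commute)
  moreover have "tp (cm W (tp A)) = cm A (tp W)" by (simp only: tp_cm tp_simps)
  ultimately have "tp (cm W (tp A)) = cm W (tp A)"
    using cm_swap[of W "tp A"] by simp
  then have s: "tp ?D = ?D" by (simp add: tpM)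
  have "inner (cm ?D A) W = rho * inner ?D M"
    by (rule first_order[OF s]) (use adms adm in auto)
  then have "inner ?D ?D = 0"
    by (simp add: inner_cm_left inner_diff_right)
  then show ?thesis by simp
qed

private lemma C_comm: "cm C (tp A) = 0" "cm A (tp C) = 0"
proof -
  show c: "cm C (tp A) = 0"
    using critical by (simp add: C_def cm_linear M_def mom_def)
  then have "tp (cm C (tp A)) = 0" by simp
  then show "cm A (tp C) = 0" by (simp add: tp_cm)
qed

private lemma W_norm: "(norm W)\<^sup>2 = rho * (norm M)\<^sup>2"
  using first_order[OF tpM adms(1)] by (simp add: W_def power2_norm_eq_inner)

private lemma inner_W_A: "inner W A = (norm M)\<^sup>2"
  unfolding W_def M_def by (rule inner_cm_self_mom)

private lemma inner_W_C: "inner W C = 0"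
  by (simp add: C_def inner_diff_right inner_W_A power2_norm_eq_inner[symmetric] W_norm)

text \<open>The Jacobi identity turns \<open>\<langle>[M, C], C\<rangle> = \<langle>[A, A\<^sup>t], [C, C\<^sup>t]\<rangle>\<close> into \<open>- |[A, C]|\<^sup>2\<close>, as \<open>C\<close> commutes with \<open>A\<^sup>t\<close>.\<close>

private lemma cm_C: "inner (cm M W) W = rho\<^sup>2 * (norm M)\<^sup>2 - (norm (cm A C))\<^sup>2"
proof -
  have CC: "inner (cm M C) C = - (norm (cm A C))\<^sup>2"
  proof -
    have "inner (cm M C) C = inner M (cm C (tp C))" by (rule inner_cm_left)
    also have "\<dots> = tr (M * cm C (tp C))"
      by (simp add: inner_endo_def tp_cm)
    also have "\<dots> = tr (A * cm (tp A) (cm C (tp C)))"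
      by (simp add: M_def mom_def tr_cm_mult)
    also have "cm (tp A) (cm C (tp C)) = cm C (cm (tp A) (tp C))"
      using C_comm(1) cm_swap[of "tp A" C] by (simp add: cm_jacobi[of "tp A"] cm_linear)
    also have "tr (A * \<dots>) = tr (cm A C * cm (tp A) (tp C))"
      by (simp add: tr_cm_mult)
    also have "cm (tp A) (tp C) = - tp (cm A C)" by (simp add: tp_cm) (rule cm_swap)
    finally show ?thesis by (simp add: power2_norm_eq_inner inner_endo_def)
  qed
  have W: "W = C + rho *\<^sub>R A" by (simp add: C_def)
  have "inner (cm M C) A = inner C W"
    using inner_cm_right[of M C A] by (simp add: W_def tpM)
  moreover have "inner (cm M A) C = inner C W"
    by (simp add: W_def inner_commute)
  moreover have "inner (cm M A) A = (norm M)\<^sup>2" using inner_W_A by (simp add: W_def)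
  moreover have "inner (cm M W) W = inner (cm M C) C + rho * inner (cm M C) A
      + rho * inner (cm M A) C + rho * rho * inner (cm M A) A"
    unfolding W by (simp add: cm_linear inner_simps algebra_simps)
  moreover have "inner C W = 0" using inner_W_C by (simp add: inner_commute)
  ultimately show ?thesis by (simp add: CC power2_eq_square)
qed

text \<open>By criticality M changes at the rate 2 rho M along its own flow, so every second-order
  term is a multiple of |M|^2 except the one in [A, C]. With 4 q = |M|^2 and tau = b - (tr A)^2 the
  rest is a polynomial identity in b, q and tr A.\<close>

private lemma cm_AC_le: "(norm (cm A C))\<^sup>2 \<le> ((tr A)\<^sup>2)\<^sup>2 * (norm M)\<^sup>2"
proof -
  have dm: "dmom M A = (2 * rho) *\<^sub>R M"
  proof -
    have "cm A (tp (cm M A)) = tp (cm (cm M A) (tp A))" by (simp add: tp_cm)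
    then have "cm A (tp (cm M A)) = rho *\<^sub>R M" using critical by (simp add: W_def tpM)
    then show ?thesis using critical by (simp add: dmom_def W_def scaleR_add_left[symmetric])
  qed
  let ?m = "(norm M)\<^sup>2"
  have ww: "inner W W = rho * ?m" using W_norm by (simp add: power2_norm_eq_inner)
  have Q2: "inner (cm M W) W + inner W (cm (dmom M A) A + cm M W)
      = 4 * rho\<^sup>2 * ?m - 2 * (norm (cm A C))\<^sup>2"
    by (simp add: dm cm_linear W_def[symmetric] inner_add_right ww cm_C inner_commute[of W "cm M W"])
      (simp add: power2_eq_square)
  have "\<forall>\<^sub>F t in at 0. pinch (orbit M A t) \<le> pinch A"
    using lm tpM adms by (auto simp: local_max_direction_def)
  from second_order_condition(2)[OF tpM nz this]
  have "2 * ?m\<^sup>2 + 4 * b * (rho * ?m) \<le> pinch A * (2 * ?m\<^sup>2 + (tau A + b) * (2 * (rho * ?m))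
      + (4 * rho\<^sup>2 * ?m - 2 * (norm (cm A C))\<^sup>2))"
    unfolding b_def[symmetric] M_def[symmetric] W_def[symmetric] Q2 inner_W_A W_norm by (simp add: algebra_simps)
  also have "\<dots> = 2 * (pinch A * (?m\<^sup>2 + rho\<^sup>2 * ?m - (norm (cm A C))\<^sup>2))
      + 2 * (pinch A * (tau A + b + rho)) * (rho * ?m)"
    by (simp add: algebra_simps power2_eq_square)
  finally have "?m\<^sup>2 \<le> pinch A * (?m\<^sup>2 + rho\<^sup>2 * ?m - (norm (cm A C))\<^sup>2)"
    unfolding rho by (simp add: algebra_simps)
  then have "?m\<^sup>2 * (tau A * b + q) \<le> b\<^sup>2 * (?m\<^sup>2 + rho\<^sup>2 * ?m - (norm (cm A C))\<^sup>2)"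
    using den unfolding F by (simp add: field_simps)
  also have "\<dots> = b\<^sup>2 * ?m\<^sup>2 + (b * rho)\<^sup>2 * ?m - b\<^sup>2 * (norm (cm A C))\<^sup>2"
    by algebra
  also have "b * rho = 2 * q - b * (tr A)\<^sup>2" using b0 by (simp add: rho_def field_simps)
  finally have "(4 * q)\<^sup>2 * ((b - (tr A)\<^sup>2) * b + q) \<le>
      b\<^sup>2 * (4 * q)\<^sup>2 + (2 * q - b * (tr A)\<^sup>2)\<^sup>2 * (4 * q) - b\<^sup>2 * (norm (cm A C))\<^sup>2"
    by (simp add: q_def b_def)
  moreover have "(4 * q)\<^sup>2 * ((b - (tr A)\<^sup>2) * b + q) =
      b\<^sup>2 * (4 * q)\<^sup>2 + (2 * q - b * (tr A)\<^sup>2)\<^sup>2 * (4 * q) - b\<^sup>2 * (((tr A)\<^sup>2)\<^sup>2 * (4 * q))"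
    by algebra
  ultimately have "b\<^sup>2 * (norm (cm A C))\<^sup>2 \<le> b\<^sup>2 * (((tr A)\<^sup>2)\<^sup>2 * (4 * q))"
    by linarith
  then show ?thesis using b0 by (simp add: q_def)
qed

text \<open>Two estimates of tr W^2 collide. Since \<langle>sy W, sy A\<rangle> = |M|^2 / 2,
  Cauchy-Schwarz bounds tau W from below, and tr W^2 = 2 tau W - |W|^2; from above, tr W^2 =
  \<langle>[A, C], M\<rangle> is at most (tr A)^2 |M|^2. Together they give 2 q / tau A \<le> 2 q /
  b, while tau A < b if the trace is nonzero.\<close>

private lemma tr_zero:
  assumes "M \<noteq> 0" shows "tr A = 0"
proof (rule ccontr)
  assume a: "tr A \<noteq> 0"
  let ?m = "(norm M)\<^sup>2"
  have m: "?m > 0" using assms by simp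
  have q: "q > 0" using m by (simp add: q_def)
  have "inner (sy W) (sy A) = ?m / 2"
  proof -
    have "inner W (tp A) = 0"
      by (simp add: inner_endo_def W_def tr_cm_mult cm_linear)
    then have "inner W (sy A) = ?m / 2" by (simp add: sy_def inner_add_right inner_W_A)
    then show ?thesis by (simp add: inner_sy)
  qed
  then have "?m / 2 \<le> norm (sy W) * norm (sy A)" by (metis norm_cauchy_schwarz)
  then have "(?m / 2)\<^sup>2 \<le> (norm (sy W) * norm (sy A))\<^sup>2" by (intro power_mono) auto
  moreover have "(?m / 2)\<^sup>2 = ?m * q" by (simp add: q_def power2_eq_square)
  moreover have "(norm (sy W) * norm (sy A))\<^sup>2 = tau W * tau A"
    by (simp add: tau_def power_mult_distrib)
  ultimately have "?m * q \<le> tau W * tau A" by simp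
  then have 1: "?m * q / tau A \<le> tau W" using T0 by (simp add: divide_le_eq)
  have 2: "tr (W * W) = 2 * tau W - rho * ?m" by (simp add: tau_alt W_norm add_divide_distrib)
  have "inner (cm A C) M = tr (W * W)"
  proof -
    have "cm A C = cm A W" by (simp add: C_def cm_linear)
    then have "inner (cm A C) M = tr (cm W A * (- M))"
      by (simp add: inner_endo_def tpM cm_swap[of A W])
    also have "\<dots> = tr (W * W)" using cm_swap[of A M] by (simp add: tr_cm_mult W_def cm_linear)
    finally show ?thesis .
  qed
  then have "tr (W * W) \<le> norm (cm A C) * norm M" by (metis norm_cauchy_schwarz)
  also have "norm (cm A C) \<le> (tr A)\<^sup>2 * norm M"
    by (rule power2_le_imp_le) (use cm_AC_le in \<open>auto simp: power_mult_distrib\<close>)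
  from mult_right_mono[OF this, of "norm M"] have "norm (cm A C) * norm M \<le> (tr A)\<^sup>2 * ?m"
    by (simp add: power2_eq_square mult.assoc)
  finally have "2 * (?m * q / tau A) - rho * ?m \<le> (tr A)\<^sup>2 * ?m" using 1 2 by linarith
  then have "?m * (2 * q / tau A - rho - (tr A)\<^sup>2) \<le> 0" by (simp add: algebra_simps)
  then have "2 * q / tau A \<le> 2 * q / b" using m by (simp add: mult_le_0_iff rho_def)
  moreover have "tau A < b" using a by (simp add: b_def)
  then have "2 * q / b < 2 * q / tau A" using T0 q by (intro divide_strict_left_mono) auto
  ultimately show False by linarith
qed

text \<open>With trace zero, C commutes with A and A^t, hence with M and W. The splitting is B = W /
  rho and K = - C / rho.\<close>

lemma local_max_structure:
  assumes "mom A \<noteq> 0"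
  obtains B K r where "A = B + K" "tp K = - K" "cm B K = 0" "cm (tp B) K = 0" "r > 0"
    "cm (mom B) B = r *\<^sub>R B" "adm e B" "adm e K" "B \<noteq> 0" "tr A = 0"
proof -
  have M: "M \<noteq> 0" using assms by (simp add: M_def)
  have a: "tr A = 0" by (rule tr_zero[OF M])
  have q: "q > 0" using M by (simp add: q_def)
  have r0: "rho > 0" using q b0 by (simp add: rho_def a)
  have AC: "cm A C = 0" using cm_AC_le by (simp add: a)
  have "tp (cm A C) = 0" using AC by simp
  then have AC': "cm (tp C) (tp A) = 0" by (simp add: tp_cm)
  have sw: "cm x y = 0 \<Longrightarrow> cm y x = 0" for x y :: "'a endo" using cm_swap[of y x] by simp
  note CA = AC AC' C_comm AC[THEN sw] AC'[THEN sw] C_comm[THEN sw]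
  have CM: "cm C M = 0" "cm (tp C) M = 0"
    by (simp_all add: M_def mom_def cm_jacobi CA cm_linear)
  have CW: "cm C W = 0" "cm (tp C) W = 0"
    by (simp_all add: W_def cm_jacobi CA CM cm_linear)
  have tpW: "tp W = cm (tp A) M" by (simp add: W_def tp_cm tpM)
  have CtW: "cm C (tp W) = 0" by (simp add: tpW cm_jacobi CA CM cm_linear)
  have WW: "cm W (tp W) = cm C (tp C) + rho\<^sup>2 *\<^sub>R M"
  proof -
    have W: "W = C + rho *\<^sub>R A" by (simp add: C_def)
    show ?thesis unfolding W by (simp add: cm_linear CA M_def mom_def power2_eq_square)
  qed
  \<comment> \<open>[C, C^t] is orthogonal both to [W, W^t] and to M; by \<open>WW\<close> it is
    then orthogonal to itself.\<close>
  have "inner (cm W (tp W)) (cm C (tp C)) = inner W (cm (cm C (tp C)) W)"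
    by (simp add: inner_cm_left)
  also have "cm (cm C (tp C)) W = 0"
  proof -
    have "cm W (cm C (tp C)) = 0" by (simp add: cm_jacobi CW[THEN sw] cm_linear)
    then show ?thesis by (rule sw)
  qed
  finally have "inner (cm W (tp W)) (cm C (tp C)) = 0" by simp
  moreover have "inner M (cm C (tp C)) = inner (cm M C) C" by (simp add: inner_cm_left)
  then have "inner M (cm C (tp C)) = 0" using CM(1)[THEN sw] by simp
  ultimately have "inner (cm C (tp C)) (cm C (tp C)) = 0" by (simp add: WW inner_add_left)
  then have WW': "cm W (tp W) = rho\<^sup>2 *\<^sub>R M" using WW by simp
  define B where "B = (1 / rho) *\<^sub>R W"
  define K where "K = A - B"
  have KC: "K = - (1 / rho) *\<^sub>R C" using r0 by (simp add: K_def B_def C_def algebra_simps)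
  have MB: "mom B = M" using r0 by (simp add: B_def mom_scaleR) (simp add: mom_def WW' power_divide)
  have MW: "cm M W = rho *\<^sub>R W"
  proof -
    have "cm M C = 0" by (rule sw[OF CM(1)])
    then have "cm M W = rho *\<^sub>R cm M A" by (simp add: C_def cm_linear)
    then show ?thesis by (simp add: W_def)
  qed
  have sol: "cm (mom B) B = rho *\<^sub>R B"
    unfolding MB by (simp add: B_def cm_linear MW)
  have BK: "cm B K = 0" "cm (tp B) K = 0"
    using CW(1)[THEN sw] CtW[THEN sw] by (simp_all add: B_def KC cm_linear)
  have KM: "cm (mom B) K = 0" using CM(1)[THEN sw] by (simp add: MB KC cm_linear)
  \<comment> \<open>K is skew because it leaves no room in \<open>tau\<close>: the value splits as
    |B|^2 / 2 + tau K, and |B|^2 / 2 is already all of tau A.\<close>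
  have "tau A = (norm B)\<^sup>2 / 2 + tau K"
  proof -
    have "inner B K = 0" using inner_W_C by (simp add: B_def KC)
    moreover have "tr (B * K) = 0" by (rule tr_eigen_mult[OF sol KM]) (use r0 in simp)
    moreover have "tr (K * B) = 0" using calculation(2) by (simp add: tr_commute)
    moreover have "tr (B * B) = 0" by (rule tr_eigen_square[OF sol]) (use r0 in simp)
    moreover have "A = B + K" by (simp add: K_def)
    ultimately show ?thesis
      by (simp add: tau_alt algebra_simps power2_norm_eq_inner inner_simps inner_commute)
  qed
  moreover have "tau A = (norm B)\<^sup>2 / 2"
  proof -
    have "(norm B)\<^sup>2 = rho * (norm M)\<^sup>2 / rho\<^sup>2"
      using r0 by (simp add: B_def power_divide W_norm)
    also have "\<dots> = 4 * q / rho" using r0 by (simp add: q_def power2_eq_square)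
    also have "\<dots> = 2 * tau A" using q T0 by (simp add: rho_def a b_def)
    finally show ?thesis by simp
  qed
  ultimately have "sy K = 0" using tau_pos_iff[of K] by simp
  then have "tp K = - K" by (simp add: sy_def add_eq_0_iff)
  moreover have "B \<noteq> 0" using assms MB M_def by (auto simp: mom_def cm_linear)
  moreover have "adm e B" "adm e K" unfolding K_def B_def using adm adms by blast+
  moreover have "A = B + K" by (simp add: K_def)
  ultimately show thesis using that BK r0 sol a by blast
qed

end

section \<open>Symmetric endomorphisms\<close>

text \<open>A maximum \<open>v\<close> of the Rayleigh quotient on the unit sphere of
  \<open>V\<close> is an eigenvector, since a nonzero residual
  \<open>app T v - ?m *\<^sub>R v\<close> would be a direction of increase.\<close>

lemma symmetric_eigenvector:
  assumes T: "tp T = T" and V: "subspace V" "V \<noteq> {0}" and TV: "\<And>x. x \<in> V \<Longrightarrow> app T x \<in> V"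
  obtains v c where "v \<in> V" "norm v = 1" "app T v = c *\<^sub>R v"
proof -
  let ?S = "V \<inter> sphere 0 1" and ?f = "\<lambda>x. app T x \<bullet> x"
  obtain x where x: "x \<in> V" "x \<noteq> 0" using V subspace_0 by blast
  have "x /\<^sub>R norm x \<in> ?S" using x V by (simp add: subspace_scale)
  then have "?S \<noteq> {}" by blast
  moreover have "compact ?S"
    using closed_subspace[OF V(1)] by (simp add: closed_Int_compact)
  moreover have "continuous_on ?S ?f"
    by (intro continuous_intros linear_continuous_on)
      (simp add: linear_conv_bounded_linear[symmetric] linear_app)
  ultimately obtain v where v': "v \<in> ?S" "\<forall>y\<in>?S. ?f y \<le> ?f v"
    using continuous_attains_sup[of ?S ?f] by blast
  then have v: "v \<in> V" "norm v = 1" "\<And>y. y \<in> ?S \<Longrightarrow> ?f y \<le> ?f v" by auto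
  let ?m = "?f v"
  have le: "?f u \<le> ?m * (u \<bullet> u)" if "u \<in> V" for u
  proof (cases "u = 0")
    case False
    then have "u /\<^sub>R norm u \<in> ?S" using that by (simp add: subspace_scale[OF V(1)])
    from v(3)[OF this] have "?f u / (norm u * norm u) \<le> ?m" by (simp add: divide_inverse mult_ac)
    then show ?thesis using False
      by (simp add: divide_le_eq power2_norm_eq_inner[symmetric] power2_eq_square)
  qed simp
  let ?w = "app T v - ?m *\<^sub>R v"
  have sT: "app T x \<bullet> y = x \<bullet> app T y" for x y using app_tp[of T x y] T by simp
  have wV: "?w \<in> V" using v TV V by (simp add: subspace_diff subspace_scale)
  have vv: "v \<bullet> v = 1" using v(2) by (simp add: power2_norm_eq_inner[symmetric])
  have "?w \<bullet> ?w \<le> 0"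
  proof (rule ccontr)
    assume "\<not> ?w \<bullet> ?w \<le> 0"
    then have w: "?w \<bullet> ?w > 0" by (simp only: not_le)
    define c where "c = ?m * (?w \<bullet> ?w) - ?f ?w"
    have c: "c \<ge> 0" using le[OF wV] by (simp add: c_def)
    \<comment> \<open>Small enough for the quadratic loss t^2 c to stay below the linear gain; the
      summand 1 keeps the divisor positive if c = 0.\<close>
    define t where "t = (?w \<bullet> ?w) / (c + 1)"
    have t: "t > 0" using w c by (simp add: t_def)
    have "v + t *\<^sub>R ?w \<in> V" using v wV V by (simp add: subspace_add subspace_scale)
    from le[OF this] have "0 \<le> ?m * ((v + t *\<^sub>R ?w) \<bullet> (v + t *\<^sub>R ?w)) - ?f (v + t *\<^sub>R ?w)" by simp
    also have "\<dots> = t\<^sup>2 * c - 2 * t * ((app T v - ?m *\<^sub>R v) \<bullet> ?w)"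
    proof -
      define w where "w = ?w"
      have "app T w \<bullet> v = app T v \<bullet> w" by (metis sT inner_commute)
      then have "?m * ((v + t *\<^sub>R w) \<bullet> (v + t *\<^sub>R w)) - ?f (v + t *\<^sub>R w)
        = t\<^sup>2 * (?m * (w \<bullet> w) - ?f w) - 2 * t * ((app T v - ?m *\<^sub>R v) \<bullet> w)"
        by (simp add: inner_simps vv inner_commute[of w v] power2_eq_square algebra_simps)
      then show ?thesis unfolding c_def w_def .
    qed
    finally have "2 * t * (?w \<bullet> ?w) \<le> t * (t * c)" by (simp add: power2_eq_square)
    then have "2 * (?w \<bullet> ?w) \<le> t * c" using t by (simp add: mult.assoc mult.left_commute)
    also have "t * c \<le> ?w \<bullet> ?w"
      using c w unfolding t_def by (simp add: divide_le_eq mult_left_mono)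
    finally show False using w by simp
  qed
  then have "?w = 0" by (metis inner_eq_zero_iff inner_ge_zero order_antisym)
  then show thesis using that[OF v(1,2), of ?m] by simp
qed

lemma spectral_basis:
  assumes T: "tp T = T" and V: "subspace V" and TV: "\<And>x. x \<in> V \<Longrightarrow> app T x \<in> V"
  shows "\<exists>B. finite B \<and> B \<subseteq> V \<and> pairwise orthogonal B \<and> (\<forall>b\<in>B. norm b = 1) \<and> span B = V \<and>
    (\<forall>b\<in>B. \<exists>c. app T b = c *\<^sub>R b)"
  using V TV
proof (induction "dim V" arbitrary: V rule: less_induct)
  case less
  show ?case
  proof (cases "V = {0}")
    case True then show ?thesis by (intro exI[of _ "{}"]) auto
  next
    case False
    obtain v c where v: "v \<in> V" "norm v = 1" "app T v = c *\<^sub>R v"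
      using symmetric_eigenvector[OF T less.prems(1) False less.prems(2)] by blast
    let ?V = "{x \<in> V. v \<bullet> x = 0}"
    have sub: "subspace ?V"
      using less.prems(1) by (auto simp: subspace_def inner_simps)
    have "v \<notin> ?V" using v by (auto simp: norm_eq_sqrt_inner)
    then have "?V \<subset> V" using v(1) by blast
    then have "span ?V \<subset> span V"
      using sub less.prems(1) by (simp only: span_eq_iff[THEN iffD2])
    then have "dim ?V < dim V" by (rule dim_psubset)
    moreover have "app T x \<in> ?V" if "x \<in> ?V" for x
    proof -
      have "v \<bullet> app T x = app T v \<bullet> x" using app_tp[of T v x] T by simp
      then show ?thesis using that less.prems(2) v by simp
    qed
    ultimately obtain B where B: "finite B" "B \<subseteq> ?V" "pairwise orthogonal B" "\<forall>b\<in>B. norm b = 1"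
      "span B = ?V" "\<forall>b\<in>B. \<exists>c. app T b = c *\<^sub>R b"
      using less.hyps[OF _ sub] by blast
    have "V \<subseteq> span (insert v B)"
    proof
      fix x assume "x \<in> V"
      then have "x - (v \<bullet> x) *\<^sub>R v \<in> ?V"
        using v less.prems(1) by (auto simp: subspace_diff subspace_scale inner_simps norm_eq_sqrt_inner)
      then show "x \<in> span (insert v B)" unfolding B(5)[symmetric] span_insert by blast
    qed
    moreover have "span (insert v B) \<subseteq> V"
      by (rule span_minimal) (use v B(2) less.prems(1) in auto)
    moreover have "pairwise orthogonal (insert v B)"
      using B(2,3) by (auto simp: pairwise_insert orthogonal_def inner_commute)
    ultimately show ?thesis
      using B v by (intro exI[of _ "insert v B"]) auto
  qed
qed

lemma orthogonal_projection:
  assumes "subspace U"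
  obtains P where "tp P = P" "\<And>x. app P x \<in> U" "\<And>x. x \<in> U \<Longrightarrow> app P x = x"
    "\<And>x. (\<And>u. u \<in> U \<Longrightarrow> x \<bullet> u = 0) \<Longrightarrow> app P x = 0"
    "\<And>T. (\<And>u. u \<in> U \<Longrightarrow> app T u \<in> U) \<Longrightarrow> (\<And>u. u \<in> U \<Longrightarrow> app (tp T) u \<in> U) \<Longrightarrow> cm P T = 0"
proof -
  obtain B where B: "B \<subseteq> U" "pairwise orthogonal B" "\<And>x. x \<in> B \<Longrightarrow> norm x = 1" "independent B"
    "span B = U"
    using orthonormal_basis_subspace[OF assms] by metis
  have fin: "finite B" using B(4) by (rule independent_imp_finite)
  define P where "P = (\<Sum>b\<in>B. outer b b)"
  have P: "app P x = (\<Sum>b\<in>B. (x \<bullet> b) *\<^sub>R b)" for x by (simp add: P_def app_sum_left)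
  have s: "tp P = P"
    by (rule tp_eqI) (simp add: P inner_sum_left inner_sum_right inner_commute mult.commute)
  have PU: "app P x \<in> U" for x
    unfolding P B(5)[symmetric] by (intro span_sum span_scale span_base)
  have Pid: "app P x = x" if "x \<in> U" for x
  proof -
    have "x \<in> span B" using that B(5) by simp
    then show ?thesis
    proof (rule span_induct)
      show "subspace {x. app P x = x}" by (auto simp: subspace_def)
      show "app P b = b" if "b \<in> B" for b
      proof -
        have "(b \<bullet> c) *\<^sub>R c = (if c = b then b else 0)" if "c \<in> B" for c
          using B(2,3) \<open>b \<in> B\<close> that
          by (auto simp: pairwise_def orthogonal_def norm_eq_sqrt_inner)
        then have "app P b = (\<Sum>c\<in>B. if c = b then b else 0)" unfolding P by (rule sum.cong[OF refl])
        then show ?thesis using fin that by simp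
      qed
    qed
  qed
  have P0: "app P x = 0" if "\<And>u. u \<in> U \<Longrightarrow> x \<bullet> u = 0" for x
    unfolding P using that B(1) by (auto intro!: sum.neutral)
  have "cm P T = 0" if T: "\<And>u. u \<in> U \<Longrightarrow> app T u \<in> U" and T': "\<And>u. u \<in> U \<Longrightarrow> app (tp T) u \<in> U" for T
  proof (rule endo_eqI)
    fix x
    define y where "y = x - app P x"
    have y: "y \<bullet> u = 0" if "u \<in> U" for u
    proof -
      have "app P x \<bullet> u = x \<bullet> u" using app_tp[of P x u] s Pid[OF that] by simp
      then show ?thesis by (simp add: y_def inner_diff_left)
    qed
    have "app P (app T y) = 0"
    proof (rule P0)
      fix u assume "u \<in> U"
      then show "app T y \<bullet> u = 0" using y[OF T'] by (simp add: app_tp')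
    qed
    moreover have "app P (app T (app P x)) = app T (app P x)" using Pid T PU by blast
    ultimately show "app (cm P T) x = app 0 x"
      by (simp add: cm_def y_def)
  qed
  then show thesis using that[OF s PU Pid P0] by blast
qed

lemma cm_power:
  assumes "cm M B = r *\<^sub>R B"
  shows "cm M (B ^ n) = (real n * r) *\<^sub>R B ^ n"
proof (induction n)
  case (Suc n)
  have "cm M (B * B ^ n) = cm M B * B ^ n + B * cm M (B ^ n)" by (simp add: cm_def algebra_simps)
  then show ?case by (simp add: Suc assms algebra_simps)
qed (simp add: cm_def)

text \<open>A nonzero \<open>B ^ n\<close> would be an eigenvector of the commutator with
  \<open>M\<close> for the eigenvalue n r, which the bound 2 |M| on that operator excludes for large
  n.\<close>

lemma eigen_nilpotent:
  assumes "cm M B = r *\<^sub>R B" "r \<noteq> 0"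
  shows "\<exists>n. B ^ n = 0"
proof -
  obtain n where n: "2 * norm M / \<bar>r\<bar> < real n" using reals_Archimedean2 by blast
  have "norm (cm M (B ^ n)) \<le> norm M * norm (B ^ n) + norm (B ^ n) * norm M"
    unfolding cm_def by (meson add_mono norm_mult_ineq norm_triangle_le_diff)
  then have "(real n * \<bar>r\<bar>) * norm (B ^ n) \<le> (2 * norm M) * norm (B ^ n)"
    by (simp add: cm_power[OF assms(1)] abs_mult algebra_simps)
  moreover have "2 * norm M < real n * \<bar>r\<bar>" using n assms(2) by (simp add: divide_less_eq)
  ultimately have "norm (B ^ n) \<le> 0"
    by (meson linorder_not_le mult_strict_right_mono not_less)
  then show ?thesis by auto
qed

text \<open>
  The Ricci solitons \<open>B + K\<close> with non-normal matrix: \<open>B\<close> is a nilsoliton, and the skew part \<open>K\<close> does not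
  change the metric up to isometry. The vector \<open>e\<close> is the unit normal of the abelian ideal.
\<close>

definition soliton_pair :: "'a::euclidean_space \<Rightarrow> 'a endo \<Rightarrow> 'a endo \<Rightarrow> real \<Rightarrow> bool" where
  "soliton_pair e B K r \<longleftrightarrow> tp K = - K \<and> cm B K = 0 \<and> cm (tp B) K = 0 \<and> r > 0 \<and>
     cm (mom B) B = r *\<^sub>R B \<and> adm e B \<and> adm e K \<and> B \<noteq> 0"

lemma soliton_pair_scale:
  "soliton_pair e B K r \<Longrightarrow> t > 0 \<Longrightarrow> soliton_pair e (t *\<^sub>R B) K (t\<^sup>2 * r)"
  by (auto simp: soliton_pair_def cm_linear mom_scaleR mult_ac)

context
  fixes e :: "'a::euclidean_space" and B K :: "'a endo" and r :: real
  assumes sp: "soliton_pair e B K r"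
begin

lemma soliton_pair_facts:
  "tp K = - K" "cm B K = 0" "cm (tp B) K = 0" "cm K B = 0" "cm K (tp B) = 0"
  "cm (mom B) K = 0" "cm K (mom B) = 0" "mom (B + K) = mom B" "tr (B + K) = 0"
  "(norm (mom B))\<^sup>2 = r * (norm B)\<^sup>2" "tau (B + K) = (norm B)\<^sup>2 / 2" "mom B \<noteq> 0" "sy (B + K) \<noteq> 0"
  "pinch (B + K) = 1 / (1 + (norm (mom B))\<^sup>2 / ((norm B)\<^sup>2)\<^sup>2)"
proof -
  show 1: "tp K = - K" "cm B K = 0" "cm (tp B) K = 0" using sp by (auto simp: soliton_pair_def)
  show 2: "cm K B = 0" "cm K (tp B) = 0" using 1 cm_swap[of K B] cm_swap[of K "tp B"] by auto
  show 3: "cm K (mom B) = 0" by (simp add: mom_def cm_jacobi 2 cm_linear)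
  then show "cm (mom B) K = 0" using cm_swap[of "mom B" K] by simp
  show m: "mom (B + K) = mom B" by (simp add: mom_def cm_linear 1 2)
  have r: "r > 0" and B: "B \<noteq> 0" and s: "cm (mom B) B = r *\<^sub>R B"
    using sp by (auto simp: soliton_pair_def)
  have "tr K = tr (tp K)" by simp
  then have "tr K = 0" unfolding 1 by simp
  moreover have "tr B = 0" using tr_eigen[OF s] r by simp
  ultimately show t: "tr (B + K) = 0" by simp
  show n: "(norm (mom B))\<^sup>2 = r * (norm B)\<^sup>2"
    using inner_cm_self_mom[of B] by (simp add: s power2_norm_eq_inner)
  have "sy (B + K) = sy B" by (simp add: sy_def 1)
  then have "tau (B + K) = tau B" by (simp add: tau_def)
  also have "tr (B * B) = 0" using tr_eigen_square[OF s] r by simp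
  then have "tau B = (norm B)\<^sup>2 / 2" by (simp add: tau_alt)
  finally show ta: "tau (B + K) = (norm B)\<^sup>2 / 2" .
  show "sy (B + K) \<noteq> 0" using tau_pos_iff[of "B + K"] ta B by simp
  show "mom B \<noteq> 0" using n r B by auto
  have "(norm B)\<^sup>2 > 0" using B by simp
  from pinch_traceless[OF t ta this]
  show "pinch (B + K) = 1 / (1 + (norm (mom B))\<^sup>2 / ((norm B)\<^sup>2)\<^sup>2)" by (simp only: m)
qed

text \<open>The flow of M rescales B and fixes K, so the metrics with matrices t B + K, t > 0, all
  belong to the same group.\<close>

lemma orbit_mom_soliton_pair: "orbit (mom B) (B + K) s = exp (r * s) *\<^sub>R B + K"
proof -
  have "mom B * B = B * (mom B + r *\<^sub>R 1)"
    using sp by (simp add: soliton_pair_def cm_def algebra_simps)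
  then have 1: "expo (mom B) s * B = exp (r * s) *\<^sub>R (B * expo (mom B) s)" by (rule expo_intertwine)
  have "mom B * K = K * mom B" using soliton_pair_facts(6) by (simp add: cm_def)
  then have 2: "expo (mom B) s * K = K * expo (mom B) s" by (rule expo_commute)
  show ?thesis
    unfolding orbit_def distrib_left 1 2 distrib_right mult_scaleR_left mult.assoc expo_inverse
    by simp
qed

text \<open>\<open>mom B\<close> preserves the kernel of \<open>tp B\<close>, which therefore has a
  basis of its eigenvectors. If K vanished on this kernel, it would vanish on the kernels of all
  powers of \<open>tp B\<close>: inductively K x lies in the kernel, so K K x = 0 and K x = 0 by
  skewness. As \<open>tp B\<close> is nilpotent, K would be zero.\<close>

lemma lowest_weight_vector:
  assumes "K \<noteq> 0"
  obtains v c where "app (tp B) v = 0" "app (mom B) v = c *\<^sub>R v" "app K v \<noteq> 0"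
proof (rule ccontr)
  assume neg: "\<not> thesis"
  note ex = that
  let ?V = "{x. app (tp B) x = 0}"
  have sub: "subspace ?V" by (auto simp: subspace_def)
  have tB: "cm (mom B) (tp B) = - r *\<^sub>R tp B"
  proof -
    have "tp (cm (mom B) B) = r *\<^sub>R tp B" using sp by (simp add: soliton_pair_def)
    moreover have "cm (mom B) (tp B) = - cm (tp B) (mom B)" by (rule cm_swap)
    ultimately show ?thesis by (simp add: tp_cm)
  qed
  have "app (mom B) x \<in> ?V" if "x \<in> ?V" for x
    using arg_cong[OF tB, of "\<lambda>z. app z x"] that by (simp add: cm_def)
  from spectral_basis[OF tp_mom sub this] obtain S where
    S: "S \<subseteq> ?V" "span S = ?V" "\<forall>b\<in>S. \<exists>c. app (mom B) b = c *\<^sub>R b" by blast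
  have K0: "app K b = 0" if b: "b \<in> S" for b
  proof -
    obtain c where c: "app (mom B) b = c *\<^sub>R b" using bspec[OF S(3) b] by (elim exE)
    have "b \<in> ?V" using S(1) b by (rule subsetD)
    then have "app (tp B) b = 0" by simp
    then show ?thesis using neg ex[OF _ c] by argo
  qed
  have z: "app K x = 0" if "x \<in> ?V" for x
  proof -
    have "x \<in> span S" using that S(2) by simp
    then show ?thesis
    proof (rule span_induct)
      show "subspace {x. app K x = 0}" by (auto simp: subspace_def)
      show "app K b = 0" if "b \<in> S" for b using K0 that .
    qed
  qed
  have c: "app (tp B) (app K x) = app K (app (tp B) x)" for x
    using arg_cong[OF soliton_pair_facts(3), of "\<lambda>z. app z x"] by (simp add: cm_def)
  have sk: "app K x \<bullet> y = - (x \<bullet> app K y)" for x y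
    using app_tp[of K x y] soliton_pair_facts(1) by simp
  have "app K x = 0" if "app (tp B ^ k) x = 0" for k x
    using that
  proof (induction k arbitrary: x)
    case (Suc k)
    then have "app (tp B ^ k) (app (tp B) x) = 0" by (simp add: power_commutes[symmetric])
    from Suc.IH[OF this] have "app (tp B) (app K x) = 0" by (simp add: c)
    then have "app K (app K x) = 0" using z by simp
    then have "app K x \<bullet> app K x = 0" by (simp add: sk)
    then show ?case by simp
  qed simp
  moreover obtain n where "tp B ^ n = 0"
    using eigen_nilpotent[OF tB] sp by (auto simp: soliton_pair_def)
  ultimately have "app K x = app 0 x" for x by (metis app_simps(1))
  then show False using assms endo_eqI by blast
qed

text \<open>P projects onto the span of the vectors B^n v for a lowest weight vector v; this span is
  stable under B^t because [B, B^t] = mom B. K v is orthogonal to it: to v by skewness, and to B^n v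
  with n > 0 because the eigenvalues c and c + n r of \<open>mom B\<close> differ. Hence P kills K v
  but fixes v, while K v \<noteq> 0.\<close>

lemma symmetric_commutant:
  assumes "K \<noteq> 0"
  obtains P where "tp P = P" "adm e P" "cm P B = 0" "cm P (tp B) = 0" "cm P K \<noteq> 0"
proof -
  obtain v0 c where v0: "app (tp B) v0 = 0" "app (mom B) v0 = c *\<^sub>R v0" "app K v0 \<noteq> 0"
    using lowest_weight_vector[OF assms] by blast
  have cK: "app (tp B) (app K x) = app K (app (tp B) x)" "app (mom B) (app K x) = app K (app (mom B) x)" for x
    using arg_cong[OF soliton_pair_facts(3), of "\<lambda>z. app z x"]
      arg_cong[OF soliton_pair_facts(6), of "\<lambda>z. app z x"] by (auto simp: cm_def)
  have sk: "app K x \<bullet> y = - (x \<bullet> app K y)" for x y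
    using app_tp[of K x y] soliton_pair_facts(1) by simp
  have s: "cm (mom B) B = r *\<^sub>R B" and r: "r > 0" and ad: "adm e B" "adm e K"
    using sp by (auto simp: soliton_pair_def)
  \<comment> \<open>replacing \<open>v0\<close> by \<open>K v0\<close> makes it orthogonal to \<open>e\<close>\<close>
  define v where "v = app K v0"
  have v: "app (tp B) v = 0" "app (mom B) v = c *\<^sub>R v" by (simp_all add: v_def cK v0)
  have Kv: "app K v \<noteq> 0"
  proof
    assume "app K v = 0"
    then have "v \<bullet> v = 0" by (simp add: v_def sk)
    then show False using v0 by (simp add: v_def)
  qed
  let ?S = "range (\<lambda>n. app (B ^ n) v)"
  let ?U = "span ?S"
  have MB: "app (mom B) (app (B ^ n) v) = (c + real n * r) *\<^sub>R app (B ^ n) v" for n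
    using arg_cong[OF cm_power[OF s, of n], of "\<lambda>z. app z v"] v
    by (simp add: cm_def algebra_simps)
  have BU: "app B u \<in> ?U" if "u \<in> ?U" for u
    using that
  proof (rule span_induct)
    show "subspace {u. app B u \<in> ?U}"
      by (auto simp: subspace_def intro: span_add span_scale span_zero)
    have "app B (app (B ^ n) v) = app (B ^ Suc n) v" for n by simp
    then show "app B u \<in> ?U" if "u \<in> ?S" for u
      using that by (auto intro!: span_base simp del: power_Suc)
  qed
  have tBn: "app (tp B) (app (B ^ n) v) \<in> ?U" for n
  proof (induction n)
    case (Suc n)
    have "app (tp B) (app B x) = app B (app (tp B) x) - app (mom B) x" for x
      by (simp add: mom_def cm_def)
    then have "app (tp B) (app (B ^ Suc n) v)
        = app B (app (tp B) (app (B ^ n) v)) - (c + real n * r) *\<^sub>R app (B ^ n) v"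
      by (simp add: MB)
    moreover have "app (B ^ n) v \<in> ?U" by (intro span_base) simp
    ultimately show ?case using BU[OF Suc] by (simp only: span_diff span_scale)
  qed (simp add: v span_zero)
  have tBU: "app (tp B) u \<in> ?U" if "u \<in> ?U" for u
    using that
  proof (rule span_induct)
    show "subspace {u. app (tp B) u \<in> ?U}"
      by (auto simp: subspace_def intro: span_add span_scale span_zero)
  qed (use tBn in auto)
  have KvU: "app K v \<bullet> u = 0" if "u \<in> ?U" for u
    using that
  proof (rule span_induct)
    show "subspace {u. app K v \<bullet> u = 0}" by (auto simp: subspace_def inner_simps)
    fix u assume "u \<in> ?S"
    then obtain n where u: "u = app (B ^ n) v" by blast
    show "app K v \<bullet> u = 0"
    proof (cases "n = 0")
      case True
      then show ?thesis using sk[of v v] by (simp add: u inner_commute)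
    next
      case False
      have "app (mom B) (app K v) \<bullet> u = app K v \<bullet> app (mom B) u"
        using app_tp[of "mom B"] by simp
      then have "real n * r * (app K v \<bullet> u) = 0"
        by (simp add: cK v u MB) (auto simp: algebra_simps)
      then show ?thesis using False r by simp
    qed
  qed
  have eU: "e \<bullet> u = 0" if "u \<in> ?U" for u
    using that
  proof (rule span_induct)
    show "subspace {u. e \<bullet> u = 0}" by (auto simp: subspace_def inner_simps)
    fix u assume "u \<in> ?S"
    then obtain n where u: "u = app (B ^ n) v" by blast
    show "e \<bullet> u = 0"
    proof (cases n)
      case 0
      then show ?thesis using ad app_tp[of K e v0] by (simp add: u v_def adm_def)
    next
      case (Suc m)
      then show ?thesis using ad app_tp[of B e "app (B ^ m) v"] by (simp add: u adm_def)
    qed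
  qed
  obtain P where P: "tp P = P" "\<And>x. app P x \<in> ?U" "\<And>x. x \<in> ?U \<Longrightarrow> app P x = x"
    "\<And>x. (\<And>u. u \<in> ?U \<Longrightarrow> x \<bullet> u = 0) \<Longrightarrow> app P x = 0"
    "\<And>T. (\<And>u. u \<in> ?U \<Longrightarrow> app T u \<in> ?U) \<Longrightarrow> (\<And>u. u \<in> ?U \<Longrightarrow> app (tp T) u \<in> ?U) \<Longrightarrow> cm P T = 0"
    using orthogonal_projection[OF subspace_span] by blast
  show thesis
  proof
    show "tp P = P" by fact
    have "app P e = 0" by (rule P(4)[OF eU])
    then show "adm e P" by (simp add: adm_def P(1))
    show "cm P B = 0" using P(5) BU tBU by blast
    show "cm P (tp B) = 0" using P(5)[of "tp B"] BU tBU by simp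
    show "cm P K \<noteq> 0"
    proof
      assume "cm P K = 0"
      then have "app P (app K v) = app K (app P v)"
        by (metis app_simps(6) cm_def eq_iff_diff_eq_0)
      moreover have "v \<in> ?U" using span_base[of "app (B ^ 0) v" ?S] by (metis app_simps(2) power_0 rangeI)
      moreover have "app P (app K v) = 0" by (rule P(4)[OF KvU])
      ultimately show False using P(3) Kv by simp
    qed
  qed
qed

text \<open>As P commutes with B and B^t, only K moves along the orbit. The first derivative of
  \<open>tau\<close> vanishes, and the second-order condition weighs the growth of
  \<open>tau\<close>, governed by [P, K], against that of |M|^2, governed by [K, [P, K]].\<close>

lemma soliton_pair_second_order:
  assumes P: "tp P = P" "adm e P" "cm P B = 0" "cm P (tp B) = 0"
    and lm: "local_max_direction e (B + K)"
  shows "(norm (mom B))\<^sup>2 * (norm (cm P K))\<^sup>2 \<le> (norm B)\<^sup>2 * (norm (cm K (cm P K)))\<^sup>2"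
proof -
  note f = soliton_pair_facts
  let ?Y = "cm P K" and ?Z = "cm K (cm P K)"
  have sw: "cm x y = 0 \<Longrightarrow> cm y x = 0" for x y :: "'a endo" using cm_swap[of y x] by simp
  have EA: "cm P (B + K) = ?Y" by (simp add: cm_linear P)
  have tY: "tp ?Y = ?Y" using cm_swap[of P K] by (simp add: tp_cm P f cm_linear)
  have BY: "cm B ?Y = 0" "cm (tp B) ?Y = 0"
    by (simp_all add: cm_jacobi f P(3,4)[THEN sw] cm_linear)
  have PM: "cm P (mom B) = 0" by (simp add: mom_def cm_jacobi P cm_linear)
  have MY: "cm (mom B) ?Y = 0" by (simp add: cm_jacobi f PM[THEN sw] cm_linear)
  have BZ: "cm B ?Z = 0" using cm_jacobi[of B K ?Y] by (simp add: f BY cm_linear)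
  have W: "cm (mom B) (B + K) = r *\<^sub>R B"
    using sp by (simp add: cm_linear f soliton_pair_def)
  have T1: "inner ?Y (B + K) = 0"
  proof -
    have "inner ?Y (B + K) = inner P (cm (B + K) (tp K))" by (rule inner_cm_left)
    then show ?thesis by (simp add: f cm_linear)
  qed
  have dm: "dmom P (B + K) = 2 *\<^sub>R ?Z"
    using cm_swap[of ?Y K] BY[THEN sw] BY
    unfolding dmom_def EA tY by (simp add: cm_linear f scaleR_2)
  have Q2: "inner (cm P ?Y) (r *\<^sub>R B) + inner ?Y (cm (2 *\<^sub>R ?Z) (B + K) + cm (mom B) ?Y) = 2 * (norm ?Z)\<^sup>2"
  proof -
    have "inner (cm P ?Y) B = inner ?Y (cm (tp P) B)" by (rule inner_cm_right)
    then have 1: "inner (cm P ?Y) B = 0" by (simp add: P)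
    have "inner (cm ?Z K) ?Y = inner ?Z (cm ?Y (tp K))" by (rule inner_cm_left)
    also have "cm ?Y (tp K) = ?Z" using cm_swap[of ?Y K] by (simp add: f cm_linear)
    finally show ?thesis
      by (simp add: 1 cm_linear BZ[THEN sw] MY inner_commute[of ?Y] power2_norm_eq_inner)
  qed
  have "\<forall>\<^sub>F t in at 0. pinch (orbit P (B + K) t) \<le> pinch (B + K)"
    using lm P by (auto simp: local_max_direction_def)
  from second_order_condition(2)[OF P(1) f(13) this]
  have le: "2 * (tau (B + K) * (2 * (norm ?Y)\<^sup>2)) \<le>
     pinch (B + K) * (2 * (tau (B + K) * (2 * (norm ?Y)\<^sup>2)) + 2 * (norm ?Z)\<^sup>2)"
    unfolding EA f(8) W T1 f(9) dm Q2 by (simp add: algebra_simps)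
  define x y where "x = (norm B)\<^sup>2" and "y = (norm (mom B))\<^sup>2"
  have x: "x > 0" "y \<ge> 0" using sp by (auto simp: x_def y_def soliton_pair_def)
  then have p: "1 + y / x\<^sup>2 > 0" by (simp add: add_pos_nonneg)
  have "2 * x * (norm ?Y)\<^sup>2 \<le> (2 * x * (norm ?Y)\<^sup>2 + 2 * (norm ?Z)\<^sup>2) / (1 + y / x\<^sup>2)"
    using le by (simp add: f(11,14) x_def[symmetric] y_def[symmetric] mult.assoc)
  then have "2 * x * (norm ?Y)\<^sup>2 * (1 + y / x\<^sup>2) \<le> 2 * x * (norm ?Y)\<^sup>2 + 2 * (norm ?Z)\<^sup>2"
    using p by (simp add: le_divide_eq)
  then have "2 * ((y / x) * (norm ?Y)\<^sup>2) \<le> 2 * (norm ?Z)\<^sup>2"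
    using x by (simp add: algebra_simps power2_eq_square)
  then have "(y / x) * (norm ?Y)\<^sup>2 \<le> (norm ?Z)\<^sup>2" by simp
  then show ?thesis using x unfolding x_def[symmetric] y_def[symmetric] by (simp add: field_simps)
qed

end

text \<open>Replacing B by t B multiplies the left side of the second-order inequality by t^4 but
  the right side only by t^2, so it fails for large t.\<close>

lemma soliton_pair_not_local_max:
  assumes sp: "soliton_pair e B K r" and K: "K \<noteq> 0"
  obtains s where "\<not> local_max_direction e (exp (r * s) *\<^sub>R B + K)"
proof -
  have r: "r > 0" using sp by (simp add: soliton_pair_def)
  obtain P where P: "tp P = P" "adm e P" "cm P B = 0" "cm P (tp B) = 0" "cm P K \<noteq> 0"
    using symmetric_commutant[OF sp K] by blast
  let ?c = "(norm (mom B))\<^sup>2 * (norm (cm P K))\<^sup>2" and ?d = "(norm B)\<^sup>2 * (norm (cm K (cm P K)))\<^sup>2"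
  have c: "?c > 0" using P(5) soliton_pair_facts(12)[OF sp] by simp
  \<comment> \<open>By exp x \<ge> 1 + x this makes the factor at least 1 + d / c, just beyond the
    range in which the inequality can hold.\<close>
  define s where "s = ?d / ?c / r"
  let ?t = "exp (r * s)"
  have "r * s = ?d / ?c" using r by (simp add: s_def)
  have t1: "?t \<ge> 1 + ?d / ?c" unfolding \<open>r * s = _\<close> by (rule exp_ge_add_one_self)
  show thesis
  proof (rule that[of s], rule notI)
    assume lm: "local_max_direction e (?t *\<^sub>R B + K)"
    have "cm P (?t *\<^sub>R B) = 0" "cm P (tp (?t *\<^sub>R B)) = 0" using P by (simp_all add: cm_linear)
    from soliton_pair_second_order[OF soliton_pair_scale[OF sp] P(1,2) this lm]
    have "?t\<^sup>2 * (?t\<^sup>2 * ?c) \<le> ?t\<^sup>2 * ?d"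
      by (simp add: mom_scaleR power_mult_distrib power2_eq_square[of "?t\<^sup>2"] mult.assoc
          flip: power_mult)
    then have "?t\<^sup>2 * ?c \<le> ?d" by (rule mult_left_le_imp_le) simp
    moreover have "?t * ?c \<le> ?t\<^sup>2 * ?c"
    proof (intro mult_right_mono self_le_power)
      have "0 \<le> ?d / ?c" by simp
      with t1 show "1 \<le> ?t" by linarith
    qed simp_all
    moreover have "(1 + ?d / ?c) * ?c \<le> ?t * ?c" using t1 c by (intro mult_right_mono) auto
    moreover have "(1 + y / x) * x = x + y" if "x > 0" for x y :: real
      using that by (simp add: field_simps)
    from this[OF c] have "(1 + ?d / ?c) * ?c = ?c + ?d" .
    ultimately show False using c by linarith
  qed
qed

section \<open>Gram--Schmidt along a weighted flag\<close>

lemma span_insert_shift: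
  assumes "p \<in> span T" "c \<noteq> 0" shows "span (insert (c *\<^sub>R (x - p)) T) = span (insert x T)"
proof (rule antisym)
  have p: "p \<in> span (insert y T)" for y using assms(1) span_mono[of T "insert y T"] by blast
  have T: "T \<subseteq> span (insert y T)" for y using span_superset[of "insert y T"] by blast
  have x: "y \<in> span (insert y T)" for y by (simp add: span_base)
  show "span (insert (c *\<^sub>R (x - p)) T) \<subseteq> span (insert x T)"
    by (rule span_minimal) (use p T x in \<open>auto intro!: span_scale span_diff\<close>)
  have "x = (1 / c) *\<^sub>R (c *\<^sub>R (x - p)) + p" using assms(2) by simp
  also have "\<dots> \<in> span (insert (c *\<^sub>R (x - p)) T)" by (intro span_add span_scale p x)
  finally show "span (insert x T) \<subseteq> span (insert (c *\<^sub>R (x - p)) T)"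
    by (intro span_minimal) (use T in auto)
qed

text \<open>Vectors are orthonormalised by decreasing weight. A set closed under larger or equal
  weights is then an initial segment, never cutting through a tie, and Gram-Schmidt preserves its
  span.\<close>

lemma gram_schmidt_flag:
  fixes b :: "'a::euclidean_space \<Rightarrow> real"
  assumes g: "inner_product g" and "finite B" "independent B"
  shows "\<exists>e. (\<forall>x\<in>B. \<forall>y\<in>B. g (e x) (e y) = (if x = y then 1 else 0)) \<and>
    (\<forall>U\<subseteq>B. (\<forall>x\<in>U. \<forall>y\<in>B. b x \<le> b y \<longrightarrow> y \<in> U) \<longrightarrow> span (e ` U) = span U)"
  using assms(2,3)
proof (induction rule: finite_ranking_induct[where f = "\<lambda>x. - b x"])
  case empty
  show ?case by auto
next
  case (insert x S)
  show ?case
  proof (cases "x \<in> S")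
    case True then show ?thesis using insert by (simp add: insert_absorb)
  next
    case False
    have bl: "bilinear g" and sym: "\<And>x y. g x y = g y x" and pos: "\<And>x. x \<noteq> 0 \<Longrightarrow> g x x > 0"
      using g by (auto simp: inner_product_def)
    have ind: "independent S" using insert.prems by (simp add: independent_insert False)
    have xS: "x \<notin> span S" using insert.prems False by (simp add: independent_insert)
    obtain e where e: "\<And>x y. x \<in> S \<Longrightarrow> y \<in> S \<Longrightarrow> g (e x) (e y) = (if x = y then 1 else 0)"
      and fl: "\<And>U. U \<subseteq> S \<Longrightarrow> (\<forall>x\<in>U. \<forall>y\<in>S. b x \<le> b y \<longrightarrow> y \<in> U) \<Longrightarrow> span (e ` U) = span U"
      using insert.IH[OF ind] by blast
    have S: "span (e ` S) = span S" by (rule fl) auto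
    define p where "p = (\<Sum>y\<in>S. g x (e y) *\<^sub>R e y)"
    have p: "p \<in> span (e ` S)" unfolding p_def by (intro span_sum span_scale span_base imageI)
    define w where "w = x - p"
    have w0: "w \<noteq> 0" using xS p S by (auto simp: w_def)
    define c where "c = 1 / sqrt (g w w)"
    have "c * c = 1 / g w w" using pos[OF w0] by (simp add: c_def)
    then have c: "c \<noteq> 0" "c * c * g w w = 1" using pos[OF w0] by auto
    have wS: "g w (e y) = 0" if "y \<in> S" for y
    proof -
      have "g p (e y) = (\<Sum>z\<in>S. g x (e z) * g (e z) (e y))"
        using bl unfolding p_def
        by (simp add: linear_sum[of "\<lambda>x. g x (e y)"] bilinear_def bilinear_lmul[OF bl])
      also have "\<dots> = (\<Sum>z\<in>S. if z = y then g x (e y) else 0)"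
        using e that by (intro sum.cong) auto
      also have "\<dots> = g x (e y)" using insert.hyps(1) that by simp
      finally show ?thesis by (simp add: w_def bilinear_lsub[OF bl])
    qed
    define e' where "e' = e(x := c *\<^sub>R w)"
    have e'S: "e' ` U = e ` U" if "U \<subseteq> S" for U using that False by (auto simp: e'_def)
    have "g (e' u) (e' v) = (if u = v then 1 else 0)" if "u \<in> insert x S" "v \<in> insert x S" for u v
    proof -
      have wS': "g (e y) w = 0" if "y \<in> S" for y using wS[OF that] sym by metis
      show ?thesis using that False e wS wS' c(2)
        by (auto simp: e'_def bilinear_lmul[OF bl] bilinear_rmul[OF bl])
    qed
    moreover have "span (e' ` U) = span U"
      if U: "U \<subseteq> insert x S" "\<forall>u\<in>U. \<forall>y\<in>insert x S. b u \<le> b y \<longrightarrow> y \<in> U" for U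
    proof (cases "x \<in> U")
      case True
      then have "U = insert x S" using U insert.hyps(2) by auto
      moreover have "e' ` insert x S = insert (c *\<^sub>R (x - p)) (e ` S)"
        by (simp only: image_insert e'S[OF subset_refl]) (simp add: e'_def w_def)
      moreover have "span (insert x (e ` S)) = span (insert x S)"
        unfolding span_insert S ..
      ultimately show ?thesis using span_insert_shift[OF p c(1)] by simp
    next
      case False
      then have "U \<subseteq> S" using U(1) by blast
      then show ?thesis using fl[of U] U(2) e'S by auto
    qed
    ultimately show ?thesis by (intro exI[of _ e']) blast
  qed
qed

section \<open>Orthonormal bases and flags of eigenspaces\<close>

lemma inner_product_inner: "inner_product (\<lambda>x y. x \<bullet> y)"
  by (auto simp: inner_product_def bilinear_def inner_commute linear_conv_bounded_linear
      bounded_linear_inner_left bounded_linear_inner_right)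

lemma tr_outer [simp]: "tr (outer u v) = u \<bullet> v"
  by (simp add: tr_alt euclidean_inner[of u v] mult.commute inner_commute)

lemma mult_outer: "a * outer u v = outer (app a u) v"
  by (rule endo_eqI) simp

lemma linear_on_span_eqI:
  assumes "\<And>x. x \<in> S \<Longrightarrow> app f x = app g x" "span S = UNIV" shows "f = g"
proof (rule endo_eqI)
  fix x
  have "x \<in> span S" using assms(2) by simp
  then show "app f x = app g x"
    by (rule span_induct) (auto simp: subspace_def assms(1))
qed

context
  fixes F :: "'a::euclidean_space set" and e :: "'a \<Rightarrow> 'a"
  assumes fin: "finite F" and ortho: "\<forall>x\<in>F. \<forall>y\<in>F. e x \<bullet> e y = (if x = y then 1 else 0)"
    and sp: "span (e ` F) = UNIV"
begin

lemma resolution_of_identity: "(\<Sum>f\<in>F. outer (e f) (e f)) = 1"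
proof (rule linear_on_span_eqI[OF _ sp])
  fix x assume "x \<in> e ` F"
  then obtain y where y: "y \<in> F" "x = e y" by blast
  have "app (\<Sum>f\<in>F. outer (e f) (e f)) x = (\<Sum>f\<in>F. if f = y then e y else 0)"
    unfolding app_sum_left using y ortho by (intro sum.cong) auto
  then show "app (\<Sum>f\<in>F. outer (e f) (e f)) x = app 1 x" using fin y by simp
qed

lemma tr_orthonormal: "tr a = (\<Sum>f\<in>F. app a (e f) \<bullet> e f)"
proof -
  have "a = a * (\<Sum>f\<in>F. outer (e f) (e f))" by (simp add: resolution_of_identity)
  also have "\<dots> = (\<Sum>f\<in>F. outer (app a (e f)) (e f))" by (simp add: sum_distrib_left mult_outer)
  finally have "tr a = tr (\<Sum>f\<in>F. outer (app a (e f)) (e f))" by simp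
  also have "\<dots> = (\<Sum>f\<in>F. app a (e f) \<bullet> e f)"
    by (simp add: bounded_linear.linear[OF bounded_linear_tr, THEN linear_sum])
  finally show ?thesis .
qed

lemma inner_orthonormal: "inner a c = (\<Sum>f\<in>F. app a (e f) \<bullet> app c (e f))"
proof -
  have "inner a c = tr (tp c * a)" by (simp add: inner_endo_def tr_commute)
  then show ?thesis by (simp add: tr_orthonormal app_tp)
qed

lemma norm_orthonormal: "y \<bullet> y = (\<Sum>f\<in>F. (y \<bullet> e f)\<^sup>2)"
proof -
  have "y = app (\<Sum>f\<in>F. outer (e f) (e f)) y" by (simp add: resolution_of_identity)
  then have "y \<bullet> y = (\<Sum>f\<in>F. (y \<bullet> e f) *\<^sub>R e f) \<bullet> y" by (simp add: app_sum_left)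
  then show ?thesis by (simp add: inner_sum_left inner_sum_right power2_eq_square inner_commute)
qed

end

lemma eigenspace_span:
  fixes b :: "'a::euclidean_space \<Rightarrow> real"
  assumes F: "finite F" "independent F" "span F = UNIV" and ev: "\<forall>f\<in>F. app \<beta> f = b f *\<^sub>R f"
    and v: "app \<beta> v = c *\<^sub>R v"
  shows "v \<in> span {f \<in> F. b f = c}"
proof -
  have "v \<in> span F" using F(3) by simp
  then obtain u where u: "v = (\<Sum>f\<in>F. u f *\<^sub>R f)" using span_finite[OF F(1)] by auto
  have "(\<Sum>f\<in>F. (u f * (b f - c)) *\<^sub>R f) = app \<beta> v - c *\<^sub>R v"
    unfolding u app_sum by (simp add: ev scaleR_sum_right sum_subtractf[symmetric] algebra_simps)
  also have "\<dots> = 0" using v by simp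
  finally have z0: "(\<Sum>f\<in>F. (u f * (b f - c)) *\<^sub>R f) = 0" .
  have z: "u f * (b f - c) = 0" if "f \<in> F" for f
    by (rule independentD[OF F(2,1) subset_refl z0 that])
  have "(\<Sum>f\<in>F. u f *\<^sub>R f) \<in> span {f \<in> F. b f = c}"
  proof (rule span_sum)
    fix f assume f: "f \<in> F"
    show "u f *\<^sub>R f \<in> span {f \<in> F. b f = c}"
    proof (cases "b f = c")
      case True with f show ?thesis by (intro span_scale span_base) auto
    next
      case False with z[OF f] show ?thesis by (simp add: span_zero)
    qed
  qed
  then show ?thesis using u by simp
qed

text \<open>
  \<open>R\<close> is the symmetric endomorphism with the eigenvalues of \<open>\<beta>\<close> and the same flag of sums of
  eigenspaces to eigenvalues at least \<open>r\<close>; the difference \<open>R - \<beta>\<close> strictly raises this flag.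
\<close>

lemma flag_operator:
  fixes b :: "'a::euclidean_space \<Rightarrow> real"
  assumes F: "finite F" "independent F" "span F = UNIV" and ev: "\<forall>f\<in>F. app \<beta> f = b f *\<^sub>R f"
  obtains R where "tp R = R" "tr (R * R) = tr (\<beta> * \<beta>)"
    "\<And>Z. cm \<beta> Z = 0 \<Longrightarrow> tr (Z * R) = tr (Z * \<beta>)"
    "\<And>Z c. cm \<beta> Z = c *\<^sub>R Z \<Longrightarrow> c * (norm Z)\<^sup>2 \<le> inner (cm R Z) Z"
proof -
  obtain e where e: "\<forall>x\<in>F. \<forall>y\<in>F. e x \<bullet> e y = (if x = y then 1 else 0)"
    and fl: "\<And>U. U \<subseteq> F \<Longrightarrow> (\<forall>x\<in>U. \<forall>y\<in>F. b x \<le> b y \<longrightarrow> y \<in> U) \<Longrightarrow> span (e ` U) = span U"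
    using gram_schmidt_flag[OF inner_product_inner F(1,2), of b] by blast
  have sp: "span (e ` F) = UNIV" using fl[of F] F(3) by auto
  define R where "R = (\<Sum>f\<in>F. b f *\<^sub>R outer (e f) (e f))"
  have R: "app R x = (\<Sum>f\<in>F. (b f * (x \<bullet> e f)) *\<^sub>R e f)" for x
    by (simp add: R_def app_sum_left)
  have tpR: "tp R = R"
    by (rule tp_eqI) (simp add: R inner_sum_left inner_sum_right inner_commute mult_ac)
  have Re: "app R (e f) = b f *\<^sub>R e f" if "f \<in> F" for f
  proof -
    have "app R (e f) = (\<Sum>f'\<in>F. if f' = f then b f *\<^sub>R e f else 0)"
      unfolding R using e that by (intro sum.cong) auto
    then show ?thesis using F(1) that by simp
  qed
  let ?ge = "\<lambda>r. span {f \<in> F. b f \<ge> r}" and ?gt = "\<lambda>r. span {f \<in> F. b f > r}"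
  have ge: "span (e ` {f \<in> F. b f \<ge> r}) = ?ge r" and gt: "span (e ` {f \<in> F. b f > r}) = ?gt r" for r
    by (rule fl; force)+
  have e_ge: "e f \<in> ?ge (b f)" if "f \<in> F" for f
    unfolding ge[symmetric] using that by (intro span_base) auto
  \<comment> \<open>On the subspace of eigenvalues at least \<open>r\<close>, the map r - \<beta>
    kills the eigenspace to \<open>r\<close> and so lands strictly higher in the flag.\<close>
  have shift: "r *\<^sub>R v - app \<beta> v \<in> ?gt r" if "v \<in> ?ge r" for r v
    using that
  proof (rule span_induct)
    show "subspace {v. r *\<^sub>R v - app \<beta> v \<in> ?gt r}"
    proof -
      have "linear (\<lambda>v. r *\<^sub>R v - app \<beta> v)"
        by (intro linear_compose_sub linear_app linear_scale_self)
      then have "subspace ((\<lambda>v. r *\<^sub>R v - app \<beta> v) -` ?gt r)"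
        by (rule linear_subspace_vimage) simp
      then show ?thesis by (simp add: vimage_def)
    qed
    fix f assume f: "f \<in> {f \<in> F. b f \<ge> r}"
    have "r *\<^sub>R f - app \<beta> f = (r - b f) *\<^sub>R f" using f by (simp add: ev algebra_simps)
    also have "\<dots> \<in> ?gt r"
    proof (cases "b f = r")
      case False with f show ?thesis by (intro span_scale span_base) auto
    qed (simp add: span_zero)
    finally show "r *\<^sub>R f - app \<beta> f \<in> ?gt r" .
  qed
  have perp: "y \<bullet> e f = 0" if f: "f \<in> F" and U: "U \<subseteq> F" "f \<notin> U" and y: "y \<in> span (e ` U)" for y f U
    using y
  proof (rule span_induct)
    show "subspace {y. y \<bullet> e f = 0}" by (auto simp: subspace_def inner_simps)
    show "x \<bullet> e f = 0" if "x \<in> e ` U" for x using that e f U by fastforce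
  qed
  \<comment> \<open>Z (R - \<beta>) is strictly triangular for the flag, so its diagonal entries in
    the basis \<open>e\<close> vanish.\<close>
  have tr0: "tr (Z * (R - \<beta>)) = 0" if Z: "\<And>r v. v \<in> ?gt r \<Longrightarrow> app Z v \<in> ?gt r" for Z
    unfolding tr_orthonormal[OF F(1) e sp]
  proof (rule sum.neutral, rule ballI)
    fix f assume f: "f \<in> F"
    have "app (R - \<beta>) (e f) \<in> ?gt (b f)" using shift[OF e_ge[OF f]] by (simp add: Re f)
    from Z[OF this] have "app (Z * (R - \<beta>)) (e f) \<in> span (e ` {f' \<in> F. b f' > b f})"
      by (simp only: gt app_simps(6))
    with f show "app (Z * (R - \<beta>)) (e f) \<bullet> e f = 0"
      by (intro perp[where U = "{f' \<in> F. b f' > b f}"]) auto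
  qed
  \<comment> \<open>An eigenvector Z of the commutator with \<beta> shifts the eigenvalues of
    \<beta> by \<open>c\<close>.\<close>
  have raise: "app Z v \<in> span {f \<in> F. b f \<in> (\<lambda>x. x + c) ` b ` S}" if cZ: "cm \<beta> Z = c *\<^sub>R Z"
    and v: "v \<in> span S" and S: "S \<subseteq> F" for Z c v S
    using v
  proof (rule span_induct)
    show "subspace {v. app Z v \<in> span {f \<in> F. b f \<in> (\<lambda>x. x + c) ` b ` S}}"
      using linear_subspace_vimage[OF linear_app subspace_span] by (simp add: vimage_def)
    fix f assume f: "f \<in> S"
    have "app \<beta> (app Z f) = (b f + c) *\<^sub>R app Z f"
      using arg_cong[OF cZ, of "\<lambda>z. app z f"] f S
      by (simp add: cm_def ev subset_iff algebra_simps)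
    then have "app Z f \<in> span {f' \<in> F. b f' = b f + c}" by (rule eigenspace_span[OF F ev])
    then show "app Z f \<in> span {f \<in> F. b f \<in> (\<lambda>x. x + c) ` b ` S}"
      by (rule subsetD[OF span_mono, rotated]) (use f in auto)
  qed
  have comm: "tr (Z * R) = tr (Z * \<beta>)" if "cm \<beta> Z = 0" for Z
  proof -
    have cZ: "cm \<beta> Z = 0 *\<^sub>R Z" using that by simp
    have "app Z v \<in> ?gt r" if "v \<in> ?gt r" for r v
      by (rule subsetD[OF span_mono raise[OF cZ that]]) auto
    from tr0[OF this] show ?thesis by (simp add: right_diff_distrib)
  qed
  have "tr (R * (R - \<beta>)) = 0"
  proof (rule tr0)
    fix r v assume "v \<in> ?gt r"
    then have "v \<in> span (e ` {f \<in> F. b f > r})" by (simp add: gt)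
    then have "app R v \<in> span (e ` {f \<in> F. b f > r})"
    proof (rule span_induct)
      show "subspace {v. app R v \<in> span (e ` {f \<in> F. b f > r})}"
        using linear_subspace_vimage[OF linear_app subspace_span] by (simp add: vimage_def)
      show "app R x \<in> span (e ` {f \<in> F. b f > r})" if "x \<in> e ` {f \<in> F. b f > r}" for x
        using that by (auto simp: Re intro!: span_scale[OF span_base])
    qed
    then show "app R v \<in> ?gt r" by (simp add: gt)
  qed
  moreover have "tr (\<beta> * R) = tr (\<beta> * \<beta>)" by (rule comm) (simp add: cm_linear)
  ultimately have "tr (R * R) = tr (\<beta> * \<beta>)"
    by (simp add: right_diff_distrib tr_commute[of R \<beta>])
  moreover have "c * (norm Z)\<^sup>2 \<le> inner (cm R Z) Z" if cZ: "cm \<beta> Z = c *\<^sub>R Z" for Z c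
  proof -
    have "c * (app Z (e f) \<bullet> app Z (e f)) \<le> app (cm R Z) (e f) \<bullet> app Z (e f)" if f: "f \<in> F" for f
    proof -
      define y where "y = app Z (e f)"
      \<comment> \<open>Z raises the flag by \<open>c\<close>, so \<open>y\<close> only involves
        eigenvalues at least \<open>b f + c\<close> of R, and the quadratic form of R at
        \<open>y\<close> is bounded below accordingly.\<close>
      have "y \<in> span {f' \<in> F. b f' \<in> (\<lambda>x. x + c) ` b ` {f' \<in> F. b f' \<ge> b f}}"
        unfolding y_def by (rule raise[OF cZ e_ge[OF f]]) auto
      then have "y \<in> ?ge (b f + c)" by (rule subsetD[OF span_mono, rotated]) auto
      then have y: "y \<in> span (e ` {f' \<in> F. b f' \<ge> b f + c})" by (simp add: ge)
      have "app R y \<bullet> y = (\<Sum>f'\<in>F. b f' * (y \<bullet> e f')\<^sup>2)"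
        by (simp add: R inner_sum_left inner_sum_right power2_eq_square inner_commute mult_ac)
      then have "app R y \<bullet> y - (b f + c) * (y \<bullet> y) = (\<Sum>f'\<in>F. (b f' - (b f + c)) * (y \<bullet> e f')\<^sup>2)"
        by (simp add: norm_orthonormal[OF F(1) e sp] sum_distrib_left sum_subtractf[symmetric] left_diff_distrib)
      also have "\<dots> \<ge> 0"
      proof (rule sum_nonneg)
        fix f' assume f': "f' \<in> F"
        show "0 \<le> (b f' - (b f + c)) * (y \<bullet> e f')\<^sup>2"
        proof (cases "b f' \<ge> b f + c")
          case False
          then have "y \<bullet> e f' = 0" using perp[OF f' _ _ y] by auto
          then show ?thesis by simp
        qed simp
      qed
      finally show ?thesis using f by (simp add: cm_def y_def[symmetric] Re inner_diff_left algebra_simps)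
    qed
    then have "c * inner Z Z \<le> inner (cm R Z) Z"
      unfolding inner_orthonormal[OF F(1) e sp] sum_distrib_left by (rule sum_mono)
    then show ?thesis by (simp add: power2_norm_eq_inner)
  qed
  ultimately show thesis using that[OF tpR] comm by blast
qed

text \<open>The conjugate \<open>h * S * k\<close> is in general not symmetric, but it still has a
  real eigenbasis, the image under \<open>h\<close> of one for \<open>S\<close>. The operator
  \<open>R\<close> built from it has the norm of \<open>S\<close> because tr R^2 = tr S^2.\<close>

lemma flag_operator_conj:
  assumes S: "tp S = S" and hk: "h * k = 1" "k * h = (1 :: 'a::euclidean_space endo)"
  obtains R where "tp R = R" "norm R = norm S"
    "\<And>Z. cm S Z = 0 \<Longrightarrow> tr (h * Z * k * R) = tr (Z * S)"
    "\<And>Z c. cm S Z = c *\<^sub>R Z \<Longrightarrow> c * (norm (h * Z * k))\<^sup>2 \<le> inner (cm R (h * Z * k)) (h * Z * k)"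
proof -
  obtain B where B: "finite B" "pairwise orthogonal B" "\<forall>b\<in>B. norm b = 1" "span B = UNIV"
    "\<forall>b\<in>B. \<exists>c. app S b = c *\<^sub>R b"
    using spectral_basis[OF S subspace_UNIV] by auto
  have "0 \<notin> B" using B(3) by auto
  then have ind: "independent B" using B(2) pairwise_orthogonal_independent by blast
  have kh: "app k (app h x) = x" "app h (app k x) = x" for x
    using arg_cong[OF hk(2), of "\<lambda>z. app z x"] arg_cong[OF hk(1), of "\<lambda>z. app z x"] by simp_all
  have inj: "inj (app h)" by (metis injI kh(1))
  let ?F = "app h ` B"
  have F: "finite ?F" "independent ?F" "span ?F = UNIV"
  proof -
    show "finite ?F" using B by simp
    show "independent ?F" using linear_independent_injective_image[OF linear_app ind] inj
      by (simp add: inj_on_subset)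
    show "span ?F = UNIV" unfolding linear_span_image[OF linear_app] B(4) by (metis kh(2) surjI)
  qed
  have "\<forall>f\<in>?F. \<exists>c. app (h * S * k) f = c *\<^sub>R f" using B(5) by (auto simp: kh)
  then obtain b where "\<forall>f\<in>?F. app (h * S * k) f = b f *\<^sub>R f" by metis
  from flag_operator[OF F this] obtain R where R: "tp R = R" "tr (R * R) = tr (h * S * k * (h * S * k))"
    "\<And>Z. cm (h * S * k) Z = 0 \<Longrightarrow> tr (Z * R) = tr (Z * (h * S * k))"
    "\<And>Z c. cm (h * S * k) Z = c *\<^sub>R Z \<Longrightarrow> c * (norm Z)\<^sup>2 \<le> inner (cm R Z) Z"
    by blast
  have mm: "h * x * k * (h * y * k) = h * (x * y) * k" for x y
    by (metis hk(2) mult.assoc mult_1)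
  have trc: "tr (h * x * k) = tr x" for x by (metis hk(2) mult.assoc mult_1 tr_commute)
  have cmc: "cm (h * x * k) (h * y * k) = h * cm x y * k" for x y
    by (simp only: cm_def mm) (simp add: algebra_simps)
  show thesis
  proof
    show "tp R = R" by fact
    have "(norm R)\<^sup>2 = (norm S)\<^sup>2"
      using R(1,2) S by (simp add: power2_norm_eq_inner inner_endo_def mm trc)
    then show "norm R = norm S" by (simp add: power2_eq_iff_nonneg)
    show "tr (h * Z * k * R) = tr (Z * S)" if "cm S Z = 0" for Z
      using R(3)[of "h * Z * k"] that by (simp add: cmc mm trc)
    show "c * (norm (h * Z * k))\<^sup>2 \<le> inner (cm R (h * Z * k)) (h * Z * k)" if "cm S Z = c *\<^sub>R Z" for Z c
      using R(4)[of "h * Z * k" c] that by (simp add: cmc)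
  qed
qed

section \<open>Maxima on conjugacy orbits\<close>

text \<open>S = sy A commutes with A by normality. Tested against the R belonging to S, sy Z gives
  tr (Z R) = tr (A S) = |S|^2, while |R| = |S|. The summand L is reserved for the nilpotent part in
  (iv).\<close>

lemma normal_tau_le:
  assumes n: "mom A = 0" and L: "cm (sy A) L = 0" "tr (L * sy A) = 0" and hk: "h * k = 1" "k * h = 1"
  shows "tau A \<le> tau (h * (A + L) * k)"
proof -
  let ?Z = "h * (A + L) * k"
  have "cm (sy A) A = 0"
    using n cm_swap[of "tp A" A] by (simp add: sy_def cm_linear mom_def)
  then have c: "cm (sy A) (A + L) = 0" by (simp add: cm_linear L)
  obtain R where R: "tp R = R" "norm R = norm (sy A)"
    "\<And>Z. cm (sy A) Z = 0 \<Longrightarrow> tr (h * Z * k * R) = tr (Z * sy A)"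
    using flag_operator_conj[OF tp_sy hk] by metis
  have "inner (sy ?Z) R = inner ?Z R" by (rule inner_sy[OF R(1)])
  also have "\<dots> = tr (?Z * R)" by (simp add: inner_endo_def R(1))
  also have "\<dots> = tr (A * sy A)" using R(3)[OF c] L(2) by (simp add: distrib_right)
  also have "\<dots> = inner A (sy A)" by (simp add: inner_endo_def)
  also have "\<dots> = norm (sy A) * norm (sy A)"
    using inner_sy[of "sy A" A] by (simp add: power2_norm_eq_inner[symmetric] power2_eq_square)
  finally have "norm (sy A) * norm (sy A) \<le> norm (sy ?Z) * norm (sy A)"
    using norm_cauchy_schwarz[of "sy ?Z" R] R(2) by simp
  then have "norm (sy A) \<le> norm (sy ?Z)" by (cases "sy A = 0") auto
  then show ?thesis by (simp add: tau_def)
qed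

text \<open>With R belonging to M and Z the conjugate of A, r |Z|^2 \<le> \<langle>[R, Z],
  Z\<rangle> = \<langle>R, mom Z\<rangle>, and |R| = |M|.\<close>

lemma nilsoliton_mom_le:
  assumes s: "cm (mom A) A = r *\<^sub>R A" and hk: "h * k = 1" "k * h = 1"
  shows "r * (norm (h * A * k))\<^sup>2 \<le> norm (mom (h * A * k)) * norm (mom A)"
proof -
  let ?Z = "h * A * k"
  obtain R where R: "tp R = R" "norm R = norm (mom A)"
    "\<And>Z c. cm (mom A) Z = c *\<^sub>R Z \<Longrightarrow> c * (norm (h * Z * k))\<^sup>2 \<le> inner (cm R (h * Z * k)) (h * Z * k)"
    using flag_operator_conj[OF tp_mom hk, of A] by metis
  have "r * (norm ?Z)\<^sup>2 \<le> inner (cm R ?Z) ?Z" by (rule R(3)[OF s])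
  also have "\<dots> = inner R (mom ?Z)" by (simp add: inner_cm_left mom_def)
  also have "\<dots> \<le> norm R * norm (mom ?Z)" by (rule norm_cauchy_schwarz)
  finally show ?thesis by (simp add: R(2) mult.commute)
qed

text \<open>The term |M|^2 / 4 is dropped from the denominator; normal matrices attain the
  bound.\<close>

lemma pinch_le:
  assumes "sy A \<noteq> 0" shows "pinch A \<le> 1 + (tr A)\<^sup>2 / tau A"
proof -
  have t: "tau A > 0" using assms by (simp add: tau_pos_iff)
  let ?b = "tau A + (tr A)\<^sup>2"
  have b: "?b > 0" using t by (simp add: add_pos_nonneg)
  have "pinch A \<le> ?b\<^sup>2 / (tau A * ?b)"
    unfolding pinch_def using t b by (intro divide_left_mono) (auto intro!: add_pos_nonneg mult_pos_pos)
  also have "\<dots> = 1 + (tr A)\<^sup>2 / tau A" using t b by (simp add: power2_eq_square[of ?b] add_divide_distrib)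
  finally show ?thesis .
qed

lemma pinch_normal:
  assumes "sy A \<noteq> 0" "mom A = 0" shows "pinch A = 1 + (tr A)\<^sup>2 / tau A"
proof -
  have t: "tau A > 0" using assms by (simp add: tau_pos_iff)
  let ?b = "tau A + (tr A)\<^sup>2"
  have "?b > 0" using t by (simp add: add_pos_nonneg)
  then show ?thesis using t
    by (simp add: pinch_def assms power2_eq_square[of ?b] add_divide_distrib)
qed

lemma tr_conj: "k * h = 1 \<Longrightarrow> tr (h * A * k) = tr A"
  by (metis mult.assoc mult_1 tr_commute)

lemma pinch_conj_le_normal:
  assumes n: "mom A = 0" "sy A \<noteq> 0" and hk: "h * k = 1" "k * h = 1"
    and L: "cm (sy A) L = 0" "tr (L * sy A) = 0" "tr L = 0"
  shows "sy (h * (A + L) * k) \<noteq> 0" "pinch (h * (A + L) * k) \<le> pinch A"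
proof -
  let ?Z = "h * (A + L) * k"
  have t: "tau A \<le> tau ?Z" by (rule normal_tau_le[OF n(1) L(1,2) hk])
  moreover have t0: "tau A > 0" using n by (simp add: tau_pos_iff)
  ultimately show s: "sy ?Z \<noteq> 0" using tau_pos_iff[of ?Z] by simp
  have "pinch ?Z \<le> 1 + (tr ?Z)\<^sup>2 / tau ?Z" by (rule pinch_le[OF s])
  also have "tr ?Z = tr A" using hk L(3) by (simp add: tr_conj)
  also have "(tr A)\<^sup>2 / tau ?Z \<le> (tr A)\<^sup>2 / tau A"
    using t t0 by (intro divide_left_mono) auto
  finally show "pinch ?Z \<le> pinch A" by (simp add: pinch_normal n)
qed

text \<open>tr A = tr A^2 = 0 persists under conjugation, so F is a decreasing function of |M| /
  |A|^2. Since r = |M|^2 / |A|^2, the estimate on \<open>mom\<close> compares exactly these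
  ratios.\<close>

lemma pinch_conj_le_nilsoliton:
  assumes s: "cm (mom A) A = r *\<^sub>R A" "r > 0" "A \<noteq> 0" and hk: "h * k = 1" "k * h = 1"
  shows "pinch (h * A * k) \<le> pinch A"
proof -
  let ?Z = "h * A * k"
  have tau: "tau B = (norm B)\<^sup>2 / 2" if "tr (B * B) = 0" for B :: "'a endo"
    using that by (simp add: tau_alt)
  have "A = k * ?Z * h" using hk by (metis mult.assoc mult_1 mult_1_right)
  then have Z: "?Z \<noteq> 0" using s(3) by auto
  have r0: "r \<noteq> 0" using s(2) by simp
  have AA: "tr (A * A) = 0" "tr A = 0" using tr_eigen_square[OF s(1) r0] tr_eigen[OF s(1) r0] by auto
  have "?Z * ?Z = h * (A * A) * k" by (metis hk(2) mult.assoc mult_1)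
  then have ZZ: "tr (?Z * ?Z) = 0" "tr ?Z = 0" using hk AA by (simp_all add: tr_conj)
  have p: "pinch B = 1 / (1 + (norm (mom B))\<^sup>2 / ((norm B)\<^sup>2)\<^sup>2)" if "tr (B * B) = 0" "tr B = 0" "B \<noteq> 0"
    for B :: "'a endo"
    by (rule pinch_traceless[OF that(2) tau[OF that(1)]]) (use that in simp)
  have n: "(norm (mom A))\<^sup>2 = r * (norm A)\<^sup>2"
    using inner_cm_self_mom[of A] by (simp add: s power2_norm_eq_inner)
  then have m: "mom A \<noteq> 0" using s by auto
  have "(norm (mom A))\<^sup>2 * (norm ?Z)\<^sup>2 = (norm A)\<^sup>2 * (r * (norm ?Z)\<^sup>2)" by (simp add: n)
  also have "\<dots> \<le> (norm A)\<^sup>2 * (norm (mom ?Z) * norm (mom A))"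
    by (intro mult_left_mono nilsoliton_mom_le[OF s(1) hk]) simp
  finally have "norm (mom A) * (norm (mom A) * (norm ?Z)\<^sup>2) \<le> norm (mom A) * ((norm A)\<^sup>2 * norm (mom ?Z))"
    by (simp only: power2_eq_square[of "norm (mom A)"] mult_ac)
  then have "norm (mom A) * (norm ?Z)\<^sup>2 \<le> (norm A)\<^sup>2 * norm (mom ?Z)"
    by (rule mult_left_le_imp_le) (use m in simp)
  then have "norm (mom A) / (norm A)\<^sup>2 \<le> norm (mom ?Z) / (norm ?Z)\<^sup>2"
    using Z s(3) by (simp add: field_simps)
  then have "(norm (mom A) / (norm A)\<^sup>2)\<^sup>2 \<le> (norm (mom ?Z) / (norm ?Z)\<^sup>2)\<^sup>2" by (intro power_mono) auto
  then show ?thesis unfolding p[OF ZZ Z] p[OF AA s(3)]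
    by (intro divide_left_mono) (auto simp: power_divide intro!: mult_pos_pos add_pos_nonneg)
qed

section \<open>Orthonormal frames adapted to the abelian ideal\<close>

definition e0 :: "'a::euclidean_space" where
  "e0 = (SOME b. b \<in> Basis)"

lemma e0_Basis: "e0 \<in> Basis"
  unfolding e0_def by (rule SOME_Basis)

lemma e0_inner [simp]: "e0 \<bullet> e0 = 1"
  using e0_Basis by (rule inner_same_Basis)

lemma hyperplane_frame:
  fixes N :: "'a::euclidean_space set"
  assumes g: "inner_product g" and N: "subspace N" "dim N + 1 = DIM('a)"
  obtains P Q where "P * Q = 1" "Q * P = 1" "\<And>x y. g x y = app P x \<bullet> app P y"
    "\<And>x. x \<in> N \<longleftrightarrow> app P x \<bullet> e0 = 0"
proof -
  have bl: "bilinear g" and pos: "\<And>x. x \<noteq> 0 \<Longrightarrow> g x x > 0"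
    using g by (auto simp: inner_product_def)
  obtain M where M: "M \<subseteq> N" "independent M" "N \<subseteq> span M" "card M = dim N"
    using basis_exists[of N] by metis
  have spM: "span M = N" using M(1,3) N(1) by (metis span_minimal antisym)
  have finM: "finite M" using M(2) by (rule independent_imp_finite)
  have "N \<noteq> UNIV" using N(2) dim_UNIV by (metis add_cancel_right_right one_neq_zero)
  then obtain X where X: "X \<notin> N" by blast
  then have XM: "X \<notin> M" using M(1) by blast
  let ?B = "insert X M"
  have ind: "independent ?B" using M(2) X spM by (simp add: independent_insertI)
  have "card ?B = DIM('a)" using finM XM M(4) N(2) by simp
  then have spB: "span ?B = UNIV"
    using card_eq_dim[of ?B UNIV] ind finM by (auto simp: dim_UNIV)
  \<comment> \<open>Weight 1 on N and 0 elsewhere lets Gram-Schmidt treat the basis of N before X,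
    so that its span survives.\<close>
  define w :: "'a \<Rightarrow> real" where "w x = (if x \<in> N then 1 else 0)" for x
  have "finite ?B" using finM by simp
  from gram_schmidt_flag[OF g this ind, of w] obtain e where
    e: "\<forall>x\<in>?B. \<forall>y\<in>?B. g (e x) (e y) = (if x = y then 1 else 0)"
    and fl: "\<forall>U\<subseteq>?B. (\<forall>x\<in>U. \<forall>y\<in>?B. w x \<le> w y \<longrightarrow> y \<in> U) \<longrightarrow> span (e ` U) = span U"
    by (elim exE conjE)
  have eM: "span (e ` M) = N"
  proof -
    have "\<forall>x\<in>M. \<forall>y\<in>?B. w x \<le> w y \<longrightarrow> y \<in> M" using X M(1) by (auto simp: w_def)
    then have "span (e ` M) = span M" using fl by blast
    then show ?thesis by (simp add: spM)
  qed
  have "span (e ` ?B) = UNIV" using fl spB by blast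
  then have eX: "e X \<notin> N"
    using eM \<open>N \<noteq> UNIV\<close> N(1) by (metis image_insert span_redundant)
  have "card (Basis - {e0::'a}) = card M"
    unfolding M(4) card_Diff_singleton[OF e0_Basis] using N(2) by simp
  then obtain \<tau> where \<tau>: "bij_betw \<tau> (Basis - {e0::'a}) M"
    using finM by (metis finite_Basis finite_Diff finite_same_card_bij)
  define \<sigma> where "\<sigma> = \<tau>(e0 := X)"
  have \<sigma>M: "\<sigma> i \<in> M" if "i \<in> Basis" "i \<noteq> e0" for i
    using that \<tau> by (auto simp: \<sigma>_def bij_betw_def)
  have \<sigma>e: "\<sigma> e0 = X" by (simp add: \<sigma>_def)
  have \<sigma>B: "\<sigma> i \<in> ?B" if "i \<in> Basis" for i using \<sigma>M[OF that] \<sigma>e by auto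
  have \<sigma>inj: "\<sigma> i = \<sigma> j \<longleftrightarrow> i = j" if ij: "i \<in> Basis" "j \<in> Basis" for i j
  proof (cases "i = e0 \<or> j = e0")
    case True then show ?thesis using \<sigma>M \<sigma>e XM ij by metis
  next
    case False then show ?thesis using ij \<tau> by (auto simp: \<sigma>_def bij_betw_def inj_on_def)
  qed
  define Q where "Q = (\<Sum>i\<in>Basis. outer (e (\<sigma> i)) i)"
  have Q: "app Q x = (\<Sum>i\<in>Basis. (x \<bullet> i) *\<^sub>R e (\<sigma> i))" for x
    by (simp add: Q_def app_sum_left)
  have gl: "linear (\<lambda>x. g x y)" and gr: "linear (\<lambda>y. g x y)" for x y using bl by (auto simp: bilinear_def)
  have gQ: "g (app Q x) (app Q y) = x \<bullet> y" for x y
  proof -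
    have "g (app Q x) (app Q y) = (\<Sum>i\<in>Basis. \<Sum>j\<in>Basis. (x \<bullet> i) * ((y \<bullet> j) * g (e (\<sigma> i)) (e (\<sigma> j))))"
      unfolding Q by (simp add: linear_sum[OF gl] linear_sum[OF gr] linear_scale[OF gl] linear_scale[OF gr] sum_distrib_left)
        (subst sum.swap, simp add: mult_ac)
    also have "\<dots> = (\<Sum>i\<in>Basis. \<Sum>j\<in>Basis. if j = i then (x \<bullet> i) * (y \<bullet> i) else 0)"
    proof (intro sum.cong refl)
      fix i j :: 'a assume ij: "i \<in> Basis" "j \<in> Basis"
      have "g (e (\<sigma> i)) (e (\<sigma> j)) = (if \<sigma> i = \<sigma> j then 1 else 0)"
        by (rule bspec[OF bspec[OF e \<sigma>B[OF ij(1)]] \<sigma>B[OF ij(2)]])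
      then show "(x \<bullet> i) * ((y \<bullet> j) * g (e (\<sigma> i)) (e (\<sigma> j))) = (if j = i then (x \<bullet> i) * (y \<bullet> i) else 0)"
        by (simp add: \<sigma>inj[OF ij])
    qed
    also have "\<dots> = x \<bullet> y" by (simp add: euclidean_inner[of x y])
    finally show ?thesis .
  qed
  have "inj (app Q)"
  proof (rule injI)
    fix x y assume "app Q x = app Q y"
    then have "app Q (x - y) = 0" by simp
    then have "(x - y) \<bullet> (x - y) = g 0 0" using gQ[of "x - y" "x - y"] by simp
    also have "\<dots> = 0" using linear_0[OF gl] by simp
    finally show "x = y" by simp
  qed
  then obtain f where f: "linear f" "\<forall>x. f (app Q x) = x" "\<forall>x. app Q (f x) = x"
    using linear_injective_isomorphism[OF linear_app, of Q] by metis
  define P where "P = Endo f"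
  have P: "app P = f" unfolding P_def by (rule app_Endo[OF f(1)])
  have PQ: "P * Q = 1" "Q * P = 1" by (rule endo_eqI; simp add: P f)+
  have NQ: "app Q x \<in> N \<longleftrightarrow> x \<bullet> e0 = 0" for x
  proof -
    have "(\<Sum>i\<in>Basis - {e0}. (x \<bullet> i) *\<^sub>R e (\<sigma> i)) \<in> span (e ` M)"
      by (intro span_sum span_scale span_base imageI \<sigma>M) auto
    moreover define s where "s = (\<Sum>i\<in>Basis - {e0}. (x \<bullet> i) *\<^sub>R e (\<sigma> i))"
    ultimately have s: "s \<in> N" by (simp add: eM)
    have x: "app Q x = (x \<bullet> e0) *\<^sub>R e X + s"
      unfolding Q s_def by (subst sum.remove[OF finite_Basis e0_Basis]) (simp add: \<sigma>e)
    show ?thesis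
    proof
      assume "app Q x \<in> N"
      then have "app Q x - s \<in> N" using s N(1) by (simp add: subspace_diff)
      then have m: "(x \<bullet> e0) *\<^sub>R e X \<in> N" by (simp add: x)
      show "x \<bullet> e0 = 0"
      proof (rule ccontr)
        assume "x \<bullet> e0 \<noteq> 0"
        then have "e X = (1 / (x \<bullet> e0)) *\<^sub>R ((x \<bullet> e0) *\<^sub>R e X)" by simp
        then show False using subspace_scale[OF N(1) m] eX by metis
      qed
    qed (simp add: x s)
  qed
  show thesis
  proof (rule that[OF PQ])
    show "g x y = app P x \<bullet> app P y" for x y using gQ[of "f x" "f y"] f by (simp add: P)
    show "x \<in> N \<longleftrightarrow> app P x \<bullet> e0 = 0" for x using NQ[of "f x"] f by (simp add: P)
  qed
qed

text \<open>
  \<open>P\<close> is an isometry from \<open>g\<close> to the standard inner product which maps \<open>N\<close> to the complement of \<open>e0\<close>, with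
  inverse \<open>Q\<close>. In this frame \<open>A\<close> is \<open>ad \<nu>\<close> for the unit normal \<open>\<nu> = Q e0\<close>, so the matrix on \<open>N\<close> is
  extended by zero to the normal direction.
\<close>

definition frame :: "('a::euclidean_space \<Rightarrow> 'a \<Rightarrow> 'a) \<Rightarrow> 'a set \<Rightarrow> ('a \<Rightarrow> 'a \<Rightarrow> real) \<Rightarrow>
    'a endo \<Rightarrow> 'a endo \<Rightarrow> 'a endo \<Rightarrow> bool" where
  "frame br N g P Q A \<longleftrightarrow> P * Q = 1 \<and> Q * P = 1 \<and> (\<forall>x y. g x y = app P x \<bullet> app P y) \<and>
     (\<forall>x. x \<in> N \<longleftrightarrow> app P x \<bullet> e0 = 0) \<and> adm e0 A \<and>
     (\<forall>x y. app P (br x y) = (app P x \<bullet> e0) *\<^sub>R app A (app P y) - (app P y \<bullet> e0) *\<^sub>R app A (app P x))"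

definition ad :: "('a::euclidean_space \<Rightarrow> 'a \<Rightarrow> 'a) \<Rightarrow> 'a \<Rightarrow> 'a endo" where
  "ad br x = Endo (br x)"

lemma app_inverse:
  assumes "P * Q = 1" "Q * P = (1 :: 'a::euclidean_space endo)"
  shows "app P (app Q x) = x" "app Q (app P x) = x"
  using arg_cong[OF assms(1), of "\<lambda>z. app z x"] arg_cong[OF assms(2), of "\<lambda>z. app z x"] by simp_all

lemma frame_of_hyperplane_frame:
  assumes lie: "lie_algebra br" and ideal: "codim1_abelian_ideal br N"
    and PQ: "P * Q = 1" "Q * P = 1" and g: "\<And>x y. g x y = app P x \<bullet> app P y"
    and N: "\<And>x. x \<in> N \<longleftrightarrow> app P x \<bullet> e0 = 0"
  shows "frame br N g P Q (P * ad br (app Q e0) * Q)" "app Q e0 \<notin> N"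
proof -
  note inv = app_inverse[OF PQ]
  let ?\<nu> = "app Q e0"
  show \<nu>: "?\<nu> \<notin> N" by (simp add: N inv)
  have h: "height N ?\<nu> x = app P x \<bullet> e0" for x
    by (rule height_eqI[OF lie ideal \<nu>]) (simp add: N inv inner_simps)
  have ad: "app (ad br ?\<nu>) x = br ?\<nu> x" for x
    unfolding ad_def by (simp add: app_Endo br_linear[OF lie ideal \<nu>])
  let ?A = "P * ad br ?\<nu> * Q"
  have "app P (br x y) = (app P x \<bullet> e0) *\<^sub>R app ?A (app P y) - (app P y \<bullet> e0) *\<^sub>R app ?A (app P x)" for x y
    using br_eq[OF lie ideal \<nu>, of x y]
    by (simp add: h ad[symmetric] inv del: ad)
  moreover have "app ?A e0 = 0" using lie by (simp add: ad lie_algebra_def)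
  moreover have "app (tp ?A) e0 = 0"
  proof -
    have "y \<bullet> app (tp ?A) e0 = 0" for y
    proof -
      have "y \<bullet> app (tp ?A) e0 = app ?A y \<bullet> e0" by (rule app_tp')
      also have "app ?A y = app P (br ?\<nu> (app Q y))" by (simp add: ad)
      also have "\<dots> \<bullet> e0 = 0" using height_br[OF lie ideal \<nu>] h by metis
      finally show ?thesis .
    qed
    then show ?thesis by (metis inner_eq_zero_iff)
  qed
  ultimately show "frame br N g P Q ?A"
    using PQ g N by (auto simp: frame_def adm_def)
qed

lemma frame_exists:
  assumes "lie_algebra br" "codim1_abelian_ideal br N" "inner_product g"
  obtains P Q A where "frame br N g P Q A"
proof -
  have N: "subspace N" "dim N + 1 = DIM('a)"
    using assms(2) by (auto simp: codim1_abelian_ideal_def)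
  obtain P Q where "P * Q = 1" "Q * P = 1" "\<And>x y. g x y = app P x \<bullet> app P y"
    "\<And>x. x \<in> N \<longleftrightarrow> app P x \<bullet> e0 = 0"
    using hyperplane_frame[OF assms(3) N] by blast
  from frame_of_hyperplane_frame(1)[OF assms(1,2) this] show thesis by (rule that)
qed

section \<open>Curvature in a frame\<close>

definition sk :: "'a::euclidean_space endo \<Rightarrow> 'a endo" where
  "sk a = (1/2) *\<^sub>R (a - tp a)"

lemma sy_plus_sk: "sy a + sk a = a"
  by (simp add: sy_def sk_def scaleR_add_right[symmetric] scaleR_2[symmetric])

lemma tp_sk: "tp (sk a) = - sk a"
  by (simp add: sk_def algebra_simps)

definition ric :: "'a::euclidean_space endo \<Rightarrow> 'a endo" where
  "ric A = (1/2) *\<^sub>R mom A - tr A *\<^sub>R sy A - tau A *\<^sub>R outer e0 e0"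

text \<open>The quadratic terms left over by the trace of the curvature collapse to half the moment
  map.\<close>

lemma ric_alt: "sy A * sy A + sk A * sy A - sy A * A = (1/2) *\<^sub>R mom A"
proof -
  have "sy A * A = sy A * sy A + sy A * sk A"
    by (metis distrib_left sy_plus_sk)
  then have "sy A * sy A + sk A * sy A - sy A * A = sk A * sy A - sy A * sk A" by simp
  also have "\<dots> = (1/4) *\<^sub>R (2 *\<^sub>R mom A)"
    unfolding scaleR_2 by (simp add: sy_def sk_def mom_def cm_def algebra_simps scaleR_add_left[symmetric])
  finally show ?thesis by simp
qed

context
  fixes br :: "'a::euclidean_space \<Rightarrow> 'a \<Rightarrow> 'a" and N g P Q A
  assumes fr: "frame br N g P Q A"
begin

lemma frame_facts:
  "P * Q = 1" "Q * P = 1" "app P (app Q x) = x" "app Q (app P x) = x"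
  "g x y = app P x \<bullet> app P y" "x \<in> N \<longleftrightarrow> app P x \<bullet> e0 = 0" "adm e0 A"
  "app P (br x y) = (app P x \<bullet> e0) *\<^sub>R app A (app P y) - (app P y \<bullet> e0) *\<^sub>R app A (app P x)"
  using fr app_inverse[of P Q] by (auto simp: frame_def)

private abbreviation "S \<equiv> sy A"
private abbreviation "K \<equiv> sk A"

private lemma SK:
  "app S x \<bullet> y = x \<bullet> app S y" "app K x \<bullet> y = - (x \<bullet> app K y)" "app S e0 = 0" "app K e0 = 0"
  "app S x \<bullet> e0 = 0" "app K x \<bullet> e0 = 0" "app A x = app S x + app K x" "e0 \<bullet> app S x = 0" "e0 \<bullet> app K x = 0"
proof -
  show 1: "app S x \<bullet> y = x \<bullet> app S y" "app K x \<bullet> y = - (x \<bullet> app K y)" for x y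
    using app_tp[of S x y] app_tp[of K x y] by (simp_all add: tp_sk)
  show 2: "app S e0 = 0" "app K e0 = 0" using frame_facts(7) by (simp_all add: adm_def sy_def sk_def)
  show 3: "app S x \<bullet> e0 = 0" "app K x \<bullet> e0 = 0" by (simp_all add: 1 2)
  show "e0 \<bullet> app S x = 0" "e0 \<bullet> app K x = 0" using 3 by (simp_all add: inner_commute)
  show "app A x = app S x + app K x" by (metis app_simps(3) sy_plus_sk)
qed

text \<open>The Levi-Civita connection in the frame: along the normal it rotates by the skew part K,
  and along the ideal the symmetric part S acts as the shape operator.\<close>

private definition LC :: "'a \<Rightarrow> 'a \<Rightarrow> 'a" where
  "LC x y = (x \<bullet> e0) *\<^sub>R app K y - (y \<bullet> e0) *\<^sub>R app S x + (app S x \<bullet> y) *\<^sub>R e0"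

private lemma levi_civita_frame: "levi_civita br g x y = app Q (LC (app P x) (app P y))"
proof -
  let ?w = "app Q (LC (app P x) (app P y))"
  have w: "2 * g ?w z = g (br x y) z - g (br y z) x + g (br z x) y" for z
  proof -
    have s: "v \<bullet> app S u = u \<bullet> app S v" "v \<bullet> app K u = - (u \<bullet> app K v)" for u v
      using SK(1,2)[of u v] by (simp_all add: inner_commute)
    show ?thesis
      unfolding frame_facts(5,8) frame_facts(3)
      by (simp add: LC_def SK(7) inner_simps SK(1,2) inner_commute[of e0] s[of "app P y" "app P x"]
          s[of "app P z" "app P x"] s[of "app P z" "app P y"]) (simp add: algebra_simps)
  qed
  show ?thesis
    unfolding levi_civita_def
  proof (rule the_equality)
    show "\<forall>z. 2 * g ?w z = g (br x y) z - g (br y z) x + g (br z x) y" using w by blast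
    fix v assume v: "\<forall>z. 2 * g v z = g (br x y) z - g (br y z) x + g (br z x) y"
    have "g v z = g ?w z" for z using v[rule_format, of z] w[of z] by linarith
    then have "(app P v - app P ?w) \<bullet> app P z = 0" for z by (simp add: frame_facts(5) inner_diff_left)
    from this[of "v - ?w"] have "app P v = app P ?w" by simp
    then show "v = ?w" by (metis frame_facts(4))
  qed
qed

text \<open>The curvature R(x, y) z as an endomorphism in x, written with \<open>outer\<close> so
  that its trace can be read off termwise.\<close>

private definition CV :: "'a \<Rightarrow> 'a \<Rightarrow> 'a endo" where
  "CV y z = - (z \<bullet> e0) *\<^sub>R outer (app K (app S y)) e0 + ((y \<bullet> e0) * (z \<bullet> e0)) *\<^sub>R (K * S)
     - (app S y \<bullet> z) *\<^sub>R S + outer (app S y) (app S z) + (y \<bullet> e0) *\<^sub>R outer e0 (app S (app K z))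
     - (app S y \<bullet> app K z) *\<^sub>R outer e0 e0 + (z \<bullet> e0) *\<^sub>R outer (app S (app A y)) e0
     - ((z \<bullet> e0) * (y \<bullet> e0)) *\<^sub>R (S * A) - (app S (app A y) \<bullet> z) *\<^sub>R outer e0 e0
     + (y \<bullet> e0) *\<^sub>R outer e0 (app (tp A) (app S z))"

private lemma curvature_frame:
  "curvature br g x y z = app (Q * CV (app P y) (app P z) * P) x"
proof -
  have main: "LC x (LC y z) - LC y (LC x z) - LC ((x \<bullet> e0) *\<^sub>R app A y - (y \<bullet> e0) *\<^sub>R app A x) z
      = app (CV y z) x" for x y z
  proof -
    have "y \<bullet> app S (app S x) = x \<bullet> app S (app S y)" using SK(1) by (metis inner_commute)
    then show ?thesis
      unfolding LC_def CV_def
      by (simp add: inner_simps SK(3,4,5,6) app_tp') (simp add: SK algebra_simps inner_simps)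
  qed
  show ?thesis
    unfolding curvature_def levi_civita_frame frame_facts(3,8) by (simp add: main[symmetric])
qed

private lemma tr_CV: "tr (CV y z) = app (ric A) y \<bullet> z"
proof -
  have KS: "tr (K * S) = 0"
  proof -
    have "tr (K * S) = tr (tp (K * S))" by (simp only: tr_simps)
    also have "\<dots> = - tr (S * K)" by (simp add: tp_sk)
    finally show ?thesis by (simp add: tr_commute)
  qed
  have SA: "tr (S * A) = tau A"
  proof -
    have "tr (S * A) = inner A S" by (simp add: inner_endo_def tr_commute)
    then show ?thesis using inner_sy[of S A] by (simp add: tau_def power2_norm_eq_inner)
  qed
  have trS: "tr S = tr A" by (simp add: sy_def)
  have "(1/2) * (app (mom A) y \<bullet> z) = app (S * S + K * S - S * A) y \<bullet> z"
    unfolding ric_alt by simp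
  then have m: "app (mom A) y \<bullet> z = 2 * (app S (app S y) \<bullet> z + app K (app S y) \<bullet> z - app S (app A y) \<bullet> z)"
    by (simp add: inner_simps)
  have f: "y \<bullet> app S (app K z) = - (z \<bullet> app K (app S y))" "y \<bullet> app S (app S z) = z \<bullet> app S (app S y)"
    using SK(1,2) by (metis inner_commute)+
  have e: "e0 \<bullet> app (tp A) (app S z) = 0"
    using frame_facts(7) by (simp add: app_tp' adm_def)
  show ?thesis
    unfolding CV_def ric_def
    by (simp add: KS SA trS m e inner_simps) (simp add: SK inner_simps inner_commute algebra_simps,
        simp add: f)
qed

lemma ricci_tensor_frame: "ricci_tensor br g y z = app (ric A) (app P y) \<bullet> app P z"
proof -
  let ?C = "CV (app P y) (app P z)"
  have "ricci_tensor br g y z = tr (Q * ?C * P)"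
    unfolding ricci_tensor_def tr_def curvature_frame ..
  also have "\<dots> = tr ?C" by (rule tr_conj[OF frame_facts(1)])
  finally show ?thesis by (simp add: tr_CV)
qed

lemma ricci_operator_frame: "ricci_operator br g = app (Q * ric A * P)"
proof
  fix y
  let ?w = "app (Q * ric A * P) y"
  have w: "g ?w z = ricci_tensor br g y z" for z
    by (simp add: ricci_tensor_frame frame_facts)
  show "ricci_operator br g y = ?w"
    unfolding ricci_operator_def
  proof (rule the_equality)
    show "\<forall>z. g ?w z = ricci_tensor br g y z" using w by blast
    fix v assume v: "\<forall>z. g v z = ricci_tensor br g y z"
    have "(app P v - app P ?w) \<bullet> app P z = 0" for z using v w[of z] by (simp add: frame_facts(5) inner_diff_left)
    from this[of "v - ?w"] have "app P v = app P ?w" by simp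
    then show "v = ?w" by (metis frame_facts(4))
  qed
qed

text \<open>The normal line is annihilated by M and S, and tr (M S) = 0, so no cross terms survive
  in |Ric|^2.\<close>

lemma ricci_pinching_frame: "ricci_pinching br g = pinch A"
proof -
  have ad: "adm e0 (mom A)" "adm e0 S" using frame_facts(7) by blast+
  have t1: "tr (ric A) = - (tau A + (tr A)\<^sup>2)"
    by (simp add: ric_def sy_def mom_def power2_eq_square)
  have z: "outer e0 e0 * mom A = 0" "mom A * outer e0 e0 = 0" "outer e0 e0 * S = 0" "S * outer e0 e0 = 0"
    using ad by (auto intro!: endo_eqI simp: adm_def inner_commute app_tp'[of _ _ e0, symmetric])
      (metis ad adm_def app_tp' inner_zero_right scaleR_zero_left tp_mom tp_sy inner_commute)+
  have o: "outer e0 e0 * outer e0 e0 = (outer e0 e0 :: 'a endo)" by (rule endo_eqI) simp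
  have ms: "tr (mom A * S) = 0" "tr (S * mom A) = 0"
  proof -
    show "tr (mom A * S) = 0"
      by (simp add: mom_def tr_cm_mult sy_def cm_linear) (simp add: cm_def algebra_simps tr_commute[of _ "A * _"] mult.assoc)
    then show "tr (S * mom A) = 0" by (simp add: tr_commute)
  qed
  have t2: "tr (ric A * ric A) = tau A * (tau A + (tr A)\<^sup>2) + (norm (mom A))\<^sup>2 / 4"
  proof -
    have "tr (mom A * mom A) = (norm (mom A))\<^sup>2" by (simp add: power2_norm_eq_inner inner_endo_def)
    moreover have "tr (S * S) = tau A" by (simp add: tau_def power2_norm_eq_inner inner_endo_def)
    ultimately show ?thesis
      by (simp add: ric_def left_diff_distrib right_diff_distrib z o ms) (simp add: power2_eq_square algebra_simps)
  qed
  have "scalar_curvature br g = tr (Q * ric A * P)"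
    by (simp add: scalar_curvature_def ricci_operator_frame tr_def)
  then have s: "scalar_curvature br g = tr (ric A)" by (simp add: tr_conj[OF frame_facts(1)])
  have "ricci_operator br g \<circ> ricci_operator br g = app (Q * (ric A * ric A) * P)"
    by (simp add: ricci_operator_frame fun_eq_iff frame_facts)
  then have "endo_trace (ricci_operator br g \<circ> ricci_operator br g) = tr (ric A * ric A)"
    using tr_conj[OF frame_facts(1)] by (simp add: tr_def)
  then have e: "endo_trace (ricci_operator br g \<circ> ricci_operator br g)
      = tau A * (tau A + (tr A)\<^sup>2) + (norm (mom A))\<^sup>2 / 4" by (simp only: t2)
  show ?thesis unfolding ricci_pinching_def s t1 e pinch_def power2_minus ..
qed

text \<open>The unit normal has Ricci curvature - tau A, so flatness forces S = 0; conversely every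
  term of \<open>CV\<close> contains a factor S.\<close>

lemma flat_frame: "flat br g \<longleftrightarrow> sy A = 0"
proof
  assume f: "flat br g"
  have "ricci_tensor br g y z = 0" for y z
    using f by (simp add: ricci_tensor_def flat_def endo_trace_def)
  from this[of "app Q e0" "app Q e0"] have "app (ric A) e0 \<bullet> e0 = 0"
    by (simp add: ricci_tensor_frame frame_facts)
  moreover have "app (mom A) e0 = 0"
    using frame_facts(7) by (simp add: adm_def mom_def cm_def)
  ultimately have "tau A = 0" by (simp add: ric_def SK inner_simps)
  then show "sy A = 0" by (simp add: tau_def)
next
  assume "sy A = 0"
  then have "CV y z = 0" for y z
    unfolding CV_def by (simp add: endo_eqI)
  then show "flat br g" by (simp add: flat_def curvature_frame)
qed

lemma frame_inner_product: "inner_product g"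
proof -
  have "bilinear g"
    unfolding bilinear_def frame_facts(5)
    by (intro conjI allI linearI) (simp_all add: inner_simps)
  moreover have "g x x > 0" if "x \<noteq> 0" for x
  proof -
    have "app P x \<noteq> 0" using that frame_facts(4)[of x] by auto
    then show ?thesis by (simp add: frame_facts(5))
  qed
  ultimately show ?thesis
    by (auto simp: inner_product_def frame_facts(5) inner_commute)
qed

lemma frame_nonflat: "g \<in> nonflat_metrics br \<longleftrightarrow> sy A \<noteq> 0"
  by (simp add: nonflat_metrics_def frame_inner_product flat_frame)

end

section \<open>Comparison of frames\<close>

lemma app_ad:
  assumes "lie_algebra br" shows "app (ad br x) = br x"
  using assms unfolding ad_def by (intro app_Endo) (auto simp: lie_algebra_def bilinear_def)

lemma frame_matrix:
  assumes lie: "lie_algebra br" and fr: "frame br N g P Q A"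
  shows "A = P * ad br (app Q e0) * Q"
  by (rule endo_eqI)
    (use frame_facts(7)[OF fr] in \<open>simp add: app_ad[OF lie] frame_facts(3,8)[OF fr] adm_def\<close>)

lemma frame_transform:
  assumes fr: "frame br N g P Q A" and hk: "h * k = 1" "k * h = 1"
    and he: "app h e0 = e0" "app (tp h) e0 = e0"
  shows "frame br N (\<lambda>x y. app (h * P) x \<bullet> app (h * P) y) (h * P) (Q * k) (h * A * k)"
proof -
  note f = frame_facts[OF fr] and inv = app_inverse[OF hk]
  have h: "app h x \<bullet> e0 = x \<bullet> e0" for x using app_tp'[of x h e0] he(2) by simp
  have k: "app k e0 = e0" using inv(2)[of e0] by (simp add: he)
  have "h * P * (Q * k) = h * (P * Q) * k" "Q * k * (h * P) = Q * (k * h) * P"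
    by (simp_all only: mult.assoc)
  then have "h * P * (Q * k) = 1" "Q * k * (h * P) = 1" by (simp_all add: f hk)
  moreover have "app (tp (h * A * k)) e0 = 0"
    using f(7) he by (simp add: adm_def)
  ultimately show ?thesis
    using f(7) k by (simp add: frame_def h f(6,8) inv adm_def)
qed

text \<open>\<open>h\<close> identifies the two images of N through P Q0 and fixes
  \<open>e0\<close>. The vector Q0 e0 need not be normal for the other frame, but its component in N
  acts trivially on the abelian ideal, so the difference is only a factor.\<close>

lemma frame_conj:
  fixes br :: "'a::euclidean_space \<Rightarrow> 'a \<Rightarrow> 'a"
  assumes lie: "lie_algebra br" and fr: "frame br N g P Q A"
    and P0: "P0 * Q0 = 1" "Q0 * P0 = 1" "\<And>x. x \<in> N \<longleftrightarrow> app P0 x \<bullet> e0 = 0"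
  obtains h k c where "h * k = 1" "k * h = 1" "c \<noteq> 0" "A = c *\<^sub>R (h * (P0 * ad br (app Q0 e0) * Q0) * k)"
proof -
  note f = frame_facts[OF fr] and inv = app_inverse[OF P0(1,2)]
  let ?pr = "1 - outer e0 e0 :: 'a endo" and ?\<nu> = "app Q0 e0"
  define h where "h = P * Q0 * ?pr + outer e0 e0"
  define k where "k = P0 * Q * ?pr + outer e0 e0"
  have h: "app h x = app P (app Q0 (x - (x \<bullet> e0) *\<^sub>R e0)) + (x \<bullet> e0) *\<^sub>R e0" for x
    by (simp add: h_def)
  have k: "app k x = app P0 (app Q (x - (x \<bullet> e0) *\<^sub>R e0)) + (x \<bullet> e0) *\<^sub>R e0" for x
    by (simp add: k_def)
  have perp: "(x - (x \<bullet> e0) *\<^sub>R e0) \<bullet> e0 = 0" for x :: 'a by (simp add: inner_simps)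
  have QN: "app P0 (app Q x) \<bullet> e0 = 0" "app P (app Q0 x) \<bullet> e0 = 0" if "x \<bullet> e0 = 0" for x
    using that f(3,6) inv P0(3) by metis+
  have kh: "k * h = 1"
  proof (rule endo_eqI)
    fix x :: 'a
    define y where "y = x - (x \<bullet> e0) *\<^sub>R e0"
    have hx: "app h x = app P (app Q0 y) + (x \<bullet> e0) *\<^sub>R e0" by (simp only: h y_def)
    have "app h x \<bullet> e0 = x \<bullet> e0" using QN(2)[OF perp[of x]] by (simp add: hx y_def[symmetric] inner_add_left)
    then have "app k (app h x) = app P0 (app Q (app P (app Q0 y))) + (x \<bullet> e0) *\<^sub>R e0"
      unfolding k by (simp only: hx add_diff_cancel)
    then show "app (k * h) x = app 1 x" by (simp add: f(4) inv y_def del: app_linear)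
  qed
  have hk: "h * k = 1"
  proof (rule endo_eqI)
    fix x :: 'a
    define y where "y = x - (x \<bullet> e0) *\<^sub>R e0"
    have kx: "app k x = app P0 (app Q y) + (x \<bullet> e0) *\<^sub>R e0" by (simp only: k y_def)
    have "app k x \<bullet> e0 = x \<bullet> e0" using QN(1)[OF perp[of x]] by (simp add: kx y_def[symmetric] inner_add_left)
    then have "app h (app k x) = app P (app Q0 (app P0 (app Q y))) + (x \<bullet> e0) *\<^sub>R e0"
      unfolding h by (simp only: kx add_diff_cancel)
    then show "app (h * k) x = app 1 x" by (simp add: f(3) inv y_def del: app_linear)
  qed
  let ?B = "P0 * ad br ?\<nu> * Q0"
  let ?c = "app P ?\<nu> \<bullet> e0"
  have c: "?c \<noteq> 0" using f(6)[of ?\<nu>] P0(3)[of ?\<nu>] by (simp add: inv)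
  have Ae: "app A e0 = 0" "app A x \<bullet> e0 = 0" for x
    using f(7) app_tp'[of x A e0] by (auto simp: adm_def)
  have "h * ?B * k = ?c *\<^sub>R A"
  proof (rule endo_eqI)
    fix x :: 'a
    define y where "y = x - (x \<bullet> e0) *\<^sub>R e0"
    have y: "y \<bullet> e0 = 0" by (simp add: y_def perp)
    have z: "br ?\<nu> ?\<nu> = 0" using lie by (simp add: lie_algebra_def)
    have "app (?B * k) x = app P0 (br ?\<nu> (app Q y))"
      by (simp add: k y_def[symmetric] app_ad[OF lie, symmetric] inv del: app_linear(3))
        (simp add: app_ad[OF lie] z)
    moreover have Pb: "app P (br ?\<nu> (app Q y)) = ?c *\<^sub>R app A y"
      by (simp add: f(3,8) y)
    moreover have "app P0 (br ?\<nu> (app Q y)) \<bullet> e0 = 0"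
      using P0(3) f(6)[of "br ?\<nu> (app Q y)"] by (simp add: Pb Ae)
    ultimately have "app (h * (?B * k)) x = ?c *\<^sub>R app A y"
      by (simp add: h inv)
    also have "app A y = app A x" by (simp add: y_def Ae)
    finally show "app (h * ?B * k) x = app (?c *\<^sub>R A) x" by simp
  qed
  then have "A = (1 / ?c) *\<^sub>R (h * ?B * k)" using c by simp
  with hk kh c show thesis by (intro that[of h k "1 / ?c"]) auto
qed

lemma frame_conj_frame:
  assumes lie: "lie_algebra br" and fr: "frame br N g P Q A" and fr0: "frame br N g0 P0 Q0 A0"
  obtains h k c where "h * k = 1" "k * h = 1" "c \<noteq> 0" "A = c *\<^sub>R (h * A0 * k)"
  using frame_conj[OF lie fr frame_facts(1,2,6)[OF fr0]] frame_matrix[OF lie fr0] by metis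

lemma pinch_nonneg: "pinch A \<ge> 0"
  by (simp add: pinch_def)

lemma pinch_zero: "sy A = 0 \<Longrightarrow> pinch A = 0"
proof -
  assume s: "sy A = 0"
  have "tr A = tr (sy A)" by (simp add: sy_def)
  with s show ?thesis by (simp add: pinch_def tau_def)
qed

text \<open>Conjugating A by exp(t E) means pulling the standard product back along exp(t E) P.
  These metrics depend continuously on t for pointwise convergence, so small t stay in the
  neighbourhood on which g is maximal.\<close>

lemma local_max_imp_direction:
  fixes br :: "'a::euclidean_space \<Rightarrow> 'a \<Rightarrow> 'a"
  assumes fr: "frame br N g P Q A"
    and lm: "local_maximum_on (nonflat_metrics br) (ricci_pinching br) g"
  shows "local_max_direction e0 A"
  unfolding local_max_direction_def
proof (intro allI impI)
  fix E :: "'a endo" assume E: "tp E = E" "adm e0 E"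
  let ?h = "expo E"
  define G where "G t x y = app (?h t * P) x \<bullet> app (?h t * P) y" for t x y
  have he: "app (?h t) e0 = e0" for t by (rule expo_fixes[OF E(2)])
  have Gfr: "frame br N (G t) (?h t * P) (Q * ?h (- t)) (orbit E A t)" for t
    unfolding G_def orbit_def
    by (rule frame_transform[OF fr expo_inverse he]) (simp add: tp_expo[OF E(1)] he)
  have G0: "G 0 = g" by (simp add: G_def frame_facts(5)[OF fr] fun_eq_iff)
  have cont: "continuous_on UNIV G"
  proof (intro continuous_on_coordinatewise_then_product)
    fix x y
    have c: "continuous_on UNIV (\<lambda>t. app (?h t) v)" for v
      by (rule continuous_at_imp_continuous_on)
        (use expo_deriv_app has_vector_derivative_continuous in blast)
    show "continuous_on UNIV (\<lambda>t. G t x y)"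
      unfolding G_def by (simp only: app_simps) (intro continuous_intros c)
  qed
  have "\<forall>\<^sub>F h in at g within nonflat_metrics br. ricci_pinching br h \<le> ricci_pinching br g"
    using lm by (simp add: local_maximum_on_def)
  then obtain S where S: "open S" "g \<in> S"
    "\<And>h. h \<in> S \<Longrightarrow> h \<noteq> g \<Longrightarrow> h \<in> nonflat_metrics br \<Longrightarrow> ricci_pinching br h \<le> ricci_pinching br g"
    unfolding eventually_at_topological by blast
  have "open (G -` S)" using open_vimage[OF S(1) cont] .
  moreover have "0 \<in> G -` S" using S(2) G0 by simp
  ultimately have "\<forall>\<^sub>F t in nhds 0. t \<in> G -` S" by (rule eventually_nhds_in_open)
  then have "\<forall>\<^sub>F t in at 0. t \<in> G -` S" by (simp add: eventually_at_filter eventually_mono)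
  then show "\<forall>\<^sub>F t in at 0. pinch (orbit E A t) \<le> pinch A"
  proof eventually_elim
    case (elim t)
    show ?case
    \<comment> \<open>The neighbourhood only speaks about non-flat metrics other than
      \<open>g\<close>. At a flat one the numerator of \<open>pinch\<close> vanishes, so the
      inequality holds there as well.\<close>
    proof (cases "sy (orbit E A t) = 0 \<or> G t = g")
      case True
      then show ?thesis
      proof
        assume "sy (orbit E A t) = 0"
        then show ?thesis using pinch_nonneg[of A] by (simp add: pinch_zero)
      next
        assume "G t = g"
        then show ?thesis
          using ricci_pinching_frame[OF Gfr[of t]] ricci_pinching_frame[OF fr] by simp
      qed
    next
      case False
      then have "G t \<in> nonflat_metrics br" using frame_nonflat[OF Gfr] by blast
      then show ?thesis
        using S(3)[of "G t"] elim False ricci_pinching_frame[OF Gfr[of t]] ricci_pinching_frame[OF fr]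
        by simp
    qed
  qed
qed

section \<open>Solvsolitons\<close>

lemma cm_ric:
  assumes "adm e0 A" shows "cm (ric A) A = (1/2) *\<^sub>R cm (mom A) A + (tr A / 2) *\<^sub>R mom A"
proof -
  have "outer e0 e0 * A = 0"
  proof (rule endo_eqI)
    fix x
    have "app A x \<bullet> e0 = x \<bullet> app (tp A) e0" by (simp add: app_tp')
    then show "app (outer e0 e0 * A) x = app 0 x" using assms by (simp add: adm_def)
  qed
  moreover have "A * outer e0 e0 = 0" by (rule endo_eqI) (use assms in \<open>simp add: adm_def\<close>)
  ultimately have o: "cm (outer e0 e0) A = 0" by (simp add: cm_def)
  have "cm (sy A) A = - (1/2) *\<^sub>R mom A"
    using cm_swap[of "tp A" A] by (simp add: sy_def cm_linear mom_def)
  then show ?thesis by (simp add: ric_def cm_linear o)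
qed

text \<open>Pairing with A gives d |A|^2 = |M|^2 / 2, so d > 0 unless M = 0; taking traces gives d
  tr A = 0, which removes the second term.\<close>

lemma solvsoliton_equation:
  "(\<exists>d. (1/2) *\<^sub>R cm (mom A) A + (tr A / 2) *\<^sub>R mom A = d *\<^sub>R A) \<longleftrightarrow>
    mom A = 0 \<or> (\<exists>r>0. cm (mom A) A = r *\<^sub>R A)"
proof
  assume "\<exists>d. (1/2) *\<^sub>R cm (mom A) A + (tr A / 2) *\<^sub>R mom A = d *\<^sub>R A"
  then obtain d where d: "(1/2) *\<^sub>R cm (mom A) A + (tr A / 2) *\<^sub>R mom A = d *\<^sub>R A" by blast
  show "mom A = 0 \<or> (\<exists>r>0. cm (mom A) A = r *\<^sub>R A)"
  proof (cases "mom A = 0")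
    case False
    then have A: "A \<noteq> 0" by (auto simp: mom_def cm_linear)
    have "inner (mom A) A = 0"
      unfolding mom_def using inner_cm_right[of A "tp A" A]
      by (simp add: inner_cm_left[of A "tp A" A] cm_linear)
    then have "d * inner A A = (norm (mom A))\<^sup>2 / 2"
      using arg_cong[OF d, of "\<lambda>z. inner z A"] inner_cm_self_mom[of A] by (simp add: inner_add_left)
    moreover have "inner A A > 0" using A by simp
    moreover have "(norm (mom A))\<^sup>2 / 2 > 0" using False by simp
    ultimately have d0: "d > 0" by (metis zero_less_mult_pos2)
    have "d * tr A = 0" using arg_cong[OF d, of tr] by (simp add: mom_def)
    then have "tr A = 0" using d0 by simp
    then have "2 *\<^sub>R ((1/2) *\<^sub>R cm (mom A) A) = 2 *\<^sub>R (d *\<^sub>R A)" using d by simp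
    then have "cm (mom A) A = (2 * d) *\<^sub>R A" by simp
    with d0 show ?thesis by (intro disjI2 exI[of _ "2 * d"]) auto
  qed simp
next
  assume "mom A = 0 \<or> (\<exists>r>0. cm (mom A) A = r *\<^sub>R A)"
  then show "\<exists>d. (1/2) *\<^sub>R cm (mom A) A + (tr A / 2) *\<^sub>R mom A = d *\<^sub>R A"
  proof
    assume "mom A = 0"
    then show ?thesis by (intro exI[of _ 0]) (simp add: cm_linear)
  next
    assume "\<exists>r>0. cm (mom A) A = r *\<^sub>R A"
    then obtain r where r: "r > 0" "cm (mom A) A = r *\<^sub>R A" by blast
    then have "tr A = 0" using tr_eigen by auto
    with r show ?thesis by (intro exI[of _ "r / 2"]) simp
  qed
qed

lemma ric_e0:
  assumes "adm e0 A" shows "app (ric A) x \<bullet> e0 = - tau A * (x \<bullet> e0)" "app (ric A) e0 = - tau A *\<^sub>R e0"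
proof -
  have m: "adm e0 (mom A)" "adm e0 (sy A)" using assms by blast+
  have "app (mom A) x \<bullet> e0 = 0" "app (sy A) x \<bullet> e0 = 0"
    using m app_tp'[of x "mom A" e0] app_tp'[of x "sy A" e0] by (auto simp: adm_def)
  then show "app (ric A) x \<bullet> e0 = - tau A * (x \<bullet> e0)" by (simp add: ric_def inner_simps)
  show "app (ric A) e0 = - tau A *\<^sub>R e0" using m by (simp add: ric_def adm_def)
qed

text \<open>Ric preserves the normal line with eigenvalue - tau, so Ric - c is a derivation exactly
  if [Ric, A] = (- tau - c) A. By \<open>cm_ric\<close> some such c exists if and only if the
  preceding equation has a solution.\<close>

lemma solvsoliton_frame:
  assumes fr: "frame br N g P Q A"
  shows "solvsoliton br g \<longleftrightarrow> mom A = 0 \<or> (\<exists>r>0. cm (mom A) A = r *\<^sub>R A)"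
  unfolding solvsoliton_equation[symmetric]
proof
  note f = frame_facts[OF fr]
  note ricA = ric_e0[OF f(7)]
  have Ae: "app A e0 = 0" using f(7) by (simp add: adm_def)
  assume "solvsoliton br g"
  then obtain c D where D: "derivation br D" "\<And>x. ricci_operator br g x = c *\<^sub>R x + D x"
    by (auto simp: solvsoliton_def)
  have Dx: "app P (D x) = app (ric A) (app P x) - c *\<^sub>R app P x" for x
  proof -
    have "app P (ricci_operator br g x) = c *\<^sub>R app P x + app P (D x)" by (simp add: D(2))
    then show ?thesis by (simp add: ricci_operator_frame[OF fr] f)
  qed
  have "cm (ric A) A = (- tau A - c) *\<^sub>R A"
  proof (rule endo_eqI)
    fix y
    have "D (br (app Q e0) (app Q y)) = br (D (app Q e0)) (app Q y) + br (app Q e0) (D (app Q y))"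
      using D(1) by (simp add: derivation_def)
    from arg_cong[OF this, of "app P"]
    have "app (ric A) (app A y) - c *\<^sub>R app A y = (- tau A - c) *\<^sub>R app A y
       + (app A (app (ric A) y) - c *\<^sub>R app A y)"
      by (simp add: Dx f(3,8) ricA Ae inner_simps algebra_simps)
    then show "app (cm (ric A) A) y = app ((- tau A - c) *\<^sub>R A) y"
      by (simp add: cm_def algebra_simps)
  qed
  then show "\<exists>d. (1/2) *\<^sub>R cm (mom A) A + (tr A / 2) *\<^sub>R mom A = d *\<^sub>R A"
    unfolding cm_ric[OF f(7)] by blast
next
  note f = frame_facts[OF fr]
  note ricA = ric_e0[OF f(7)]
  assume "\<exists>d. (1/2) *\<^sub>R cm (mom A) A + (tr A / 2) *\<^sub>R mom A = d *\<^sub>R A"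
  then obtain d where d: "cm (ric A) A = d *\<^sub>R A" unfolding cm_ric[OF f(7)] by blast
  define c where "c = - tau A - d"
  let ?D = "Q * (ric A - c *\<^sub>R 1) * P"
  have RA: "app (ric A) (app A y) = app A (app (ric A) y) + d *\<^sub>R app A y" for y
    using arg_cong[OF d, of "\<lambda>z. app z y"] by (simp add: cm_def algebra_simps)
  have "app ?D (br x y) = br (app ?D x) y + br x (app ?D y)" for x y
  proof -
    have "app P (app ?D (br x y)) = app P (br (app ?D x) y + br x (app ?D y))"
      by (simp add: f(3,8) RA ricA inner_simps c_def algebra_simps)
    then have "app Q (app P (app ?D (br x y))) = app Q (app P (br (app ?D x) y + br x (app ?D y)))" by (rule arg_cong)
    then show ?thesis unfolding f(4) .
  qed
  then have "derivation br (app ?D)" by (simp add: derivation_def linear_app)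
  moreover have "ricci_operator br g x = c *\<^sub>R x + app ?D x" for x
    by (simp add: ricci_operator_frame[OF fr] f)
  ultimately show "solvsoliton br g"
    unfolding solvsoliton_def using frame_inner_product[OF fr] by blast
qed

lemma solvsoliton_pinching_max:
  assumes lie: "lie_algebra br" and ideal: "codim1_abelian_ideal br N"
    and g: "g \<in> nonflat_metrics br" "solvsoliton br g" and g': "g' \<in> nonflat_metrics br"
  shows "ricci_pinching br g' \<le> ricci_pinching br g"
proof -
  have "inner_product g" "inner_product g'" using g g' by (auto simp: nonflat_metrics_def)
  then obtain P Q A P' Q' A' where fr: "frame br N g P Q A" and fr': "frame br N g' P' Q' A'"
    using frame_exists[OF lie ideal] by metis
  obtain h k c where hk: "h * k = 1" "k * h = 1" and c: "c \<noteq> 0" and A': "A' = c *\<^sub>R (h * A * k)"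
    using frame_conj_frame[OF lie fr' fr] by metis
  have sA: "sy A \<noteq> 0" using g(1) frame_nonflat[OF fr] by blast
  have "pinch A' = pinch (h * A * k)" unfolding A' by (rule pinch_scaleR[OF c])
  also have "\<dots> \<le> pinch A"
    using g(2) unfolding solvsoliton_frame[OF fr]
  proof
    assume "mom A = 0"
    from pinch_conj_le_normal(2)[OF this sA hk, of 0] show ?thesis by (simp add: cm_linear)
  next
    assume "\<exists>r>0. cm (mom A) A = r *\<^sub>R A"
    moreover have "A \<noteq> 0" using sA by (auto simp: sy_def)
    ultimately show ?thesis using pinch_conj_le_nilsoliton hk by blast
  qed
  finally show ?thesis by (simp add: ricci_pinching_frame[OF fr] ricci_pinching_frame[OF fr'])
qed

section \<open>Ricci solitons\<close>

lemma bounded_linear_app: "bounded_linear (app a)"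
  by (simp add: linear_conv_bounded_linear[symmetric] linear_app)

lemma linear_real_ode_zero:
  fixes f :: "real \<Rightarrow> real"
  assumes "\<And>t. (f has_vector_derivative d * f t) (at t)" "f 0 = 0"
  shows "f s = 0"
  by (rule linear_ode_unique[of "\<lambda>x. d * x" f]) (use assms in \<open>auto intro!: linearI simp: algebra_simps\<close>)

lemma linear_expo_const:
  assumes "linear \<eta>" "\<And>x. \<eta> (app T x) = (0::real)"
  shows "\<eta> (app (expo T t) x) = \<eta> x"
proof -
  have "bounded_linear \<eta>" using assms(1) by (simp add: linear_conv_bounded_linear)
  from bounded_linear.has_vector_derivative[OF this expo_deriv_app[of T x]]
  have "((\<lambda>t. \<eta> (app (expo T t) x)) has_real_derivative 0) (at t)" for t
    by (simp add: assms(2) has_real_derivative_iff_has_vector_derivative)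
  from DERIV_isconst_all[of _ t 0, OF allI[OF this]] show ?thesis by simp
qed

lemma expo_eq_on_kernel:
  assumes \<eta>: "linear \<eta>" "\<And>x. \<eta> (app T x) = (0::real)"
    and eq: "\<And>x. \<eta> x = 0 \<Longrightarrow> app T' x = app T x" and x: "\<eta> x = 0"
  shows "app (expo T' t) x = app (expo T t) x"
proof -
  let ?f = "\<lambda>t. app (expo T' t) x - app (expo T t) x"
  have "?f t = 0"
  proof (rule linear_ode_unique[OF linear_app])
    fix s
    have "\<eta> (app (expo T s) x) = 0" using linear_expo_const[OF \<eta>] x by simp
    then have "app T (app (expo T s) x) = app T' (app (expo T s) x)" by (simp add: eq)
    then show "(?f has_vector_derivative app T' (?f s)) (at s)"
      using has_vector_derivative_diff[OF expo_deriv_app[of T' x s] expo_deriv_app[of T x s]] by simp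
  qed simp
  then show ?thesis by simp
qed

text \<open>The relation [D, T] = d B integrated along the flow of T; since T commutes with B, the
  correction is linear in t.\<close>

lemma expo_derivation:
  assumes DT: "D * T = T * D + d *\<^sub>R B" and TB: "T * B = B * T"
  shows "D * expo T t = expo T t * (D + (d * t) *\<^sub>R B)"
proof (rule endo_eqI)
  fix x
  let ?f = "\<lambda>t. app D (app (expo T t) x) - app (expo T t) (app D x) - (d * t) *\<^sub>R app (expo T t) (app B x)"
  have "?f t = 0"
  proof (rule linear_ode_unique[OF linear_app])
    fix s
    have d1: "((\<lambda>t. app D (app (expo T t) x)) has_vector_derivative app D (app T (app (expo T s) x))) (at s)"
      by (rule bounded_linear.has_vector_derivative[OF bounded_linear_app expo_deriv_app])
    have d2: "((\<lambda>t. d * t) has_real_derivative d) (at s)" by (auto intro!: derivative_eq_intros)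
    note d3 = has_vector_derivative_scaleR[OF d2 expo_deriv_app[of T "app B x" s]]
    have DTx: "app D (app T y) = app T (app D y) + d *\<^sub>R app B y" for y
      using arg_cong[OF DT, of "\<lambda>z. app z y"] by simp
    have "expo T s * B = B * expo T s" by (rule expo_commute[OF TB])
    then have BL: "app (expo T s) (app B x) = app B (app (expo T s) x)" by (metis app_simps(6))
    show "(?f has_vector_derivative app T (?f s)) (at s)"
      using has_vector_derivative_diff[OF has_vector_derivative_diff[OF d1 expo_deriv_app[of T "app D x" s]] d3]
      by (rule has_vector_derivative_eq_rhs) (simp add: DTx BL algebra_simps)
  qed simp
  then show "app (D * expo T t) x = app (expo T t * (D + (d * t) *\<^sub>R B)) x"
    by (simp add: algebra_simps)
qed

text \<open>A class of maps which contains the soliton field and is closed under directional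
  derivatives, so that smoothness follows by induction.\<close>

definition exp_affine :: "('a::euclidean_space \<Rightarrow> real) \<Rightarrow> 'a endo \<Rightarrow> 'a \<Rightarrow> 'a \<Rightarrow> 'a endo \<Rightarrow> 'a endo \<Rightarrow> 'a endo \<Rightarrow> 'a \<Rightarrow> 'a" where
  "exp_affine \<eta> T w c L L1 L2 p =
     c + app L p + app L1 (app (expo T (\<eta> p)) w) + \<eta> p *\<^sub>R app L2 (app (expo T (\<eta> p)) w)"

context
  fixes \<eta> :: "'a::euclidean_space \<Rightarrow> real"
  assumes \<eta>: "linear \<eta>"
begin

lemma expo_has_derivative:
  "((\<lambda>q. app (expo T (\<eta> q)) w) has_derivative (\<lambda>y. \<eta> y *\<^sub>R app T (app (expo T (\<eta> p)) w))) (at p)"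
proof -
  have "bounded_linear \<eta>" using \<eta> by (simp add: linear_conv_bounded_linear)
  from has_derivative_compose[OF bounded_linear_imp_has_derivative[OF this]
      expo_deriv_app[unfolded has_vector_derivative_def]]
  show ?thesis .
qed

lemma exp_affine_has_derivative:
  "(exp_affine \<eta> T w c L L1 L2 has_derivative
     (\<lambda>y. app L y + \<eta> y *\<^sub>R app L1 (app T (app (expo T (\<eta> p)) w))
        + (\<eta> p *\<^sub>R (\<eta> y *\<^sub>R app L2 (app T (app (expo T (\<eta> p)) w))) + \<eta> y *\<^sub>R app L2 (app (expo T (\<eta> p)) w)))) (at p)"
proof -
  have "bounded_linear \<eta>" using \<eta> by (simp add: linear_conv_bounded_linear)
  note d\<eta> = bounded_linear_imp_has_derivative[OF this, of "at p"]
  have dL: "((\<lambda>q. app L' (app (expo T (\<eta> q)) w)) has_derivative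
      (\<lambda>y. \<eta> y *\<^sub>R app L' (app T (app (expo T (\<eta> p)) w)))) (at p)" for L'
    using bounded_linear.has_derivative[OF bounded_linear_app expo_has_derivative, of L' T w p] by simp
  show ?thesis
    unfolding exp_affine_def[abs_def]
    by (rule has_derivative_eq_rhs[OF has_derivative_add[OF has_derivative_add[OF has_derivative_add[OF
            has_derivative_const bounded_linear_imp_has_derivative[OF bounded_linear_app]] dL]
            has_derivative_scaleR[OF d\<eta> dL]]]) simp
qed

lemma frechet_derivative_exp_affine:
  "(\<lambda>p. frechet_derivative (exp_affine \<eta> T w c L L1 L2) (at p) v)
    = exp_affine \<eta> T w (app L v) 0 (\<eta> v *\<^sub>R (L1 * T + L2)) (\<eta> v *\<^sub>R (L2 * T))"
  by (rule ext) (simp add: frechet_derivative_at[OF exp_affine_has_derivative, symmetric]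
      exp_affine_def algebra_simps)

lemma smooth_exp_affine: "smooth (exp_affine \<eta> T w c L L1 L2)"
proof -
  have dif: "exp_affine \<eta> T w c L L1 L2 differentiable at p" for c L L1 L2 p
    using exp_affine_has_derivative unfolding differentiable_def by blast
  have "C_k k (exp_affine \<eta> T w c L L1 L2)" for k c L L1 L2
  proof (induction k arbitrary: c L L1 L2)
    case 0
    then show ?case using dif
      by (simp add: continuous_at_imp_continuous_on differentiable_imp_continuous_within)
  next
    case (Suc k)
    then show ?case using dif by (simp add: frechet_derivative_exp_affine)
  qed
  then show ?thesis by (simp add: smooth_def)
qed

end

lemma inv_left_diff:
  assumes lie: "lie_algebra br" and ideal: "codim1_abelian_ideal br N" and X: "X \<notin> N"
  shows "inv (left_diff (group_mult br N X) p) = app (expo (ad br X) (- height N X p))"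
proof -
  have "left_diff (group_mult br N X) p = app (expo (ad br X) (height N X p))"
    by (simp add: left_diff_group_mult[OF lie ideal X] app_expo app_ad[OF lie])
  moreover have "inv (app (expo T t)) = app (expo T (- t))" for T :: "'a endo" and t
    by (rule inv_unique_comp)
      (simp_all add: fun_eq_iff app_simps(6)[symmetric] expo_inverse del: app_simps(6))
  ultimately show ?thesis by simp
qed

text \<open>
  In the coordinates \<open>p = h X + u\<close> the linear field of the derivation \<open>D\<close>, which belongs to the
  coordinates along the unit normal \<open>\<nu>\<close> with \<open>X = s \<nu> + n\<close>, is no longer linear. The
  endomorphism \<open>T'\<close> agrees with \<open>ad X\<close> on \<open>N\<close> and maps \<open>X\<close> to \<open>n\<close>, so that
  \<open>exp (t T') X - X\<close> is the integral of \<open>exp (r ad X) n\<close> over \<open>0 \<le> r \<le> t\<close>; this is the change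
  of coordinates. The skew part \<open>K\<close> does not change the metric field.
\<close>

lemma ricci_soliton_of_derivation:
  fixes br :: "'a::euclidean_space \<Rightarrow> 'a \<Rightarrow> 'a"
  assumes lie: "lie_algebra br" and ideal: "codim1_abelian_ideal br N" and X: "X \<notin> N"
    and fr: "frame br N g P Q (B + K)"
    and BK: "cm B K = 0" "tp K = - K" "adm e0 B" "adm e0 K"
    and D1: "tp D1 = D1" "adm e0 D1" "cm D1 B = d *\<^sub>R B" "cm D1 K = 0"
    and ricA: "ric (B + K) = c *\<^sub>R 1 + 2 *\<^sub>R (D1 + d *\<^sub>R outer e0 e0)"
  shows "ricci_soliton br N X g"
proof -
  note f = frame_facts[OF fr]
  let ?h = "height N X"
  define \<eta> where "\<eta> = ?h"
  have \<eta>: "linear \<eta>" unfolding \<eta>_def by (rule linear_height[OF lie ideal X])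
  note \<eta>l = linear_add[OF \<eta>] linear_diff[OF \<eta>] linear_scale[OF \<eta>] linear_0[OF \<eta>] linear_neg[OF \<eta>]
  define s where "s = app P X \<bullet> e0"
  have s0: "s \<noteq> 0" using X f(6)[of X] by (simp add: s_def)
  have P\<eta>: "app P x \<bullet> e0 = \<eta> x * s" for x
  proof -
    have "x - \<eta> x *\<^sub>R X \<in> N" unfolding \<eta>_def by (rule height_mem[OF lie ideal X])
    then show ?thesis by (simp add: f(6) s_def inner_simps)
  qed
  define \<nu> where "\<nu> = app Q e0"
  define n where "n = X - s *\<^sub>R \<nu>"
  have X_eq: "X = s *\<^sub>R \<nu> + n" by (simp add: n_def)
  have \<eta>X: "\<eta> X = 1" using P\<eta>[of X] s0 by (simp add: s_def)
  have \<eta>\<nu>: "s * \<eta> \<nu> = 1" using P\<eta>[of \<nu>] by (simp add: \<nu>_def f(3) mult.commute)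
  have \<eta>n: "\<eta> n = 0" by (simp add: n_def \<eta>l \<eta>X \<eta>\<nu>)
  define T where "T = ad br X"
  have Tbr: "app T = br X" by (simp add: T_def app_ad[OF lie])
  have \<eta>T: "\<eta> (app T x) = 0" for x unfolding Tbr \<eta>_def by (rule height_br[OF lie ideal X])
  have TX: "app T X = 0" using lie by (simp add: Tbr lie_algebra_def)
  define D where "D = Q * (D1 + d *\<^sub>R outer e0 e0) * P"
  define Bh where "Bh = Q * (s *\<^sub>R B) * P"
  define Kh where "Kh = Q * (s *\<^sub>R K) * P"
  define Th where "Th = Bh + Kh"
  have e0z: "app B e0 = 0" "app K e0 = 0" "app D1 e0 = 0"
    "app B x \<bullet> e0 = 0" "app K x \<bullet> e0 = 0" "app D1 x \<bullet> e0 = 0" for x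
    using BK(3,4) D1(2) app_tp'[of x B e0] app_tp'[of x K e0] app_tp'[of x D1 e0] by (auto simp: adm_def)
  have conj: "Q * x * P * (Q * y * P) = Q * (x * y) * P" for x y
    by (metis f(1) mult.assoc mult_1)
  have TN: "app Th x = app T x" if "\<eta> x = 0" for x
  proof -
    have "app P (app T x) = s *\<^sub>R app (B + K) (app P x)"
      by (simp add: Tbr f(8) P\<eta> that \<eta>X del: app_simps)
    then have "app Q (app P (app T x)) = app Q (s *\<^sub>R app (B + K) (app P x))" by (rule arg_cong)
    then show ?thesis by (simp add: Th_def Bh_def Kh_def f(4) algebra_simps)
  qed
  have \<eta>Q: "\<eta> (app Q y) = 0" if "y \<bullet> e0 = 0" for y
    using P\<eta>[of "app Q y"] that s0 by (simp add: f(3))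
  have \<eta>BK: "\<eta> (app Bh x) = 0" "\<eta> (app Kh x) = 0" for x
    by (simp_all add: Bh_def Kh_def \<eta>l \<eta>Q e0z)
  then have \<eta>Th: "\<eta> (app Th x) = 0" for x by (simp add: Th_def \<eta>l)
  have \<eta>D: "\<eta> (app D x) = d * \<eta> x" for x
  proof -
    have "app P (app D x) \<bullet> e0 = d * (app P x \<bullet> e0)"
      by (simp add: D_def f(3) e0z inner_simps)
    then show ?thesis using s0 by (simp add: P\<eta>)
  qed
  have D\<nu>: "app D \<nu> = d *\<^sub>R \<nu>" by (simp add: D_def \<nu>_def f(3) e0z)
  have DX: "app D X = d *\<^sub>R X - d *\<^sub>R n + app D n"
    unfolding n_def by (simp add: D\<nu> algebra_simps)
  have KX: "app Kh X = app Kh n" unfolding n_def by (simp add: Kh_def \<nu>_def f(3) e0z)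
  have Th_eq: "Th = Q * (s *\<^sub>R (B + K)) * P"
    by (simp add: Th_def Bh_def Kh_def algebra_simps)
  have TB: "Th * Bh = Bh * Th"
  proof -
    have "K * B = B * K" using BK(1) by (simp add: cm_def)
    then have "s *\<^sub>R (B + K) * (s *\<^sub>R B) = s *\<^sub>R B * (s *\<^sub>R (B + K))"
      by (simp add: distrib_left distrib_right scaleR_add_right)
    then show ?thesis unfolding Th_eq unfolding Bh_def conj by (simp only:)
  qed
  have DT: "D * Th = Th * D + d *\<^sub>R Bh"
  proof -
    have o: "outer e0 e0 * B = 0" "outer e0 e0 * K = 0" "B * outer e0 e0 = 0" "K * outer e0 e0 = 0"
      by (rule endo_eqI; simp add: e0z)+
    have "D1 * B = B * D1 + d *\<^sub>R B" "D1 * K = K * D1"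
      using D1(3,4) by (simp_all add: cm_def algebra_simps)
    then have "(D1 + d *\<^sub>R outer e0 e0) * (s *\<^sub>R (B + K)) = (s *\<^sub>R (B + K)) * (D1 + d *\<^sub>R outer e0 e0) + d *\<^sub>R (s *\<^sub>R B)"
      by (simp add: o algebra_simps)
    then have "Q * ((D1 + d *\<^sub>R outer e0 e0) * (s *\<^sub>R (B + K))) * P
      = Q * ((s *\<^sub>R (B + K)) * (D1 + d *\<^sub>R outer e0 e0)) * P + d *\<^sub>R (Q * (s *\<^sub>R B) * P)"
      by (simp add: distrib_left distrib_right)
    then show ?thesis unfolding Th_eq unfolding D_def Bh_def conj .
  qed
  define L where "L = expo T"
  define Lh where "Lh = expo Th"
  have LN: "app (L t) x = app (Lh t) x" if "\<eta> x = 0" for t x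
    unfolding L_def Lh_def by (rule expo_eq_on_kernel[OF \<eta> \<eta>Th TN[symmetric] that])
  have \<eta>L: "\<eta> (app (L t) x) = \<eta> x" for t x
    unfolding L_def by (rule linear_expo_const[OF \<eta> \<eta>T])
  have LX: "app (L t) X = X" for t
  proof -
    have "app (L t) X - X = 0"
      unfolding L_def
      by (rule linear_ode_unique[OF linear_app[of T], of "\<lambda>t. app (expo T t) X - X"])
        (use has_vector_derivative_diff[OF expo_deriv_app has_vector_derivative_const] in \<open>simp_all add: TX\<close>)
    then show ?thesis by simp
  qed
  have DL: "app D (app (Lh t) x) = app (Lh t) (app D x + (d * t) *\<^sub>R app Bh x)" for t x
    using arg_cong[OF expo_derivation[OF DT TB, of t], of "\<lambda>z. app z x"] by (simp add: Lh_def)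
  have ThL: "app Th (app (Lh t) x) = app (Lh t) (app Th x)" for t x
    using arg_cong[OF expo_commute[of Th Th t], of "\<lambda>z. app z x"] by (simp add: Lh_def)
  define Hn where "Hn v = Endo (\<lambda>x. \<eta> x *\<^sub>R v)" for v
  have Hn: "app (Hn v) x = \<eta> x *\<^sub>R v" for v x
    unfolding Hn_def by (subst app_Endo) (auto intro!: linearI simp: \<eta>l algebra_simps)
  define T' where "T' = T + Hn n"
  have T': "app T' x = app T x + \<eta> x *\<^sub>R n" for x by (simp add: T'_def Hn)
  have \<eta>T': "\<eta> (app T' x) = 0" for x by (simp add: T' \<eta>l \<eta>T \<eta>n)
  define E where "E t = app (expo T' t) X" for t
  have \<eta>E: "\<eta> (E t) = 1" for t
    unfolding E_def by (simp add: linear_expo_const[OF \<eta> \<eta>T'] \<eta>X)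
  have T'E: "app T' (E t) = app (Lh t) n" for t
  proof -
    have "app T' (E t) = app (expo T' t) (app T' X)"
      using arg_cong[OF expo_commute[of T' T' t], of "\<lambda>z. app z X"] by (simp add: E_def)
    also have "app T' X = n" by (simp add: T' TX \<eta>X)
    also have "app (expo T' t) n = app (Lh t) n"
      unfolding Lh_def by (rule expo_eq_on_kernel[OF \<eta> \<eta>Th _ \<eta>n]) (simp add: T' TN)
    finally show ?thesis .
  qed
  have \<eta>Ln: "\<eta> (app (Lh t) n) = 0" for t using linear_expo_const[OF \<eta> \<eta>Th] \<eta>n by (simp add: Lh_def)
  have T'T'E: "app T' (app T' (E t)) = app (Lh t) (app Th n)" for t
    unfolding T'E unfolding T' \<eta>Ln TN[OF \<eta>Ln, symmetric] ThL by simp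
  \<comment> \<open>In the coordinates \<open>t = \<eta> p\<close> and
    \<open>w = p - t *\<^sub>R X + E t - X\<close> this is the linear field (d t, D w), transported
    back.\<close>
  define Y where "Y = exp_affine \<eta> T' X (- app D X) (d *\<^sub>R Hn X + D - D * Hn X) D (- d *\<^sub>R T')"
  have Y: "Y p = (d * \<eta> p) *\<^sub>R X + app D (p - \<eta> p *\<^sub>R X + E (\<eta> p) - X) - (d * \<eta> p) *\<^sub>R app T' (E (\<eta> p))" for p
    by (simp add: Y_def exp_affine_def Hn E_def algebra_simps)
  have \<eta>Y: "\<eta> (Y p) = d * \<eta> p" for p
    unfolding Y by (simp add: \<eta>l \<eta>D \<eta>T' \<eta>X \<eta>E del: app_linear)
  have dY: "frechet_derivative Y (at p) y = (d * \<eta> y) *\<^sub>R X + app D (y - \<eta> y *\<^sub>R X)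
      + \<eta> y *\<^sub>R (app D (app T' (E (\<eta> p))) - d *\<^sub>R app T' (E (\<eta> p)) - (d * \<eta> p) *\<^sub>R app T' (app T' (E (\<eta> p))))" for p y
    unfolding Y_def frechet_derivative_at[OF exp_affine_has_derivative[OF \<eta>], symmetric]
    by (simp add: Hn E_def algebra_simps)
  have complete: "complete_vector_field Y"
    unfolding complete_vector_field_def
  proof (intro conjI allI)
    show "smooth Y" unfolding Y_def by (rule smooth_exp_affine[OF \<eta>])
    fix p
    define t0 where "t0 = \<eta> p"
    define w where "w = p - t0 *\<^sub>R X + E t0 - X"
    have \<eta>w: "\<eta> w = 0" by (simp add: w_def \<eta>l \<eta>X \<eta>E t0_def)
    \<comment> \<open>The flow of the linear field: t grows as exp(d r) and w moves by exp(r D),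
      hence it exists for all times.\<close>
    define \<gamma> where "\<gamma> r = (exp (d * r) * t0) *\<^sub>R X + app (expo D r) w - (E (exp (d * r) * t0) - X)" for r
    have "\<eta> (app (expo D r) w) = 0" for r
    proof (rule linear_real_ode_zero[where d = d and f = "\<lambda>r. \<eta> (app (expo D r) w)"])
      have "bounded_linear \<eta>" using \<eta> by (simp add: linear_conv_bounded_linear)
      from bounded_linear.has_vector_derivative[OF this expo_deriv_app[of D w]]
      show "((\<lambda>t. \<eta> (app (expo D t) w)) has_vector_derivative d * \<eta> (app (expo D t) w)) (at t)" for t
        by (simp add: \<eta>D)
    qed (simp add: \<eta>w)
    then have \<eta>\<gamma>: "\<eta> (\<gamma> r) = exp (d * r) * t0" for r by (simp add: \<gamma>_def \<eta>l \<eta>X \<eta>E)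
    show "\<exists>\<gamma>. \<gamma> 0 = p \<and> (\<forall>t. (\<gamma> has_vector_derivative Y (\<gamma> t)) (at t))"
    proof (intro exI[of _ \<gamma>] conjI allI)
      show "\<gamma> 0 = p" by (simp add: \<gamma>_def w_def algebra_simps)
      fix r
      have e: "((\<lambda>r. exp (d * r) * t0) has_real_derivative d * (exp (d * r) * t0)) (at r)"
        by (auto intro!: derivative_eq_intros)
      have dE: "((\<lambda>r. E (exp (d * r) * t0)) has_vector_derivative
          (d * (exp (d * r) * t0)) *\<^sub>R app T' (E (exp (d * r) * t0))) (at r)"
        using vector_diff_chain_at[OF e[unfolded has_real_derivative_iff_has_vector_derivative]
            expo_deriv_app[of T' X]] by (simp add: o_def E_def)
      have "(\<gamma> has_vector_derivative (d * (exp (d * r) * t0)) *\<^sub>R X + app D (app (expo D r) w)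
          - (d * (exp (d * r) * t0)) *\<^sub>R app T' (E (exp (d * r) * t0))) (at r)"
        unfolding \<gamma>_def[abs_def]
        by (rule has_vector_derivative_eq_rhs[OF has_vector_derivative_diff[OF has_vector_derivative_add[OF
              has_vector_derivative_scaleR[OF e has_vector_derivative_const] expo_deriv_app]
              has_vector_derivative_diff[OF dE has_vector_derivative_const]]]) simp
      moreover have "\<gamma> r - (exp (d * r) * t0) *\<^sub>R X + E (exp (d * r) * t0) - X = app (expo D r) w"
        by (simp add: \<gamma>_def)
      ultimately show "(\<gamma> has_vector_derivative Y (\<gamma> r)) (at r)"
        unfolding Y \<eta>\<gamma> by simp
    qed
  qed
  \<comment> \<open>Translated to the identity, dY is D with two corrections. The multiple of
    \<open>Kh\<close> is skew for the metric, and the multiple of \<open>T\<close> cancels the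
    derivative of the metric field along Y; only 2 D remains in the Lie derivative.\<close>
  have key: "frechet_derivative Y (at p) (app (L (\<eta> p)) x)
      = app (L (\<eta> p)) (app D x - (d * \<eta> p) *\<^sub>R app Kh x + (d * \<eta> p) *\<^sub>R app T x)" for p x
  proof -
    define t where "t = \<eta> p"
    define u where "u = x - \<eta> x *\<^sub>R X"
    have \<eta>u: "\<eta> u = 0" by (simp add: u_def \<eta>l \<eta>X)
    have x: "x = \<eta> x *\<^sub>R X + u" by (simp add: u_def)
    have Lx: "app (L t) x = \<eta> x *\<^sub>R X + app (Lh t) u"
      using arg_cong[OF x, of "app (L t)"] by (simp add: LX LN[OF \<eta>u])
    have Lh_eq: "app (Lh t) y = app (L t) y" if "\<eta> y = 0" for y using LN[OF that] by simp
    have "frechet_derivative Y (at p) (app (L t) x) = (d * \<eta> x) *\<^sub>R X + app D (app (Lh t) u)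
      + \<eta> x *\<^sub>R (app D (app (Lh t) n) - d *\<^sub>R app (Lh t) n - (d * t) *\<^sub>R app (Lh t) (app Th n))"
      unfolding dY \<eta>L t_def[symmetric] unfolding T'T'E unfolding T'E by (simp add: Lx)
    also have "\<dots> = (d * \<eta> x) *\<^sub>R X + app (Lh t) (app D u + (d * t) *\<^sub>R app Bh u)
      + \<eta> x *\<^sub>R app (Lh t) (app D n - d *\<^sub>R n - (d * t) *\<^sub>R app Kh n)"
      by (simp add: DL Th_def algebra_simps)
    also have "\<dots> = (d * \<eta> x) *\<^sub>R app (L t) X + app (L t) (app D u + (d * t) *\<^sub>R app Bh u)
      + \<eta> x *\<^sub>R app (L t) (app D n - d *\<^sub>R n - (d * t) *\<^sub>R app Kh n)"
      by (subst (1 2) Lh_eq) (simp_all add: \<eta>l \<eta>D \<eta>BK \<eta>u \<eta>n LX del: app_linear)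
    also have "\<dots> = app (L t) ((d * \<eta> x) *\<^sub>R X + app D u + (d * t) *\<^sub>R app Bh u
      + \<eta> x *\<^sub>R (app D n - d *\<^sub>R n - (d * t) *\<^sub>R app Kh n))"
      by simp
    also have "(d * \<eta> x) *\<^sub>R X + app D u + (d * t) *\<^sub>R app Bh u
        + \<eta> x *\<^sub>R (app D n - d *\<^sub>R n - (d * t) *\<^sub>R app Kh n)
      = app D x - (d * t) *\<^sub>R app Kh x + (d * t) *\<^sub>R app T x"
    proof -
      have "app T x = app Bh u + app Kh u"
        using arg_cong[OF x, of "app T"] TN[OF \<eta>u] by (simp add: TX Th_def)
      moreover have "app D x = \<eta> x *\<^sub>R (d *\<^sub>R X - d *\<^sub>R n + app D n) + app D u"
        using arg_cong[OF x, of "app D"] by (simp add: DX)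
      moreover have "app Kh x = \<eta> x *\<^sub>R app Kh n + app Kh u"
        using arg_cong[OF x, of "app Kh"] by (simp add: KX)
      ultimately show ?thesis by (simp add: algebra_simps)
    qed
    finally show ?thesis by (simp add: t_def)
  qed
  define R where "R p = app (L (- \<eta> p))" for p
  have inv: "inv (left_diff (group_mult br N X) p) = R p" for p
    by (simp add: inv_left_diff[OF lie ideal X] R_def L_def T_def \<eta>_def)
  have RL: "R p (app (L (\<eta> p)) x) = x" "app (L (\<eta> p)) (R p x) = x" for p x
    using app_inverse[OF expo_inverse, of T "\<eta> p"] by (simp_all add: R_def L_def)
  have RdY: "R p (frechet_derivative Y (at p) u) = app D (R p u) - (d * \<eta> p) *\<^sub>R app Kh (R p u)
     + (d * \<eta> p) *\<^sub>R app T (R p u)" for p u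
    using arg_cong[OF key[of p "R p u"], of "R p"] unfolding RL .
  have dR: "((\<lambda>q. R q u) has_derivative (\<lambda>y. - \<eta> y *\<^sub>R app T (R p u))) (at p)" for p u
  proof -
    have "linear (\<lambda>q. - \<eta> q)" using \<eta> by (rule linear_compose_neg)
    from expo_has_derivative[OF this, of T u p] show ?thesis by (simp add: R_def L_def)
  qed
  have lieder: "lie_derivative Y (left_inv_field (group_mult br N X) g) p u v
      = 2 * (app (D1 + d *\<^sub>R outer e0 e0) (app P (R p u)) \<bullet> app P (R p v))" for p u v
  proof -
    have F: "left_inv_field (group_mult br N X) g q u v = app P (R q u) \<bullet> app P (R q v)" for q u v
      by (simp add: left_inv_field_def inv f(5))
    have "((\<lambda>q. app P (R q u) \<bullet> app P (R q v)) has_derivative (\<lambda>y.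
        app P (R p u) \<bullet> app P (- \<eta> y *\<^sub>R app T (R p v)) + app P (- \<eta> y *\<^sub>R app T (R p u)) \<bullet> app P (R p v))) (at p)"
      by (rule has_derivative_inner) (rule bounded_linear.has_derivative[OF bounded_linear_app dR])+
    note fd = frechet_derivative_at[OF this, symmetric]
    have PD: "app P (app D x) = app (D1 + d *\<^sub>R outer e0 e0) (app P x)" "app P (app Kh x) = s *\<^sub>R app K (app P x)" for x
      by (simp_all add: D_def Kh_def f(3))
    have sym: "x \<bullet> app (D1 + d *\<^sub>R outer e0 e0) y = app (D1 + d *\<^sub>R outer e0 e0) x \<bullet> y"
      "x \<bullet> app K y = - (app K x \<bullet> y)" for x y
      using app_tp[of D1 x y] D1(1) app_tp[of K x y] BK(2) by (simp_all add: inner_simps inner_commute)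
    show ?thesis
      unfolding lie_derivative_def F fd \<eta>Y RdY
      by (simp add: PD inner_simps sym del: app_simps)
  qed
  show ?thesis
    unfolding ricci_soliton_def
  proof (intro conjI exI allI)
    show "inner_product g" by (rule frame_inner_product[OF fr])
    show "complete_vector_field Y" by (rule complete)
    fix p u v
    show "left_inv_field (group_mult br N X) (ricci_tensor br g) p u v =
        c * left_inv_field (group_mult br N X) g p u v
        + lie_derivative Y (left_inv_field (group_mult br N X) g) p u v"
      unfolding lieder unfolding left_inv_field_def inv ricci_tensor_frame[OF fr] ricA f(5)
      by (simp add: inner_simps algebra_simps)
  qed
qed

lemma outer_e0_adm:
  assumes "adm e0 A" shows "outer e0 e0 * A = 0" "A * outer e0 e0 = 0"
proof -
  show "A * outer e0 e0 = 0" by (rule endo_eqI) (use assms in \<open>simp add: adm_def\<close>)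
  show "outer e0 e0 * A = 0"
  proof (rule endo_eqI)
    fix x
    have "app A x \<bullet> e0 = x \<bullet> app (tp A) e0" by (simp add: app_tp')
    then show "app (outer e0 e0 * A) x = app 0 x" using assms by (simp add: adm_def)
  qed
qed

lemma adm_complement: "adm e0 (1 - outer e0 e0)"
proof -
  have "tp (outer e0 e0) = outer e0 (e0 :: 'a)" by (rule tp_eqI) (simp add: inner_commute mult.commute)
  then show ?thesis by (simp add: adm_def)
qed

lemma ricci_soliton_normal:
  assumes "lie_algebra br" "codim1_abelian_ideal br N" "X \<notin> N" and fr: "frame br N g P Q A" and m: "mom A = 0"
  shows "ricci_soliton br N X g"
proof -
  let ?\<Pi> = "outer e0 e0 :: 'a endo"
  have ad: "adm e0 A" by (rule frame_facts(7)[OF fr])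
  define D1 where "D1 = (1/2) *\<^sub>R (tau A *\<^sub>R (1 - ?\<Pi>) - tr A *\<^sub>R sy A)"
  have tpo: "tp ?\<Pi> = ?\<Pi>" by (rule tp_eqI) (simp add: inner_commute mult.commute)
  have "cm (sy A) A = 0"
    using m cm_swap[of "tp A" A] by (simp add: sy_def cm_linear mom_def)
  moreover have "cm (1 - ?\<Pi>) A = 0" by (simp add: cm_def algebra_simps outer_e0_adm[OF ad])
  ultimately have c: "cm D1 A = 0" by (simp add: D1_def cm_linear)
  show ?thesis
  proof (rule ricci_soliton_of_derivation[OF assms(1-3), where B = A and K = 0 and d = 0 and c = "- tau A"])
    show "frame br N g P Q (A + 0)" using fr by simp
    show "tp D1 = D1" by (simp add: D1_def tpo)
    show "adm e0 D1" unfolding D1_def using ad adm_complement by blast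
    show "ric (A + 0) = - tau A *\<^sub>R 1 + 2 *\<^sub>R (D1 + 0 *\<^sub>R ?\<Pi>)"
      by (simp add: ric_def m D1_def algebra_simps)
  qed (use ad c in \<open>auto simp: cm_linear\<close>)
qed

lemma ricci_soliton_pair:
  assumes "lie_algebra br" "codim1_abelian_ideal br N" "X \<notin> N" and fr: "frame br N g P Q (B + K)"
    and sp: "soliton_pair e0 B K r"
  shows "ricci_soliton br N X g"
proof -
  let ?\<Pi> = "outer e0 e0 :: 'a endo" and ?t = "tau (B + K)"
  \<comment> \<open>On N the derivation satisfies [D1, B] = (r / 4) B, so it must act on the normal
    by r / 4. As Ric is - tau there, c + 2 (r / 4) = - tau.\<close>
  define c where "c = - ?t - r / 2"
  define D1 where "D1 = (1/2) *\<^sub>R ((1/2) *\<^sub>R mom B - c *\<^sub>R (1 - ?\<Pi>))"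
  have tpo: "tp ?\<Pi> = ?\<Pi>" by (rule tp_eqI) (simp add: inner_commute mult.commute)
  note s = sp[unfolded soliton_pair_def] and f = soliton_pair_facts[OF sp]
  have ad: "adm e0 B" "adm e0 K" using s by auto
  have "cm (1 - ?\<Pi>) B = 0" "cm (1 - ?\<Pi>) K = 0"
    by (simp_all add: cm_def algebra_simps outer_e0_adm[OF ad(1)] outer_e0_adm[OF ad(2)])
  then have D: "cm D1 B = (r / 4) *\<^sub>R B" "cm D1 K = 0"
    using s by (simp_all add: D1_def cm_linear f)
  show ?thesis
  proof (rule ricci_soliton_of_derivation[OF assms(1-3) fr f(2,1) ad])
    show "tp D1 = D1" by (simp add: D1_def tpo)
    show "adm e0 D1" unfolding D1_def using ad adm_complement by blast
    show "cm D1 B = (r / 4) *\<^sub>R B" "cm D1 K = 0" by fact+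
    have "ric (B + K) = (1/2) *\<^sub>R mom B - ?t *\<^sub>R ?\<Pi>" unfolding ric_def f(8,9) by simp
    also have "\<dots> = c *\<^sub>R 1 + 2 *\<^sub>R (D1 + (r / 4) *\<^sub>R ?\<Pi>)"
    proof -
      have "c *\<^sub>R ?\<Pi> + (?t *\<^sub>R ?\<Pi> + (r / 2) *\<^sub>R ?\<Pi>) = 0"
        by (simp add: scaleR_add_left[symmetric] c_def)
      then show ?thesis by (simp add: D1_def algebra_simps)
    qed
    finally show "ric (B + K) = c *\<^sub>R 1 + 2 *\<^sub>R (D1 + (r / 4) *\<^sub>R ?\<Pi>)" .
  qed
qed

section \<open>Local and global maxima\<close>

lemma global_imp_local_maximum: "global_maximum_on C F g \<Longrightarrow> local_maximum_on C F g"
  by (auto simp: global_maximum_on_def local_maximum_on_def eventually_at_filter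
      intro!: always_eventually)

lemma local_max_cases:
  assumes fr: "frame br N g P Q A" and lm: "local_maximum_on (nonflat_metrics br) (ricci_pinching br) g"
  obtains "mom A = 0" | B K r where "A = B + K" "soliton_pair e0 B K r"
proof (cases "mom A = 0")
  case False
  have "sy A \<noteq> 0" using lm frame_nonflat[OF fr] by (simp add: local_maximum_on_def)
  from local_max_structure[OF frame_facts(7)[OF fr] this local_max_imp_direction[OF fr lm] False]
  obtain B K r where "A = B + K" "tp K = - K" "cm B K = 0" "cm (tp B) K = 0" "r > 0"
    "cm (mom B) B = r *\<^sub>R B" "adm e0 B" "adm e0 K" "B \<noteq> 0" by metis
  then show thesis using that(2) by (simp add: soliton_pair_def)
qed

text \<open>The flow of \<open>mom B\<close> moves the metric to one with matrix t B + K. F depends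
  only on |mom B| / |B|^2, which is invariant under scaling of B, while local maximality is lost for
  suitable t.\<close>

lemma soliton_pair_deformation:
  assumes lie: "lie_algebra br" and ideal: "codim1_abelian_ideal br N" and X: "X \<notin> N"
    and fr: "frame br N g P Q (B + K)" and sp: "soliton_pair e0 B K r" and K: "K \<noteq> 0"
  obtains g' where "g' \<in> nonflat_metrics br" "ricci_soliton br N X g'"
    "ricci_pinching br g' = ricci_pinching br g"
    "\<not> local_maximum_on (nonflat_metrics br) (ricci_pinching br) g'"
proof -
  obtain s where s: "\<not> local_max_direction e0 (exp (r * s) *\<^sub>R B + K)"
    using soliton_pair_not_local_max[OF sp K] by blast
  define t where "t = exp (r * s)"
  have t: "t > 0" by (simp add: t_def)
  let ?h = "expo (mom B) s" and ?k = "expo (mom B) (- s)"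
  have "adm e0 (mom B)" using sp by (auto simp: soliton_pair_def)
  then have he: "app ?h e0 = e0" by (rule expo_fixes)
  have "app (tp ?h) e0 = e0" by (simp add: tp_expo he)
  from frame_transform[OF fr expo_inverse he this]
  obtain g' P' Q' where fr': "frame br N g' P' Q' (t *\<^sub>R B + K)"
    by (metis orbit_mom_soliton_pair[OF sp] orbit_def t_def)
  have sp': "soliton_pair e0 (t *\<^sub>R B) K (t\<^sup>2 * r)" by (rule soliton_pair_scale[OF sp t])
  show thesis
  proof
    show "g' \<in> nonflat_metrics br" using soliton_pair_facts(13)[OF sp'] frame_nonflat[OF fr'] by blast
    show "ricci_soliton br N X g'" by (rule ricci_soliton_pair[OF lie ideal X fr' sp'])
    show "ricci_pinching br g' = ricci_pinching br g"
      unfolding ricci_pinching_frame[OF fr'] ricci_pinching_frame[OF fr]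
        soliton_pair_facts(14)[OF sp] soliton_pair_facts(14)[OF sp']
      using t by (simp add: mom_scaleR power_mult_distrib)
    show "\<not> local_maximum_on (nonflat_metrics br) (ricci_pinching br) g'"
      using local_max_imp_direction[OF fr'] s by (auto simp: t_def)
  qed
qed

context
  fixes br :: "'a::euclidean_space \<Rightarrow> 'a \<Rightarrow> 'a" and N :: "'a set" and X :: 'a
  assumes lie: "lie_algebra br" and ideal: "codim1_abelian_ideal br N" and X: "X \<notin> N"
begin

text \<open>The alternative in the second claim is the common source of (ii) and (iii): a local
  maximum that is not a solvsoliton has K \<noteq> 0 and can be deformed.\<close>

lemma local_maximum_structure:
  assumes lm: "local_maximum_on (nonflat_metrics br) (ricci_pinching br) g"
  shows "ricci_soliton br N X g"
    and "solvsoliton br g \<or> (\<exists>g'\<in>nonflat_metrics br. ricci_soliton br N X g' \<and>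
      ricci_pinching br g' = ricci_pinching br g \<and>
      \<not> local_maximum_on (nonflat_metrics br) (ricci_pinching br) g')"
proof -
  have "inner_product g" using lm by (simp add: local_maximum_on_def nonflat_metrics_def)
  then obtain P Q A where fr: "frame br N g P Q A" using frame_exists[OF lie ideal] by blast
  have "ricci_soliton br N X g \<and> (solvsoliton br g \<or> (\<exists>g'\<in>nonflat_metrics br. ricci_soliton br N X g' \<and>
      ricci_pinching br g' = ricci_pinching br g \<and>
      \<not> local_maximum_on (nonflat_metrics br) (ricci_pinching br) g'))"
  proof (rule local_max_cases[OF fr lm])
    assume "mom A = 0"
    then show ?thesis
      using ricci_soliton_normal[OF lie ideal X fr] solvsoliton_frame[OF fr] by blast
  next
    fix B K r assume A: "A = B + K" and sp: "soliton_pair e0 B K r"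
    have fr': "frame br N g P Q (B + K)" using fr A by simp
    show ?thesis
    proof (cases "K = 0")
      case True
      then have "solvsoliton br g"
        using sp solvsoliton_frame[OF fr] A by (auto simp: soliton_pair_def)
      then show ?thesis using ricci_soliton_pair[OF lie ideal X fr' sp] by blast
    next
      case False
      from soliton_pair_deformation[OF lie ideal X fr' sp this] show ?thesis
        using ricci_soliton_pair[OF lie ideal X fr' sp] by metis
    qed
  qed
  then show "ricci_soliton br N X g"
    and "solvsoliton br g \<or> (\<exists>g'\<in>nonflat_metrics br. ricci_soliton br N X g' \<and>
      ricci_pinching br g' = ricci_pinching br g \<and>
      \<not> local_maximum_on (nonflat_metrics br) (ricci_pinching br) g')"
    by blast+
qed

text \<open>If a global maximum were not a solvsoliton, its deformation would have the same value
  and be a global maximum too, although it is not even a local one.\<close>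

lemma global_maximum_iff_solvsoliton:
  assumes g: "g \<in> nonflat_metrics br"
  shows "global_maximum_on (nonflat_metrics br) (ricci_pinching br) g \<longleftrightarrow> solvsoliton br g"
proof
  assume gm: "global_maximum_on (nonflat_metrics br) (ricci_pinching br) g"
  show "solvsoliton br g"
  proof (rule ccontr)
    assume "\<not> solvsoliton br g"
    with local_maximum_structure(2)[OF global_imp_local_maximum[OF gm]] obtain g' where
      g': "g' \<in> nonflat_metrics br" "ricci_pinching br g' = ricci_pinching br g"
      "\<not> local_maximum_on (nonflat_metrics br) (ricci_pinching br) g'" by blast
    then have "global_maximum_on (nonflat_metrics br) (ricci_pinching br) g'"
      using gm by (simp add: global_maximum_on_def)
    with g'(3) global_imp_local_maximum show False by blast
  qed
next
  assume "solvsoliton br g"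
  then show "global_maximum_on (nonflat_metrics br) (ricci_pinching br) g"
    unfolding global_maximum_on_def using solvsoliton_pinching_max[OF lie ideal g] g by blast
qed

text \<open>Either \<open>g\<close> itself is not a local maximum, or it is one and its deformation
  serves.\<close>

lemma ricci_soliton_not_local_maximum:
  assumes "g \<in> nonflat_metrics br" "ricci_soliton br N X g" "\<not> solvsoliton br g"
  shows "\<exists>g\<in>nonflat_metrics br. ricci_soliton br N X g \<and>
         \<not> local_maximum_on (nonflat_metrics br) (ricci_pinching br) g"
  using local_maximum_structure(2)[of g] assms by blast

end

section \<open>Normal and nilsoliton inner products\<close>

text \<open>
  \<open>B\<close> is the adjoint of \<open>A\<close> with respect to \<open>g\<close>, and the last condition reads \<open>[[A, B], A] = c A\<close>; it means
  that \<open>A\<close> is normal for \<open>c = 0\<close> and a nilsoliton for \<open>c > 0\<close>.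
\<close>

definition soliton_product :: "('a::euclidean_space \<Rightarrow> 'a) \<Rightarrow> real \<Rightarrow> 'a set \<Rightarrow> bool" where
  "soliton_product A c V \<longleftrightarrow> subspace V \<and> (\<forall>v\<in>V. A v \<in> V) \<and>
     (\<exists>(g :: 'a \<Rightarrow> 'a \<Rightarrow> real) B. bilinear g \<and> (\<forall>x y. g x y = g y x) \<and> (\<forall>x\<in>V. x \<noteq> 0 \<longrightarrow> g x x > 0) \<and>
        linear B \<and> (\<forall>v\<in>V. B v \<in> V) \<and> (\<forall>x\<in>V. \<forall>y\<in>V. g (A x) y = g x (B y)) \<and>
        (\<forall>v\<in>V. 2 *\<^sub>R A (B (A v)) - B (A (A v)) - A (A (B v)) = c *\<^sub>R A v))"

lemma soliton_productI:
  fixes g :: "'a::euclidean_space \<Rightarrow> 'a \<Rightarrow> real"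
  assumes "subspace V" "\<And>v. v \<in> V \<Longrightarrow> A v \<in> V" "bilinear g" "\<And>x y. g x y = g y x"
    "\<And>x. x \<in> V \<Longrightarrow> x \<noteq> 0 \<Longrightarrow> g x x > 0" "linear B" "\<And>v. v \<in> V \<Longrightarrow> B v \<in> V"
    "\<And>x y. x \<in> V \<Longrightarrow> y \<in> V \<Longrightarrow> g (A x) y = g x (B y)"
    "\<And>v. v \<in> V \<Longrightarrow> 2 *\<^sub>R A (B (A v)) - B (A (A v)) - A (A (B v)) = c *\<^sub>R A v"
  shows "soliton_product A c V"
  unfolding soliton_product_def using assms by blast

lemma soliton_product_cong:
  fixes A :: "'a::euclidean_space \<Rightarrow> 'a"
  assumes product: "soliton_product A c V" and eq: "\<And>v. v \<in> V \<Longrightarrow> A' v = A v"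
  shows "soliton_product A' c V"
proof -
  obtain g :: "'a \<Rightarrow> 'a \<Rightarrow> real" and B where V: "subspace V" "\<And>v. v \<in> V \<Longrightarrow> A v \<in> V"
    and g: "bilinear g" "\<And>x y. g x y = g y x" "\<And>x. x \<in> V \<Longrightarrow> x \<noteq> 0 \<Longrightarrow> g x x > 0"
    and B: "linear B" "\<And>v. v \<in> V \<Longrightarrow> B v \<in> V"
    and gA: "\<And>x y. x \<in> V \<Longrightarrow> y \<in> V \<Longrightarrow> g (A x) y = g x (B y)"
    and e: "\<And>v. v \<in> V \<Longrightarrow> 2 *\<^sub>R A (B (A v)) - B (A (A v)) - A (A (B v)) = c *\<^sub>R A v"
    using product unfolding soliton_product_def by blast
  show ?thesis
  proof (rule soliton_productI[OF V(1) _ g B])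
    show "A' v \<in> V" if "v \<in> V" for v using V(2) eq that by simp
    show "g (A' x) y = g x (B y)" if "x \<in> V" "y \<in> V" for x y using gA eq that by simp
    show "2 *\<^sub>R A' (B (A' v)) - B (A' (A' v)) - A' (A' (B v)) = c *\<^sub>R A' v" if "v \<in> V" for v
      using e[OF that] by (simp add: eq V(2) B(2) that)
  qed
qed

lemma soliton_product_sum:
  fixes A :: "'a::euclidean_space \<Rightarrow> 'a"
  assumes A: "linear A" and U: "soliton_product A c U" and W: "soliton_product A c W" and UW: "U \<inter> W = {0}"
  shows "soliton_product A c {u + w | u w. u \<in> U \<and> w \<in> W}"
proof -
  obtain g :: "'a \<Rightarrow> 'a \<Rightarrow> real" and B where sU: "subspace U" and AU: "\<And>v. v \<in> U \<Longrightarrow> A v \<in> U" and bl: "bilinear g" and sg: "\<And>x y. g x y = g y x"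
    and pg: "\<And>x. x \<in> U \<Longrightarrow> x \<noteq> 0 \<Longrightarrow> g x x > 0" and lB: "linear B" and BU: "\<And>v. v \<in> U \<Longrightarrow> B v \<in> U"
    and gA: "\<And>x y. x \<in> U \<Longrightarrow> y \<in> U \<Longrightarrow> g (A x) y = g x (B y)"
    and eU: "\<And>v. v \<in> U \<Longrightarrow> 2 *\<^sub>R A (B (A v)) - B (A (A v)) - A (A (B v)) = c *\<^sub>R A v"
    using U unfolding soliton_product_def by blast
  obtain g' :: "'a \<Rightarrow> 'a \<Rightarrow> real" and B' where sW: "subspace W" and AW: "\<And>v. v \<in> W \<Longrightarrow> A v \<in> W" and bl': "bilinear g'" and sg': "\<And>x y. g' x y = g' y x"
    and pg': "\<And>x. x \<in> W \<Longrightarrow> x \<noteq> 0 \<Longrightarrow> g' x x > 0" and lB': "linear B'" and BW: "\<And>v. v \<in> W \<Longrightarrow> B' v \<in> W"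
    and gA': "\<And>x y. x \<in> W \<Longrightarrow> y \<in> W \<Longrightarrow> g' (A x) y = g' x (B' y)"
    and eW: "\<And>v. v \<in> W \<Longrightarrow> 2 *\<^sub>R A (B' (A v)) - B' (A (A v)) - A (A (B' v)) = c *\<^sub>R A v"
    using W unfolding soliton_product_def by blast
  \<comment> \<open>A left inverse of the addition map yields both projections as linear maps of the
    whole space, so that G and C can be defined everywhere.\<close>
  let ?f = "\<lambda>p::'a \<times> 'a. fst p + snd p"
  have lf: "linear ?f" by (rule linearI) (auto simp: algebra_simps)
  have "inj_on ?f (span (U \<times> W))"
  proof (rule inj_onI)
    fix p q assume "p \<in> span (U \<times> W)" "q \<in> span (U \<times> W)" and e: "?f p = ?f q"
    then have "p \<in> U \<times> W" "q \<in> U \<times> W"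
      using subspace_Times[OF sU sW] by (simp_all add: span_eq_iff[THEN iffD2])
    then have "fst p - fst q \<in> U" "snd q - snd p \<in> W"
      using sU sW by (auto simp: subspace_diff)
    moreover have "fst p - fst q = snd q - snd p" using e by (simp add: algebra_simps)
    ultimately have "fst p - fst q \<in> U \<inter> W" by simp
    then have "fst p = fst q" using UW by simp
    then show "p = q" using e by (simp add: prod_eq_iff)
  qed
  then obtain k where k: "linear k" "\<forall>x\<in>span (U \<times> W). k (?f x) = x"
    using linear_inj_on_left_inverse[OF lf] by blast
  define p where "p x = fst (k x)" for x
  define q where "q x = snd (k x)" for x
  have lp: "linear p" "linear q"
    unfolding p_def q_def using linear_compose[OF k(1) linear_fst] linear_compose[OF k(1) linear_snd]
    by (simp_all add: o_def)
  have pq: "p (u + w) = u" "q (u + w) = w" if "u \<in> U" "w \<in> W" for u w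
    using k(2) that span_base[of "(u, w)" "U \<times> W"] by (auto simp: p_def q_def)
  define G where "G x y = g (p x) (p y) + g' (q x) (q y)" for x y
  define C where "C x = B (p x) + B' (q x)" for x
  have AL: "A (u + w) = A u + A w" for u w using A by (rule linear_add)
  have Cuw: "C (u + w) = B u + B' w" if "u \<in> U" "w \<in> W" for u w
    by (simp add: C_def pq that)
  show ?thesis
  proof (rule soliton_productI[where g = G and B = C])
    show "subspace {u + w | u w. u \<in> U \<and> w \<in> W}" by (rule subspace_sums[OF sU sW])
    show "bilinear G"
      unfolding bilinear_def
    proof (intro conjI allI linearI)
    qed (use bl bl' in \<open>simp_all add: G_def linear_add[OF lp(1)] linear_add[OF lp(2)] linear_scale[OF lp(1)] linear_scale[OF lp(2)]
          bilinear_ladd bilinear_radd bilinear_lmul bilinear_rmul algebra_simps\<close>)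
    show "G x y = G y x" for x y by (simp add: G_def sg[of "p x"] sg'[of "q x"])
    show "linear C"
      unfolding C_def by (intro linear_compose_add linear_compose[OF lp(1) lB, unfolded o_def]
          linear_compose[OF lp(2) lB', unfolded o_def])
  next
    fix x assume "x \<in> {u + w | u w. u \<in> U \<and> w \<in> W}"
    then obtain u w where x: "x = u + w" "u \<in> U" "w \<in> W" by blast
    show "A x \<in> {u + w | u w. u \<in> U \<and> w \<in> W}" using x AU AW by (auto simp: AL)
    show "C x \<in> {u + w | u w. u \<in> U \<and> w \<in> W}" using x BU BW by (auto simp: Cuw)
    show "G x x > 0" if "x \<noteq> 0"
    proof -
      have "g 0 0 = 0" "g' 0 0 = 0" using bl bl' by (simp_all add: bilinear_lzero)
      then have "g u u \<ge> 0" "g' w w \<ge> 0" using pg[of u] pg'[of w] x by force+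
      moreover have "u \<noteq> 0 \<or> w \<noteq> 0" using x that by auto
      ultimately show ?thesis using pg[of u] pg'[of w] x by (auto simp: G_def pq intro: add_pos_nonneg add_nonneg_pos)
    qed
    have Ax: "A u \<in> U" "A w \<in> W" "B u \<in> U" "B' w \<in> W" "A (A u) \<in> U" "A (A w) \<in> W"
      using x AU AW BU BW by auto
    have "2 *\<^sub>R A (C (A x)) - C (A (A x)) - A (A (C x)) =
      (2 *\<^sub>R A (B (A u)) - B (A (A u)) - A (A (B u))) + (2 *\<^sub>R A (B' (A w)) - B' (A (A w)) - A (A (B' w)))"
      unfolding x(1) AL Cuw[OF x(2,3)] Cuw[OF Ax(1,2)] Cuw[OF Ax(5,6)] by (simp add: AL algebra_simps)
    then show "2 *\<^sub>R A (C (A x)) - C (A (A x)) - A (A (C x)) = c *\<^sub>R A x"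
      by (simp add: eU[OF x(2)] eW[OF x(3)] x(1) AL scaleR_add_right)
    fix y assume "y \<in> {u + w | u w. u \<in> U \<and> w \<in> W}"
    then obtain u' w' where y: "y = u' + w'" "u' \<in> U" "w' \<in> W" by blast
    show "G (A x) y = G x (C y)"
      using x y AU AW BU BW gA gA' by (simp add: G_def AL Cuw pq)
  qed
qed

lemma soliton_product_zero: "linear A \<Longrightarrow> soliton_product A c {0}"
  by (rule soliton_productI[where g = "\<lambda>x y. x \<bullet> y" and B = "\<lambda>x. 0"])
    (auto simp: linear_0 linear_zero subspace_single_0 inner_commute
      inner_product_inner[unfolded inner_product_def])

lemma linear_funpow: "linear A \<Longrightarrow> linear (A ^^ i)" for A :: "'a::real_vector \<Rightarrow> 'a"
  by (induction i) (auto intro: linear_compose linear_id)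

text \<open>
  The weights of the inner product and the adjoint \<open>B\<close> below come from the irreducible representation
  of sl(2) in which \<open>A\<close> is the raising operator.
\<close>

lemma soliton_product_chain:
  fixes A :: "'a::euclidean_space \<Rightarrow> 'a"
  assumes A: "linear A" and f: "linear f" and k: "k > 0" "(A ^^ k) v = 0"
    and d: "\<And>j. j < k \<Longrightarrow> f ((A ^^ j) v) = (if j = k - 1 then 1 else 0 :: real)"
  defines "a \<equiv> \<lambda>i x. f ((A ^^ (k - 1 - i)) x)"
  shows "soliton_product A 2 (span ((\<lambda>i. (A ^^ i) v) ` {..<k}))"
    and "x \<in> span ((\<lambda>i. (A ^^ i) v) ` {..<k}) \<Longrightarrow> x = (\<Sum>i<k. a i x *\<^sub>R (A ^^ i) v)"
    and "(\<And>i. i < k \<Longrightarrow> a i (y - (\<Sum>i<k. a i y *\<^sub>R (A ^^ i) v)) = 0)"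
proof -
  let ?e = "\<lambda>i. (A ^^ i) v"
  let ?U = "span (?e ` {..<k})"
  have la: "linear (a i)" for i
    unfolding a_def using linear_compose[OF linear_funpow[OF A] f] by (simp add: o_def)
  have z: "(A ^^ i) v = 0" if "i \<ge> k" for i
  proof -
    have "(A ^^ i) v = (A ^^ (i - k)) ((A ^^ k) v)"
      using that by (simp add: funpow_add[symmetric, unfolded o_def fun_eq_iff] flip: comp_apply[of "A ^^ _" "A ^^ _"] funpow_add)
    then show ?thesis using k(2) linear_0[OF linear_funpow[OF A]] by simp
  qed
  \<comment> \<open>A^(k - 1 - i) moves the coordinate i to the top of the chain, the only place
    where \<open>f\<close> does not vanish on it.\<close>
  have ae: "a i (?e j) = (if i = j then 1 else 0)" if "i < k" "j < k" for i j
  proof -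
    have "a i (?e j) = f ((A ^^ (k - 1 - i + j)) v)" by (simp add: a_def funpow_add)
    also have "\<dots> = (if i = j then 1 else 0)"
    proof (cases "k - 1 - i + j < k")
      case True
      then show ?thesis using d[OF True] that by auto
    next
      case False
      then show ?thesis using z[of "k - 1 - i + j"] that linear_0[OF f] by auto
    qed
    finally show ?thesis .
  qed
  have aA: "a (Suc i) (A x) = a i x" if "Suc i < k" for i x
  proof -
    have "k - 1 - i = Suc (k - 1 - Suc i)" using that by simp
    then show ?thesis by (simp add: a_def funpow_swap1)
  qed
  have rep: "x = (\<Sum>i<k. a i x *\<^sub>R ?e i)" if "x \<in> ?U" for x
    using that
  proof (rule span_induct)
    show "subspace {x. x = (\<Sum>i<k. a i x *\<^sub>R ?e i)}"
    proof (rule subspaceI)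
      show "0 \<in> {x. x = (\<Sum>i<k. a i x *\<^sub>R ?e i)}" by (simp add: linear_0[OF la])
      show "x + y \<in> {x. x = (\<Sum>i<k. a i x *\<^sub>R ?e i)}" if "x \<in> {x. x = (\<Sum>i<k. a i x *\<^sub>R ?e i)}" "y \<in> {x. x = (\<Sum>i<k. a i x *\<^sub>R ?e i)}" for x y
        using that by (simp add: linear_add[OF la] scaleR_add_left sum.distrib)
      show "c *\<^sub>R x \<in> {x. x = (\<Sum>i<k. a i x *\<^sub>R ?e i)}" if "x \<in> {x. x = (\<Sum>i<k. a i x *\<^sub>R ?e i)}" for c x
      proof -
        have "(\<Sum>i<k. a i (c *\<^sub>R x) *\<^sub>R ?e i) = c *\<^sub>R (\<Sum>i<k. a i x *\<^sub>R ?e i)"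
          by (simp add: linear_scale[OF la] scaleR_sum_right)
        then show ?thesis using that by simp
      qed
    qed
    fix x assume "x \<in> ?e ` {..<k}"
    then obtain j where j: "j < k" "x = ?e j" by blast
    have "(\<Sum>i<k. a i x *\<^sub>R ?e i) = (\<Sum>i<k. if i = j then ?e j else 0)"
      by (rule sum.cong) (use ae j in auto)
    then show "x = (\<Sum>i<k. a i x *\<^sub>R ?e i)" using j by simp
  qed
  then show "x \<in> ?U \<Longrightarrow> x = (\<Sum>i<k. a i x *\<^sub>R ?e i)" .
  have asum: "a j (\<Sum>i<k. u i *\<^sub>R ?e i) = u j" if "j < k" for u j
  proof -
    have "a j (\<Sum>i<k. u i *\<^sub>R ?e i) = (\<Sum>i<k. u i * a j (?e i))"
      by (simp add: linear_sum[OF la] linear_scale[OF la])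
    also have "\<dots> = (\<Sum>i<k. if i = j then u j else 0)"
      by (rule sum.cong) (use ae that in auto)
    finally show ?thesis using that by simp
  qed
  then show "a i (y - (\<Sum>i<k. a i y *\<^sub>R ?e i)) = 0" if "i < k" for i
    using that by (simp add: linear_diff[OF la])
  have eqU: "x = y" if "x \<in> ?U" "y \<in> ?U" "\<And>j. j < k \<Longrightarrow> a j x = a j y" for x y
  proof -
    have "(\<Sum>i<k. a i x *\<^sub>R ?e i) = (\<Sum>i<k. a i y *\<^sub>R ?e i)" by (rule sum.cong) (use that(3) in auto)
    then show ?thesis using rep that(1,2) by metis
  qed
  have AU: "A x \<in> ?U" if "x \<in> ?U" for x
    using that
  proof (rule span_induct)
    show "subspace {x. A x \<in> ?U}" using linear_subspace_vimage[OF A subspace_span] by (simp add: vimage_def)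
    fix x assume "x \<in> ?e ` {..<k}"
    then obtain j where j: "j < k" "x = ?e j" by blast
    show "A x \<in> ?U"
    proof (cases "Suc j < k")
      case True
      then show ?thesis using j by (auto intro!: span_base image_eqI[of _ _ "Suc j"])
    next
      case False
      then have "A x = 0" using z[of "Suc j"] j by simp
      then show ?thesis by (simp add: span_zero)
    qed
  qed
  have a0: "a 0 (A x) = 0" if "x \<in> ?U" for x
    using that
  proof (rule span_induct)
    show "subspace {x. a 0 (A x) = 0}"
      by (rule subspaceI) (simp_all add: linear_0[OF A] linear_0[OF la] linear_add[OF A] linear_add[OF la] linear_scale[OF A] linear_scale[OF la])
    fix x assume "x \<in> ?e ` {..<k}"
    then obtain j where j: "j < k" "x = ?e j" by blast
    show "a 0 (A x) = 0"
    proof (cases "Suc j < k")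
      case True
      then show ?thesis using ae[of 0 "Suc j"] j k by simp
    next
      case False
      then have "A x = 0" using z[of "Suc j"] j by simp
      then show ?thesis by (simp add: linear_0[OF la])
    qed
  qed
  \<comment> \<open>The coefficients i (k - i) of the representation. Their second difference is -2,
    which gives the constant 2, and they vanish at 0 and k, which settles both ends of the chain.
    The products \<open>n\<close> are the squared lengths that make B the adjoint of A.\<close>
  define m where "m i = real i * (real k - real i)" for i
  define n where "n i = (\<Prod>j<i. m (Suc j))" for i
  have mpos: "m i > 0" if "0 < i" "i < k" for i using that by (simp add: m_def)
  have npos: "n i > 0" if "i < k" for i
    unfolding n_def using that by (intro prod_pos) (auto intro: mpos)
  define g where "g x y = (\<Sum>i<k. n i * (a i x * a i y))" for x y
  define B where "B x = (\<Sum>i<k. (if Suc i < k then m (Suc i) * a (Suc i) x else 0) *\<^sub>R ?e i)" for x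
  have aB: "a i (B x) = (if Suc i < k then m (Suc i) * a (Suc i) x else 0)" if "i < k" for i x
    unfolding B_def by (rule asum[OF that])
  have BU: "B x \<in> ?U" for x unfolding B_def by (intro span_sum span_scale span_base) auto
  have lB: "linear B"
    by (rule linearI) (auto simp: B_def linear_add[OF la] linear_scale[OF la] sum.distrib[symmetric]
        scaleR_sum_right scaleR_add_left[symmetric] distrib_left intro!: sum.cong)
  show "soliton_product A 2 ?U"
  proof (rule soliton_productI[where g = g and B = B])
    show "bilinear g"
      unfolding bilinear_def
      by (intro conjI allI linearI)
        (simp_all add: g_def linear_add[OF la] linear_scale[OF la] sum.distrib[symmetric] sum_distrib_left algebra_simps)
    show "g x y = g y x" for x y by (simp add: g_def mult.commute)
    show "g x x > 0" if x: "x \<in> ?U" "x \<noteq> 0" for x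
    proof -
      obtain j where j: "j < k" "a j x \<noteq> 0"
        using eqU[of x 0] x by (auto simp: span_zero linear_0[OF la])
      show ?thesis
        unfolding g_def
      proof (rule sum_pos2[of _ j])
        show "0 < n j * (a j x * a j x)" using j npos by (auto simp: zero_less_mult_iff linorder_neq_iff)
        show "0 \<le> n i * (a i x * a i x)" if "i \<in> {..<k}" for i
          using npos[of i] that by (simp add: less_imp_le)
      qed (use j in auto)
    qed
    show "g (A x) y = g x (B y)" if "x \<in> ?U" "y \<in> ?U" for x y
    proof -
      obtain l where l: "k = Suc l" using k(1) by (cases k) auto
      have "g (A x) y = (\<Sum>i<l. n (Suc i) * (a (Suc i) (A x) * a (Suc i) y))"
        unfolding g_def l sum.lessThan_Suc_shift using a0[OF that(1)] by (simp add: l)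
      also have "\<dots> = (\<Sum>i<l. n i * (a i x * a i (B y)))"
      proof (rule sum.cong[OF refl])
        fix i assume "i \<in> {..<l}"
        then have i: "Suc i < k" using l by simp
        have "n (Suc i) = n i * m (Suc i)" by (simp add: n_def)
        then show "n (Suc i) * (a (Suc i) (A x) * a (Suc i) y) = n i * (a i x * a i (B y))"
          using aA[OF i] aB[of i y] i by simp
      qed
      also have "\<dots> = g x (B y)"
        unfolding g_def l sum.lessThan_Suc using aB[of l y] l by simp
      finally show ?thesis .
    qed
    show "2 *\<^sub>R A (B (A x)) - B (A (A x)) - A (A (B x)) = 2 *\<^sub>R A x" if x: "x \<in> ?U" for x
    proof (rule eqU)
      have U: "A (B (A x)) \<in> ?U" "B (A (A x)) \<in> ?U" "A (A (B x)) \<in> ?U" "A x \<in> ?U"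
        using AU BU x by blast+
      then show "2 *\<^sub>R A (B (A x)) - B (A (A x)) - A (A (B x)) \<in> ?U" "2 *\<^sub>R A x \<in> ?U"
        by (auto intro!: span_diff span_scale)
      fix j assume j: "j < k"
      have as: "a j (2 *\<^sub>R u - w - t) = 2 * a j u - a j w - a j t" for u w t
        by (simp add: linear_diff[OF la] linear_scale[OF la])
      show "a j (2 *\<^sub>R A (B (A x)) - B (A (A x)) - A (A (B x))) = a j (2 *\<^sub>R A x)"
      proof (cases j)
        case 0
        then show ?thesis unfolding as using a0 AU BU x aB[of 0 "A (A x)"] aA[of 0 "A x"] k j
          by (auto simp: linear_scale[OF la])
      next
        case (Suc i)
        have Si: "Suc i < k" using j Suc by simp
        have 1: "a j (A (B (A x))) = m (Suc i) * a i x"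
          using aA[OF Si] aB[of i "A x"] Si by (simp add: Suc)
        have 2: "a j (B (A (A x))) = m (Suc j) * a i x"
        proof (cases "Suc j < k")
          case True
          then show ?thesis using aB[OF j] aA[OF True] aA[OF Si] by (simp add: Suc)
        next
          case False
          then have "real k = real (Suc j)" using j by simp
          then show ?thesis using aB[OF j] False by (simp add: m_def)
        qed
        have 3: "a j (A (A (B x))) = m i * a i x"
        proof (cases i)
          case 0
          then show ?thesis using aA[OF Si, of "A (B x)"] a0[OF BU] by (simp add: Suc m_def)
        next
          case (Suc l)
          then have "Suc l < k" using Si by simp
          then show ?thesis using aA[OF Si, of "A (B x)"] aA[of l "B x"] aB[of l x] by (simp add: Suc \<open>j = Suc i\<close>)
        qed
        have "2 * m (Suc i) - m (Suc j) - m i = 2" by (simp add: m_def Suc algebra_simps)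
        moreover have "a j (2 *\<^sub>R A x) = 2 * a i x" using aA[OF Si] by (simp add: Suc linear_scale[OF la])
        ultimately show ?thesis unfolding as 1 2 3 by (metis left_diff_distrib mult.assoc)
      qed
    qed
  qed (use AU BU lB in auto)
qed

text \<open>A longest chain is split off. The coordinate functionals satisfy a (i + 1) A = a i, and
  a 0 A = f A^k vanishes on V, so their common kernel in V is an invariant complement, to which
  induction applies.\<close>

lemma soliton_product_nilpotent:
  fixes A :: "'a::euclidean_space \<Rightarrow> 'a"
  assumes A: "linear A" and "subspace V" "\<And>v. v \<in> V \<Longrightarrow> A v \<in> V" "nilpotent_on V A"
  shows "soliton_product A 2 V"
  using assms(2-4)
proof (induction "dim V" arbitrary: V rule: less_induct)
  case less
  have AV: "(A ^^ i) v \<in> V" if "v \<in> V" for i v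
    using that less.prems(2) by (induction i) auto
  note lA = linear_funpow[OF A]
  show ?case
  proof (cases "V = {0}")
    case True then show ?thesis using soliton_product_zero[OF A] by simp
  next
    case False
    obtain K where "\<forall>v\<in>V. (A ^^ K) v = 0" using less.prems(3) by (auto simp: nilpotent_on_def)
    define k where "k = (LEAST k. \<forall>v\<in>V. (A ^^ k) v = 0)"
    have k: "\<forall>v\<in>V. (A ^^ k) v = 0" unfolding k_def by (rule LeastI) fact
    have k0: "k > 0"
    proof (rule ccontr)
      assume "\<not> k > 0"
      then have "V \<subseteq> {0}" using k by auto
      then show False using False subspace_0[OF less.prems(1)] by blast
    qed
    then have "\<not> (\<forall>v\<in>V. (A ^^ (k - 1)) v = 0)"
      unfolding k_def by (intro not_less_Least) simp
    then obtain v0 where v0: "v0 \<in> V" "(A ^^ (k - 1)) v0 \<noteq> 0" by blast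
    let ?b = "(A ^^ (k - 1)) v0"
    define f where "f x = (x \<bullet> ?b) / (?b \<bullet> ?b)" for x
    have lf: "linear f" by (rule linearI) (auto simp: f_def inner_simps add_divide_distrib)
    have fb: "f ?b = 1" using v0 by (simp add: f_def)
    have hi: "(A ^^ i) v = 0" if "v \<in> V" "i \<ge> k" for v i
    proof -
      have "(A ^^ i) v = (A ^^ (i - k)) ((A ^^ k) v)"
        using that(2) by (metis comp_apply funpow_add le_add_diff_inverse2)
      then show ?thesis using k that(1) linear_0[OF lA] by simp
    qed
    \<comment> \<open>correct \<open>v0\<close> by higher elements of its chain, from the top downwards\<close>
    have "\<exists>v\<in>V. f ((A ^^ (k - 1)) v) = 1 \<and> (\<forall>i. k - 1 - j \<le> i \<and> i < k - 1 \<longrightarrow> f ((A ^^ i) v) = 0)"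
      if "j \<le> k - 1" for j
      using that
    proof (induction j)
      case 0
      then show ?case using v0 fb by auto
    next
      case (Suc j)
      then obtain v where v: "v \<in> V" "f ((A ^^ (k - 1)) v) = 1"
        "\<And>i. k - 1 - j \<le> i \<Longrightarrow> i < k - 1 \<Longrightarrow> f ((A ^^ i) v) = 0" by auto
      define i0 where "i0 = k - 1 - Suc j"
      have i0: "i0 + Suc j = k - 1" using Suc.prems by (simp add: i0_def)
      define v' where "v' = v - f ((A ^^ i0) v) *\<^sub>R (A ^^ Suc j) v"
      have Av': "f ((A ^^ i) v') = f ((A ^^ i) v) - f ((A ^^ i0) v) * f ((A ^^ (i + Suc j)) v)" for i
      proof -
        have "(A ^^ i) v' = (A ^^ i) v - f ((A ^^ i0) v) *\<^sub>R (A ^^ (i + Suc j)) v"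
          unfolding v'_def linear_diff[OF lA] linear_scale[OF lA] by (simp only: funpow_add comp_apply)
        then show ?thesis by (simp only: linear_diff[OF lf] linear_scale[OF lf] real_scaleR_def)
      qed
      have "v' \<in> V" unfolding v'_def using v(1) AV less.prems(1) by (intro subspace_diff subspace_scale)
      moreover have "f ((A ^^ (k - 1)) v') = 1"
        unfolding Av' using v hi[OF v(1), of "k - 1 + Suc j"] linear_0[OF lf] by simp
      moreover have "f ((A ^^ i) v') = 0" if i: "k - 1 - Suc j \<le> i" "i < k - 1" for i
      proof (cases "i = i0")
        case True
        then show ?thesis unfolding Av' using i0 v(2) by simp
      next
        case False
        then have "k - 1 - j \<le> i" using i i0 by (simp add: i0_def)
        then have "i + Suc j \<ge> k" using Suc.prems by linarith
        then have h: "(A ^^ (i + Suc j)) v = 0" by (rule hi[OF v(1)])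
        show ?thesis unfolding Av' h using v(3)[OF \<open>k - 1 - j \<le> i\<close> i(2)] linear_0[OF lf] by simp
      qed
      ultimately show ?case by blast
    qed
    from this[of "k - 1"] obtain v where v: "v \<in> V" "f ((A ^^ (k - 1)) v) = 1"
      "\<And>i. i < k - 1 \<Longrightarrow> f ((A ^^ i) v) = 0" by auto
    let ?e = "\<lambda>i. (A ^^ i) v"
    let ?U = "span (?e ` {..<k})"
    define a where "a i x = f ((A ^^ (k - 1 - i)) x)" for i x
    have "(A ^^ k) v = 0" using k v(1) by blast
    moreover have "f ((A ^^ j) v) = (if j = k - 1 then 1 else 0)" if "j < k" for j
      using v(2,3) that by auto
    ultimately have chain: "soliton_product A 2 ?U" "\<And>x. x \<in> ?U \<Longrightarrow> x = (\<Sum>i<k. a i x *\<^sub>R ?e i)"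
      "\<And>i y. i < k \<Longrightarrow> a i (y - (\<Sum>i<k. a i y *\<^sub>R ?e i)) = 0"
      using soliton_product_chain[OF A lf k0, of v] unfolding a_def by blast+
    let ?W = "{w \<in> V. \<forall>i<k. a i w = 0}"
    have la: "linear (a i)" for i
      unfolding a_def using linear_compose[OF lA lf] by (simp add: o_def)
    have sW: "subspace ?W"
      using less.prems(1) by (auto simp: subspace_def linear_0[OF la] linear_add[OF la] linear_scale[OF la])
    have "v \<notin> ?W" using v(2) k0 by (auto simp: a_def intro!: exI[of _ 0])
    then have "?W \<subset> V" using v(1) by blast
    then have "dim ?W < dim V"
      using sW less.prems(1) by (intro dim_psubset) (simp only: span_eq_iff[THEN iffD2])
    moreover have "A w \<in> ?W" if "w \<in> ?W" for w
    proof -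
      have "a i (A w) = 0" if "i < k" for i
      proof (cases i)
        case 0
        obtain l where l: "k = Suc l" using k0 by (cases k) auto
        have "a 0 (A w) = f ((A ^^ k) w)" by (simp add: a_def l funpow_swap1)
        then show ?thesis using 0 k \<open>w \<in> ?W\<close> linear_0[OF lf] by simp
      next
        case (Suc j)
        then have "k - 1 - j = Suc (k - 1 - i)" using that by simp
        then have "a i (A w) = a j w" by (simp add: a_def funpow_swap1)
        then show ?thesis using \<open>w \<in> ?W\<close> Suc that by simp
      qed
      then show ?thesis using that less.prems(2) by simp
    qed
    moreover have "nilpotent_on ?W A" using k by (auto simp: nilpotent_on_def)
    ultimately have gW: "soliton_product A 2 ?W" using less.hyps sW by blast
    have UV: "?U \<subseteq> V" by (rule span_minimal) (use AV v(1) less.prems(1) in auto)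
    have "?U \<inter> ?W = {0}"
    proof
      show "?U \<inter> ?W \<subseteq> {0}"
      proof
        fix x assume x: "x \<in> ?U \<inter> ?W"
        then have "x = (\<Sum>i<k. a i x *\<^sub>R ?e i)" using chain(2) by blast
        also have "\<dots> = 0" using x by (intro sum.neutral) auto
        finally show "x \<in> {0}" by simp
      qed
      show "{0} \<subseteq> ?U \<inter> ?W" using subspace_0[OF sW] by (simp add: span_zero)
    qed
    from soliton_product_sum[OF A chain(1) gW this] have "soliton_product A 2 {u + w | u w. u \<in> ?U \<and> w \<in> ?W}" .
    moreover have "{u + w | u w. u \<in> ?U \<and> w \<in> ?W} = V"
    proof
      show "{u + w | u w. u \<in> ?U \<and> w \<in> ?W} \<subseteq> V" using UV less.prems(1) by (auto intro: subspace_add)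
      show "V \<subseteq> {u + w | u w. u \<in> ?U \<and> w \<in> ?W}"
      proof
        fix x assume x: "x \<in> V"
        define u where "u = (\<Sum>i<k. a i x *\<^sub>R ?e i)"
        have "u \<in> ?U" unfolding u_def by (intro span_sum span_scale span_base) auto
        moreover have "x - u \<in> ?W"
          using chain(3)[of _ x] x UV \<open>u \<in> ?U\<close> less.prems(1) by (auto simp: u_def[symmetric] intro: subspace_diff)
        moreover have "x = u + (x - u)" by simp
        ultimately show "x \<in> {u + w | u w. u \<in> ?U \<and> w \<in> ?W}" by blast
      qed
    qed
    ultimately show ?thesis by simp
  qed
qed

text \<open>A subspace U of maximal dimension with such a product must be V. Otherwise some complex
  eigenvector lies outside U \<times> U, and the line or plane it spans meets U trivially, so its
  product can be added to that of U.\<close>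

lemma soliton_product_semisimple:
  fixes A :: "'a::euclidean_space \<Rightarrow> 'a"
  assumes A: "linear A" and V: "subspace V" "\<And>v. v \<in> V \<Longrightarrow> A v \<in> V" and ss: "semisimple_on V A"
  shows "soliton_product A 0 V"
proof -
  let ?P = "\<lambda>U. soliton_product A 0 U \<and> U \<subseteq> V"
  have P0: "?P {0}" using soliton_product_zero[OF A] subspace_0[OF V(1)] by simp
  have bd: "\<forall>U. ?P U \<longrightarrow> dim U < Suc DIM('a)"
    using dim_subset_UNIV by (auto simp: less_Suc_eq_le)
  obtain U where "?P U \<and> (\<forall>U'. ?P U' \<longrightarrow> dim U' \<le> dim U)"
    using ex_has_greatest_nat[of ?P, OF P0 bd] by (elim exE)
  then have U: "soliton_product A 0 U" "U \<subseteq> V" and max: "\<And>U'. soliton_product A 0 U' \<Longrightarrow> U' \<subseteq> V \<Longrightarrow> dim U' \<le> dim U"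
    by simp_all
  have sU: "subspace U" and AU: "\<And>v. v \<in> U \<Longrightarrow> A v \<in> U" using U(1) by (auto simp: soliton_product_def)
  have extend: False if E: "soliton_product A 0 E" "E \<subseteq> V" "U \<inter> E = {0}" "x \<in> E" "x \<notin> U" for E x
  proof -
    let ?S = "{u + w | u w. u \<in> U \<and> w \<in> E}"
    have g: "soliton_product A 0 ?S" by (rule soliton_product_sum[OF A U(1) E(1,3)])
    have sE: "subspace E" using E(1) by (simp add: soliton_product_def)
    have "?S \<subseteq> V" using U(2) E(2) V(1) by (auto intro: subspace_add)
    then have "dim ?S \<le> dim U" using max g by blast
    moreover have "U \<subset> ?S"
    proof -
      have "U \<subseteq> ?S" using subspace_0[OF sE] by force
      moreover have "x \<in> ?S" using E(4) subspace_0[OF sU] by force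
      ultimately show ?thesis using E(5) by blast
    qed
    then have "dim U < dim ?S"
      using sU g by (intro dim_psubset) (simp only: span_eq_iff[THEN iffD2] soliton_product_def)
    ultimately show False by simp
  qed
  have "U = V"
  proof (rule ccontr)
    assume "U \<noteq> V"
    have "\<exists>w \<in> {w \<in> V \<times> V. \<exists>z. complex_eigenvector A z w}. w \<notin> U \<times> U"
    proof (rule ccontr)
      assume "\<not> ?thesis"
      then have "{w \<in> V \<times> V. \<exists>z. complex_eigenvector A z w} \<subseteq> U \<times> U" by blast
      then have "span {w \<in> V \<times> V. \<exists>z. complex_eigenvector A z w} \<subseteq> U \<times> U"
        by (rule span_minimal) (rule subspace_Times[OF sU sU])
      then have "V \<times> V \<subseteq> U \<times> U" using ss by (auto simp: semisimple_on_def)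
      then have "V \<subseteq> U" by blast
      with U(2) \<open>U \<noteq> V\<close> show False by blast
    qed
    then obtain a b z where ab: "a \<in> V" "b \<in> V" "a \<notin> U \<or> b \<notin> U" and ev: "complex_eigenvector A z (a, b)" by force
    define \<alpha> \<omega> where "\<alpha> = Re z" and "\<omega> = Im z"
    have e: "A a = \<alpha> *\<^sub>R a - \<omega> *\<^sub>R b" "A b = \<omega> *\<^sub>R a + \<alpha> *\<^sub>R b"
      using ev by (auto simp: complex_eigenvector_def \<alpha>_def \<omega>_def)
    show False
    proof (cases "\<omega> = 0")
      case True
      define x where "x = (if a \<in> U then b else a)"
      have x: "x \<in> V" "x \<notin> U" "A x = \<alpha> *\<^sub>R x" using ab e True by (auto simp: x_def)
      have AE: "A y = \<alpha> *\<^sub>R y" if "y \<in> span {x}" for y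
        using that by (auto simp: span_singleton linear_scale[OF A] x(3))
      have "soliton_product A 0 (span {x})"
        by (rule soliton_productI[where g = "\<lambda>x y. x \<bullet> y" and B = A], use A in \<open>auto simp: AE span_scale inner_commute
            inner_product_inner[unfolded inner_product_def] algebra_simps\<close>)
          (simp flip: scaleR_add_left)
      moreover have "U \<inter> span {x} = {0}"
      proof -
        have "c = 0" if "c *\<^sub>R x \<in> U" for c
        proof (rule ccontr)
          assume "c \<noteq> 0"
          then have "x = (1 / c) *\<^sub>R (c *\<^sub>R x)" by simp
          then show False using subspace_scale[OF sU that] x(2) by metis
        qed
        then show ?thesis using subspace_0[OF sU] by (auto simp: span_singleton span_zero)
      qed
      moreover have "span {x} \<subseteq> V" by (rule span_minimal) (use x V(1) in auto)
      ultimately show False using extend[of "span {x}" x] x(2) by (simp add: span_base)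
    next
      case False
      let ?E = "span {a, b}"
      define M where "M x = A x - \<alpha> *\<^sub>R x" for x
      have lM: "linear M" unfolding M_def by (intro linear_compose_sub A linear_scale_self)
      have Mab: "M a = - \<omega> *\<^sub>R b" "M b = \<omega> *\<^sub>R a" by (simp_all add: M_def e)
      have ME: "M x \<in> ?E" if "x \<in> ?E" for x
        using that
      proof (rule span_induct)
        show "subspace {x. M x \<in> ?E}" using linear_subspace_vimage[OF lM subspace_span] by (simp add: vimage_def)
        show "M x \<in> ?E" if "x \<in> {a, b}" for x
          using that Mab by (auto intro!: span_scale span_neg intro: span_base)
      qed
      have MM: "M (M x) = - (\<omega> * \<omega>) *\<^sub>R x" if "x \<in> ?E" for x
        using that
      proof (rule span_induct)
        show "subspace {x. M (M x) = - (\<omega> * \<omega>) *\<^sub>R x}"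
          by (rule subspaceI) (simp_all add: linear_0[OF lM] linear_add[OF lM] linear_scale[OF lM] algebra_simps)
        show "M (M x) = - (\<omega> * \<omega>) *\<^sub>R x" if "x \<in> {a, b}" for x
          using that Mab by (auto simp: linear_scale[OF lM] linear_neg[OF lM])
      qed
      have AM: "A x = M x + \<alpha> *\<^sub>R x" for x by (simp add: M_def)
      \<comment> \<open>M^2 = - \<omega>^2 on the plane, so averaging the inner product with its
        pullback along M makes M skew; \<alpha> - M is then the adjoint of \<alpha> + M.\<close>
      let ?g = "\<lambda>x y. \<omega> * \<omega> * (x \<bullet> y) + M x \<bullet> M y" and ?B = "\<lambda>x. \<alpha> *\<^sub>R x - M x"
      have gE: "soliton_product A 0 ?E"
      proof (rule soliton_productI[where g = ?g and B = ?B])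
        show "bilinear ?g"
          unfolding bilinear_def
          by (intro conjI allI linearI) (simp_all add: linear_add[OF lM] linear_scale[OF lM] inner_simps algebra_simps)
        show "?g x x > 0" if "x \<noteq> 0" for x
        proof -
          have "\<omega> * \<omega> > 0" using False by (metis not_real_square_gt_zero)
          then show ?thesis using that by (intro add_pos_nonneg mult_pos_pos[of "\<omega> * \<omega>"]) auto
        qed
        show "linear ?B" by (intro linear_compose_sub linear_scale_self lM)
        show "?g (A x) y = ?g x (?B y)" if "x \<in> ?E" "y \<in> ?E" for x y
          unfolding AM linear_add[OF lM] linear_diff[OF lM] linear_scale[OF lM] MM[OF that(1)] MM[OF that(2)]
          by (simp add: inner_simps algebra_simps)
        show "2 *\<^sub>R A (?B (A x)) - ?B (A (A x)) - A (A (?B x)) = 0 *\<^sub>R A x" if "x \<in> ?E" for x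
          unfolding AM scaleR_2 by (simp add: linear_add[OF lM] linear_diff[OF lM] linear_scale[OF lM] algebra_simps)
        show "A x \<in> ?E" "?B x \<in> ?E" if "x \<in> ?E" for x
          unfolding AM using that ME by (auto intro: span_add span_scale span_diff)
      qed (auto simp: inner_commute)
      \<comment> \<open>The plane is irreducible under M: a nonzero vector of it in U, together with
        its image under M, would put both a and b into U.\<close>
      have "x = 0" if x: "x \<in> ?E" "x \<in> U" for x
      proof (rule ccontr)
        assume "x \<noteq> 0"
        obtain p q where pq: "x = p *\<^sub>R a + q *\<^sub>R b"
          using x(1) by (auto simp: span_insert span_singleton algebra_simps)
        have MU: "M x \<in> U" unfolding M_def using x(2) AU sU by (intro subspace_diff subspace_scale)
        have Mx: "M x = (q * \<omega>) *\<^sub>R a - (p * \<omega>) *\<^sub>R b" by (simp add: pq linear_add[OF lM] linear_scale[OF lM] Mab)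
        have nz: "\<omega> * (p * p + q * q) \<noteq> 0"
          using False \<open>x \<noteq> 0\<close> pq by (auto simp: sum_squares_eq_zero_iff)
        have "(p * \<omega>) *\<^sub>R x + q *\<^sub>R M x = (\<omega> * (p * p + q * q)) *\<^sub>R a"
          unfolding Mx unfolding pq by (simp add: algebra_simps)
        then have "(\<omega> * (p * p + q * q)) *\<^sub>R a \<in> U" using x(2) MU sU by (metis subspace_add subspace_scale)
        then have "a \<in> U" using nz subspace_scale[OF sU, of _ "1 / (\<omega> * (p * p + q * q))"] by fastforce
        have "(q * \<omega>) *\<^sub>R x - p *\<^sub>R M x = (\<omega> * (p * p + q * q)) *\<^sub>R b"
          unfolding Mx unfolding pq by (simp add: algebra_simps)
        then have "(\<omega> * (p * p + q * q)) *\<^sub>R b \<in> U" using x(2) MU sU by (metis subspace_diff subspace_scale)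
        then have "b \<in> U" using nz subspace_scale[OF sU, of _ "1 / (\<omega> * (p * p + q * q))"] by fastforce
        with \<open>a \<in> U\<close> ab show False by blast
      qed
      then have "U \<inter> ?E = {0}" using subspace_0[OF sU] by (auto simp: span_zero)
      moreover have "?E \<subseteq> V" by (rule span_minimal) (use ab V(1) in auto)
      moreover have "a \<in> ?E" "b \<in> ?E" by (simp_all add: span_base)
      ultimately show False using extend[OF gE] ab(3) by blast
    qed
  qed
  then show ?thesis using U(1) by simp
qed

text \<open>The product on N is extended by declaring X a unit vector orthogonal to N. The unit
  normal is then a multiple of X, and the matrix satisfies [mom A, A] = s^2 c A; if c = 0, pairing
  with A gives mom A = 0.\<close>

lemma solvsoliton_of_product:
  fixes br :: "'a::euclidean_space \<Rightarrow> 'a \<Rightarrow> 'a"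
  assumes lie: "lie_algebra br" and ideal: "codim1_abelian_ideal br N" and X: "X \<notin> N"
    and product: "soliton_product (br X) c N" and c: "c \<ge> 0"
  obtains g where "solvsoliton br g"
proof -
  let ?h = "height N X"
  have \<eta>: "linear ?h" by (rule linear_height[OF lie ideal X])
  note \<eta>l = linear_add[OF \<eta>] linear_diff[OF \<eta>] linear_scale[OF \<eta>]
  define pr where "pr x = x - ?h x *\<^sub>R X" for x
  have prN: "pr x \<in> N" for x unfolding pr_def by (rule height_mem[OF lie ideal X])
  have hN: "?h x = 0" if "x \<in> N" for x by (rule height_eqI[OF lie ideal X]) (use that in simp)
  have prid: "pr x = x" if "x \<in> N" for x by (simp add: pr_def hN that)
  have lpr: "linear pr" by (rule linearI) (auto simp: pr_def \<eta>l algebra_simps)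
  obtain gN :: "'a \<Rightarrow> 'a \<Rightarrow> real" and B where AN: "\<And>v. v \<in> N \<Longrightarrow> br X v \<in> N"
    and gN: "bilinear gN" "\<And>x y. gN x y = gN y x" "\<And>x. x \<in> N \<Longrightarrow> x \<noteq> 0 \<Longrightarrow> gN x x > 0"
    and B: "linear B" "\<And>v. v \<in> N \<Longrightarrow> B v \<in> N"
    and gA: "\<And>x y. x \<in> N \<Longrightarrow> y \<in> N \<Longrightarrow> gN (br X x) y = gN x (B y)"
    and e: "\<And>v. v \<in> N \<Longrightarrow> 2 *\<^sub>R br X (B (br X v)) - B (br X (br X v)) - br X (br X (B v)) = c *\<^sub>R br X v"
    using product unfolding soliton_product_def by blast
  define g where "g x y = ?h x * ?h y + gN (pr x) (pr y)" for x y
  have gN0: "gN 0 x = 0" for x using gN(1) by (rule bilinear_lzero)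
  have "inner_product g"
    unfolding inner_product_def
  proof (intro conjI allI impI)
    show "bilinear g"
      unfolding bilinear_def
      by (intro conjI allI linearI) (simp_all add: g_def \<eta>l linear_add[OF lpr] linear_scale[OF lpr]
          bilinear_ladd[OF gN(1)] bilinear_radd[OF gN(1)] bilinear_lmul[OF gN(1)] bilinear_rmul[OF gN(1)] algebra_simps)
    show "g x y = g y x" for x y by (simp add: g_def gN(2)[of "pr x"] mult.commute)
    show "0 < g x x" if "x \<noteq> 0" for x
    proof (cases "pr x = 0")
      case True
      then have "?h x \<noteq> 0" using that by (auto simp: pr_def)
      then have "?h x * ?h x > 0" by (metis not_real_square_gt_zero)
      then show ?thesis by (simp add: g_def True gN0)
    next
      case False
      then have "gN (pr x) (pr x) > 0" by (rule gN(3)[OF prN])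
      then show ?thesis by (simp add: g_def add_nonneg_pos)
    qed
  qed
  then obtain P Q A where fr: "frame br N g P Q A" using frame_exists[OF lie ideal] by blast
  note f = frame_facts[OF fr]
  let ?\<nu> = "app Q e0"
  define s where "s = ?h ?\<nu>"
  have "pr ?\<nu> = 0"
  proof (rule ccontr)
    assume "pr ?\<nu> \<noteq> 0"
    then have "gN (pr ?\<nu>) (pr ?\<nu>) > 0" by (rule gN(3)[OF prN])
    also have "gN (pr ?\<nu>) (pr ?\<nu>) = g ?\<nu> (pr ?\<nu>)"
      by (simp add: g_def hN[OF prN] prid[OF prN])
    also have "\<dots> = 0" using prN[of ?\<nu>] by (simp add: f(3,5,6) inner_commute)
    finally show False by simp
  qed
  then have \<nu>: "?\<nu> = s *\<^sub>R X" by (simp add: pr_def s_def)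
  have "?\<nu> \<noteq> 0" using f(3)[of e0] by (metis app_linear(1) e0_inner inner_zero_left zero_neq_one)
  then have s0: "s \<noteq> 0" using \<nu> by auto
  define T where "T = ad br X"
  have Tbr: "app T x = br X x" for x by (simp add: T_def app_ad[OF lie])
  define Bt where "Bt = Endo (\<lambda>x. B (pr x))"
  have Bt: "app Bt x = B (pr x)" for x
    unfolding Bt_def using linear_compose[OF lpr B(1)] by (simp add: app_Endo o_def)
  have Tpr: "app T x = br X (pr x)" for x
  proof -
    have "br X X = 0" using lie by (simp add: lie_algebra_def)
    then show ?thesis unfolding Tbr[symmetric] pr_def by (simp add: Tbr)
  qed
  define Ah where "Ah = P * T * Q"
  have A: "A = s *\<^sub>R Ah"
  proof -
    have "ad br ?\<nu> = s *\<^sub>R T"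
      by (rule endo_eqI) (use lie in \<open>simp add: app_ad[OF lie] T_def \<nu> lie_algebra_def bilinear_lmul\<close>)
    then show ?thesis using frame_matrix[OF lie fr] by (simp add: Ah_def)
  qed
  have tpA: "tp Ah = P * Bt * Q"
  proof (rule tp_eqI)
    fix x y
    have "app Ah x \<bullet> y = g (app T (app Q x)) (app Q y)" by (simp add: Ah_def f(3,5))
    also have "\<dots> = gN (br X (pr (app Q x))) (pr (app Q y))"
      by (simp add: g_def Tpr hN AN prN prid)
    also have "\<dots> = gN (pr (app Q x)) (B (pr (app Q y)))" by (rule gA[OF prN prN])
    also have "\<dots> = g (app Q x) (app Bt (app Q y))"
      by (simp add: g_def Bt hN B(2) prN prid)
    also have "\<dots> = x \<bullet> app (P * Bt * Q) y" by (simp add: f(3,5))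
    finally show "app Ah x \<bullet> y = x \<bullet> app (P * Bt * Q) y" .
  qed
  have conj: "P * x * Q * (P * y * Q) = P * (x * y) * Q" for x y by (metis f(2) mult.assoc mult_1)
  have "cm (cm T Bt) T = c *\<^sub>R T"
  proof (rule endo_eqI)
    fix x
    have "app (cm (cm T Bt) T) x = 2 *\<^sub>R br X (B (br X (pr x))) - B (br X (br X (pr x))) - br X (br X (B (pr x)))"
    proof -
      have "app (cm (cm T Bt) T) x = app T (app Bt (app T x)) - app Bt (app T (app T x))
         - (app T (app T (app Bt x)) - app T (app Bt (app T x)))"
        by (simp add: cm_def)
      also have "\<dots> = br X (B (br X (pr x))) - B (br X (br X (pr x))) - (br X (br X (B (pr x))) - br X (B (br X (pr x))))"
        by (simp add: Bt Tpr prid AN prN B(2))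
      finally show ?thesis by (simp add: scaleR_2)
    qed
    then show "app (cm (cm T Bt) T) x = app (c *\<^sub>R T) x" using e[OF prN] by (simp add: Tpr)
  qed
  moreover have "cm (cm Ah (tp Ah)) Ah = P * cm (cm T Bt) T * Q"
  proof -
    have "cm (P * x * Q) (P * y * Q) = P * cm x y * Q" for x y
      unfolding cm_def conj by (simp add: algebra_simps)
    then show ?thesis unfolding tpA unfolding Ah_def by (simp only:)
  qed
  ultimately have "cm (mom Ah) Ah = c *\<^sub>R Ah" by (simp add: mom_def Ah_def)
  then have mA: "cm (mom A) A = (s\<^sup>2 * c) *\<^sub>R A"
    by (simp add: A mom_scaleR cm_linear mult_ac)
  have "solvsoliton br g"
    unfolding solvsoliton_frame[OF fr]
  proof (cases "c = 0")
    case True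
    then have "(norm (mom A))\<^sup>2 = 0" using inner_cm_self_mom[of A] mA by simp
    then show "mom A = 0 \<or> (\<exists>r>0. cm (mom A) A = r *\<^sub>R A)" by simp
  next
    case False
    then have "s\<^sup>2 * c > 0" using c s0 by simp
    then show "mom A = 0 \<or> (\<exists>r>0. cm (mom A) A = r *\<^sub>R A)" using mA by blast
  qed
  then show thesis by (rule that)
qed

section \<open>Real type\<close>

text \<open>The nilsoliton product exhibits 2 L as a commutator.\<close>

lemma tr_nilpotent:
  assumes "L ^ k = 0" shows "tr L = 0"
proof -
  have pow: "app (L ^ i) = app L ^^ i" for i
    by (induction i) (simp_all add: fun_eq_iff id_def)
  have "nilpotent_on UNIV (app L)"
    using assms by (auto simp: nilpotent_on_def pow[symmetric] intro!: exI[of _ k])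
  then have "soliton_product (app L) 2 UNIV" by (intro soliton_product_nilpotent linear_app) auto
  then obtain B where B: "linear B"
    "\<And>v. 2 *\<^sub>R app L (B (app L v)) - B (app L (app L v)) - app L (app L (B v)) = 2 *\<^sub>R app L v"
    unfolding soliton_product_def by auto
  define b where "b = Endo B"
  have "cm (cm L b) L = 2 *\<^sub>R L"
  proof (rule endo_eqI)
    fix x
    show "app (cm (cm L b) L) x = app (2 *\<^sub>R L) x"
      using B(2)[of x] by (simp add: cm_def b_def app_Endo[OF B(1)] scaleR_2 algebra_simps)
  qed
  then have "tr (2 *\<^sub>R L) = 0" by (metis tr_cm)
  then show ?thesis by simp
qed

text \<open>|[A^t, L]|^2 = \<langle>L, [A, [A^t, L]]\<rangle>, and the inner double commutator
  vanishes by the Jacobi identity.\<close>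

lemma fuglede:
  assumes n: "mom A = 0" and L: "cm A L = 0" shows "cm (tp A) L = 0"
proof -
  have sw: "cm x y = 0 \<Longrightarrow> cm y x = 0" for x y :: "'a endo" using cm_swap[of y x] by simp
  have "tp (cm A L) = 0" using L by simp
  then have tL: "cm (tp L) (tp A) = 0" by (simp add: tp_cm)
  have AA: "cm A (tp A) = 0" using n by (simp add: mom_def)
  have "inner (cm (tp A) L) (cm (tp A) L) = inner L (cm A (cm (tp A) L))"
    using inner_cm_right[of "tp A" L "cm (tp A) L"] by simp
  also have "cm A (cm (tp A) L) = 0" by (simp add: cm_jacobi AA L cm_linear)
  finally show ?thesis by simp
qed

text \<open>G is an adapted product for which L has operator norm at most \<epsilon>; passing to the
  Frobenius norm costs sqrt DIM. By Fuglede's theorem A^t commutes with L too, so it remains the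
  adjoint of A for G, and normality, norm and tau of A are unchanged.\<close>

lemma nilpotent_shrink:
  fixes A L :: "'a::euclidean_space endo"
  assumes n: "mom A = 0" and L: "cm A L = 0" "L ^ k = 0" and \<epsilon>: "\<epsilon> > 0"
    and ad: "adm e0 L"
  defines "G \<equiv> \<lambda>x y. \<Sum>i<k. (1 / \<epsilon>) ^ (2 * i) * (app (L ^ i) x \<bullet> app (L ^ i) y)"
  shows "inner_product G" "G e0 y = e0 \<bullet> y"
    and "h * h' = 1 \<Longrightarrow> h' * h = 1 \<Longrightarrow> (\<And>x y. G x y = app h x \<bullet> app h y) \<Longrightarrow>
       mom (h * A * h') = 0 \<and> tau (h * A * h') = tau A \<and> norm (h * A * h') = norm A \<and>
       norm (h * L * h') \<le> \<epsilon> * sqrt DIM('a)"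
proof -
  have k0: "k > 0" using L(2) by (cases k) auto
  have L0: "app (L ^ 0) x = x" for x by simp
  have lin: "linear (\<lambda>x. G x y)" "linear (\<lambda>y. G x y)" for x y
    unfolding G_def by (intro linearI; simp add: inner_simps sum.distrib sum_distrib_left algebra_simps)+
  have pos: "G x x \<ge> x \<bullet> x" for x
  proof -
    have "(\<Sum>i\<in>{0}. (1 / \<epsilon>) ^ (2 * i) * (app (L ^ i) x \<bullet> app (L ^ i) x)) \<le> G x x"
      unfolding G_def using k0 \<epsilon> by (intro sum_mono2) auto
    then show ?thesis by simp
  qed
  show "inner_product G"
    unfolding inner_product_def bilinear_def
  proof (intro conjI allI impI lin)
    show "G x y = G y x" for x y by (simp add: G_def inner_commute)
    show "0 < G x x" if "x \<noteq> 0" for x using pos[of x] that by (meson inner_gt_zero_iff less_le_trans)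
  qed
  have "app (L ^ i) e0 = (if i = 0 then e0 else 0)" for i
    using ad by (cases i) (simp_all add: power_Suc2 adm_def del: power_Suc)
  then have "G e0 y = (\<Sum>i<k. if i = 0 then e0 \<bullet> y else 0)"
    unfolding G_def by (intro sum.cong) auto
  then show "G e0 y = e0 \<bullet> y" using k0 by simp
  assume hh: "h * h' = 1" "h' * h = 1" and G: "\<And>x y. G x y = app h x \<bullet> app h y"
  note inv = app_inverse[OF hh]
  have Li: "L ^ i * A = A * L ^ i" "L ^ i * tp A = tp A * L ^ i" for i
    using L(1) fuglede[OF n L(1)] by (simp_all add: cm_def power_commuting_commutes)
  have GA: "G (app A x) y = G x (app (tp A) y)" for x y
  proof -
    have "app (L ^ i) (app A x) = app A (app (L ^ i) x)" "app (L ^ i) (app (tp A) x) = app (tp A) (app (L ^ i) x)" for i x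
      using Li[of i] by (metis app_simps(6))+
    then show ?thesis by (simp add: G_def app_tp')
  qed
  have tph: "tp (h * A * h') = h * tp A * h'"
  proof (rule tp_eqI)
    fix x y
    show "app (h * A * h') x \<bullet> y = x \<bullet> app (h * tp A * h') y"
      using GA[of "app h' x" "app h' y"] by (simp add: G inv)
  qed
  have conj: "h * x * h' * (h * y * h') = h * (x * y) * h'" for x y by (metis hh(2) mult.assoc mult_1)
  have m: "mom (h * A * h') = 0"
  proof -
    have "mom (h * A * h') = h * (A * tp A) * h' - h * (tp A * A) * h'"
      by (simp only: mom_def cm_def tph conj)
    also have "\<dots> = h * mom A * h'" by (simp add: mom_def cm_def algebra_simps)
    finally have "mom (h * A * h') = h * mom A * h'" .
    then show ?thesis by (simp add: n)
  qed
  have trA: "tr (h * x * h') = tr x" for x by (rule tr_conj[OF hh(2)])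
  have nA: "(norm (h * A * h'))\<^sup>2 = (norm A)\<^sup>2"
    by (simp only: power2_norm_eq_inner inner_endo_def tph conj trA)
  have t: "tau (h * A * h') = tau A" by (simp only: tau_alt nA conj trA)
  have Lsmall: "norm (app (h * L * h') y) \<le> \<epsilon> * norm y" for y
  proof -
    define x where "x = app h' y"
    have "(norm (app (h * L * h') y))\<^sup>2 = G (app L x) (app L x)"
      by (simp add: G x_def power2_norm_eq_inner)
    also have "\<dots> = (\<Sum>i<k. \<epsilon>\<^sup>2 * ((1 / \<epsilon>) ^ (2 * Suc i) * (app (L ^ Suc i) x \<bullet> app (L ^ Suc i) x)))"
      unfolding G_def
    proof (intro sum.cong refl)
      fix i
      have p: "(1 / \<epsilon>) ^ (2 * Suc i) = (1 / \<epsilon>) ^ (2 * i) * (1 / \<epsilon>)\<^sup>2"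
        by (simp only: power_add[symmetric]) simp
      have "\<epsilon>\<^sup>2 * (1 / \<epsilon>)\<^sup>2 = 1" using \<epsilon> by (simp add: power_divide)
      then have e: "\<epsilon>\<^sup>2 * (1 / \<epsilon>) ^ (2 * Suc i) = (1 / \<epsilon>) ^ (2 * i)"
        unfolding p mult.left_commute[of "\<epsilon>\<^sup>2"] by (simp only: mult_1_right)
      have L: "app (L ^ Suc i) x = app (L ^ i) (app L x)" by (simp only: power_Suc2 app_simps(6))
      show "(1 / \<epsilon>) ^ (2 * i) * (app (L ^ i) (app L x) \<bullet> app (L ^ i) (app L x))
        = \<epsilon>\<^sup>2 * ((1 / \<epsilon>) ^ (2 * Suc i) * (app (L ^ Suc i) x \<bullet> app (L ^ Suc i) x))"
        unfolding L mult.assoc[symmetric] e ..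
    qed
    also have "\<dots> = \<epsilon>\<^sup>2 * (\<Sum>i<k. (1 / \<epsilon>) ^ (2 * Suc i) * (app (L ^ Suc i) x \<bullet> app (L ^ Suc i) x))"
      by (simp only: sum_distrib_left)
    \<comment> \<open>The shift drops the nonnegative term at 0 and adds the one at k, which is zero
      because L^k = 0.\<close>
    also have "(\<Sum>i<k. (1 / \<epsilon>) ^ (2 * Suc i) * (app (L ^ Suc i) x \<bullet> app (L ^ Suc i) x)) \<le> G x x"
    proof -
      have "(\<Sum>i<Suc k. (1 / \<epsilon>) ^ (2 * i) * (app (L ^ i) x \<bullet> app (L ^ i) x)) = G x x"
        by (simp add: G_def L(2))
      moreover have "0 \<le> (1 / \<epsilon>) ^ (2 * 0) * (app (L ^ 0) x \<bullet> app (L ^ 0) x)" by simp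
      ultimately show ?thesis unfolding sum.lessThan_Suc_shift by linarith
    qed
    finally have "(norm (app (h * L * h') y))\<^sup>2 \<le> \<epsilon>\<^sup>2 * G x x" using \<epsilon> by (simp add: mult_left_mono)
    also have "G x x = (norm y)\<^sup>2" by (simp add: G x_def inv power2_norm_eq_inner)
    finally have "(norm (app (h * L * h') y))\<^sup>2 \<le> (\<epsilon> * norm y)\<^sup>2" by (simp add: power_mult_distrib)
    then show ?thesis by (rule power2_le_imp_le) (use \<epsilon> in simp)
  qed
  have "(norm (h * L * h'))\<^sup>2 \<le> (\<Sum>b\<in>(Basis :: 'a set). \<epsilon>\<^sup>2)"
    unfolding norm_square_endo
  proof (rule sum_mono)
    fix b :: 'a assume "b \<in> Basis"
    then have "norm (app (h * L * h') b) \<le> \<epsilon>" using Lsmall[of b] by simp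
    then show "(norm (app (h * L * h') b))\<^sup>2 \<le> \<epsilon>\<^sup>2" by (intro power_mono) auto
  qed
  also have "\<dots> = (\<epsilon> * sqrt DIM('a))\<^sup>2" by (simp add: power_mult_distrib mult.commute)
  finally have "norm (h * L * h') \<le> \<epsilon> * sqrt DIM('a)" by (rule power2_le_imp_le) (use \<epsilon> in simp)
  moreover have "norm (h * A * h') = norm A" using nA by (simp add: power2_eq_iff_nonneg)
  ultimately show "mom (h * A * h') = 0 \<and> tau (h * A * h') = tau A \<and> norm (h * A * h') = norm A \<and>
       norm (h * L * h') \<le> \<epsilon> * sqrt DIM('a)" using m t by blast
qed

text \<open>The \<open>Z i\<close> may fail to converge, but their norm and tau are constant: tau
  changes continuously with D, and mom is at most 4 |A| |D| + 2 |D|^2.\<close>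

lemma pinch_perturbation:
  fixes Z D :: "nat \<Rightarrow> 'a::euclidean_space endo"
  assumes A: "mom A = 0" "sy A \<noteq> 0" and Z: "\<And>i. mom (Z i) = 0" "\<And>i. tau (Z i) = tau A" "\<And>i. norm (Z i) = norm A"
    and D: "D \<longlonglongrightarrow> 0" and tr: "\<And>i. tr (Z i + D i) = tr A"
  shows "(\<lambda>i. pinch (Z i + D i)) \<longlonglongrightarrow> pinch A"
proof -
  have nD: "(\<lambda>i. norm (D i)) \<longlonglongrightarrow> 0" using D by (rule tendsto_norm_zero)
  have sZ: "norm (sy (Z i)) = norm (sy A)" for i
    using Z(2)[of i] by (simp add: tau_def power2_eq_iff_nonneg)
  have "(\<lambda>i. norm (sy (Z i + D i)) - norm (sy A)) \<longlonglongrightarrow> 0"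
  proof (rule Lim_null_comparison[OF _ nD], rule always_eventually, rule allI)
    fix i
    have "sy (Z i + D i) = sy (Z i) + sy (D i)" by (simp add: sy_def algebra_simps)
    then have "\<bar>norm (sy (Z i + D i)) - norm (sy (Z i))\<bar> \<le> norm (sy (D i))"
      by (metis add_diff_cancel_left' norm_triangle_ineq3)
    then show "norm (norm (sy (Z i + D i)) - norm (sy A)) \<le> norm (D i)"
      using norm_sy_le[of "D i"] by (simp add: sZ)
  qed
  then have "(\<lambda>i. norm (sy (Z i + D i))) \<longlonglongrightarrow> norm (sy A)" by (simp add: LIM_zero_iff)
  then have t: "(\<lambda>i. tau (Z i + D i)) \<longlonglongrightarrow> tau A" unfolding tau_def by (intro tendsto_intros)
  have cmn: "norm (cm x y) \<le> 2 * norm x * norm y" for x y :: "'a endo"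
  proof -
    have "norm (y * x) \<le> norm x * norm y" by (metis mult.commute norm_mult_ineq)
    from order_trans[OF norm_triangle_ineq4 add_mono[OF norm_mult_ineq[of x y] this]]
    show ?thesis by (simp add: cm_def)
  qed
  have "(\<lambda>i. mom (Z i + D i)) \<longlonglongrightarrow> 0"
  proof (rule Lim_null_comparison)
    show "\<forall>\<^sub>F i in sequentially. norm (mom (Z i + D i)) \<le> 4 * norm A * norm (D i) + 2 * norm (D i) * norm (D i)"
    proof (rule always_eventually, rule allI)
      fix i
      have "mom (Z i + D i) = mom (Z i) + cm (Z i) (tp (D i)) + cm (D i) (tp (Z i)) + cm (D i) (tp (D i))"
        by (simp add: mom_def cm_linear)
      then have "norm (mom (Z i + D i)) \<le> norm (cm (Z i) (tp (D i))) + norm (cm (D i) (tp (Z i))) + norm (cm (D i) (tp (D i)))"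
        by (simp add: Z(1)) (metis (no_types, lifting) add_mono norm_triangle_ineq norm_triangle_le order_refl)
      also have "\<dots> \<le> 4 * norm A * norm (D i) + 2 * norm (D i) * norm (D i)"
        using cmn[of "Z i" "tp (D i)"] cmn[of "D i" "tp (Z i)"] cmn[of "D i" "tp (D i)"] by (simp add: Z(3) mult_ac)
      finally show "norm (mom (Z i + D i)) \<le> 4 * norm A * norm (D i) + 2 * norm (D i) * norm (D i)" .
    qed
    have "(\<lambda>i. 4 * norm A * norm (D i) + 2 * norm (D i) * norm (D i)) \<longlonglongrightarrow> 4 * norm A * 0 + 2 * 0 * 0"
      by (intro tendsto_intros nD)
    then show "(\<lambda>i. 4 * norm A * norm (D i) + 2 * norm (D i) * norm (D i)) \<longlonglongrightarrow> 0" by simp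
  qed
  then have "(\<lambda>i. norm (mom (Z i + D i))) \<longlonglongrightarrow> norm (mom A)" using A(1) by (simp add: tendsto_norm_zero)
  moreover have "tau A > 0" using A(2) by (simp add: tau_pos_iff)
  then have "tau A * (tau A + (tr A)\<^sup>2) + (norm (mom A))\<^sup>2 / 4 \<noteq> 0"
    by (intro less_imp_neq[symmetric] add_pos_nonneg mult_pos_pos) auto
  ultimately show ?thesis unfolding pinch_def tr by (intro tendsto_intros t) simp_all
qed

section \<open>The group of the semisimple part\<close>

context
  fixes br :: "'a::euclidean_space \<Rightarrow> 'a \<Rightarrow> 'a" and N :: "'a set" and X :: 'a and As An :: "'a \<Rightarrow> 'a"
  assumes lie: "lie_algebra br" and ideal: "codim1_abelian_ideal br N" and X: "X \<notin> N"
    and rt: "real_type br" and ns: "\<not> (\<exists>g. solvsoliton br g)"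
    and jd: "additive_jordan_decomposition N (br X) As An"
begin

private abbreviation "h \<equiv> height N X"
private abbreviation (input) "br0 \<equiv> semidirect_bracket N X As"

private lemma \<eta>: "linear h" by (rule linear_height[OF lie ideal X])
private lemmas \<eta>l = linear_add[OF \<eta>] linear_diff[OF \<eta>] linear_scale[OF \<eta>] linear_0[OF \<eta>]
private lemma sN: "subspace N" by (rule subspace_N[OF lie ideal X])
private lemma hN: "x \<in> N \<Longrightarrow> h x = 0" by (rule height_eqI[OF lie ideal X]) simp
private lemma Nh: "h x = 0 \<Longrightarrow> x \<in> N" using height_mem[OF lie ideal X, of x] by simp
private lemma hX: "h X = 1" by (rule height_eqI[OF lie ideal X]) (simp add: subspace_0[OF sN])

private lemma jdN:
  "linear As" "linear An" "v \<in> N \<Longrightarrow> As v \<in> N" "v \<in> N \<Longrightarrow> An v \<in> N" "v \<in> N \<Longrightarrow> br X v = As v + An v"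
  "v \<in> N \<Longrightarrow> As (An v) = An (As v)" "semisimple_on N As" "nilpotent_on N An"
  using jd by (auto simp: additive_jordan_decomposition_def)

private lemma linX: "linear (br X)" by (rule br_linear[OF lie ideal X])

private lemma br0_N: "h (br0 u v) = 0"
  unfolding semidirect_bracket_def
  by (rule hN, rule jdN(3), rule Nh) (simp add: \<eta>l)

private lemma br0_X: "v \<in> N \<Longrightarrow> br0 X v = As v"
  by (simp add: semidirect_bracket_def hX hN)

private lemma lie0: "lie_algebra br0"
  unfolding lie_algebra_def
proof (intro conjI allI)
  note l = linear_add[OF jdN(1)] linear_diff[OF jdN(1)] linear_scale[OF jdN(1)] linear_0[OF jdN(1)]
  show "bilinear br0"
    unfolding bilinear_def
    by (intro conjI allI linearI) (simp_all add: semidirect_bracket_def \<eta>l l algebra_simps)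
  show "br0 x x = 0" for x by (simp add: semidirect_bracket_def l)
  have brbr: "br0 x (br0 y z) = h x *\<^sub>R As (br0 y z)" for x y z
    unfolding semidirect_bracket_def[of N X As x] br0_N by (simp add: l)
  show "br0 x (br0 y z) + br0 y (br0 z x) + br0 z (br0 x y) = 0" for x y z
    unfolding brbr by (simp add: semidirect_bracket_def l algebra_simps)
qed

private lemma ideal0: "codim1_abelian_ideal br0 N"
  unfolding codim1_abelian_ideal_def
proof (intro conjI allI ballI)
  show "subspace N" "dim N + 1 = DIM('a)" using ideal by (auto simp: codim1_abelian_ideal_def)
  show "br0 x y \<in> N" for x y by (rule Nh[OF br0_N])
  show "br0 x y = 0" if "x \<in> N" "y \<in> N" for x y
    using that by (simp add: semidirect_bracket_def hN linear_0[OF jdN(1)])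
qed

text \<open>If ad X were nilpotent, the nilsoliton product would yield a solvsoliton. So by real
  type it has an eigenvalue with nonzero real part, which is then passed on to the semisimple
  part.\<close>

private lemma eigenpair:
  obtains a b \<alpha> \<omega> where "a \<in> N" "b \<in> N" "a \<noteq> 0 \<or> b \<noteq> 0" "\<alpha> \<noteq> 0"
    "As a = \<alpha> *\<^sub>R a - \<omega> *\<^sub>R b" "As b = \<omega> *\<^sub>R a + \<alpha> *\<^sub>R b"
proof -
  have brN: "br X v \<in> N" for v by (rule Nh[OF height_br[OF lie ideal X]])
  have "\<not> nilpotent_on UNIV (br X)"
  proof
    assume "nilpotent_on UNIV (br X)"
    then have "nilpotent_on N (br X)" by (auto simp: nilpotent_on_def)
    then have "soliton_product (br X) 2 N" by (intro soliton_product_nilpotent linX sN brN)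
    then show False using solvsoliton_of_product[OF lie ideal X, of 2] ns by auto
  qed
  then have "\<not> (\<forall>z. complex_eigenvalue (br X) z \<longrightarrow> Re z = 0)"
    using rt unfolding real_type_def by blast
  then obtain z w where ev: "complex_eigenvector (br X) z w" and z: "Re z \<noteq> 0"
    unfolding complex_eigenvalue_def by blast
  define a b \<alpha> \<omega> where "a = fst w" and "b = snd w" and "\<alpha> = Re z" and "\<omega> = Im z"
  have e: "br X a = \<alpha> *\<^sub>R a - \<omega> *\<^sub>R b" "br X b = \<omega> *\<^sub>R a + \<alpha> *\<^sub>R b" and nz: "a \<noteq> 0 \<or> b \<noteq> 0"
    using ev by (auto simp: complex_eigenvector_def a_def b_def \<alpha>_def \<omega>_def zero_prod_def prod_eq_iff)
  have \<alpha>: "\<alpha> \<noteq> 0" using z by (simp add: \<alpha>_def)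
  have pos: "\<alpha> * \<alpha> + \<omega> * \<omega> \<noteq> 0" using \<alpha> by (simp add: sum_squares_eq_zero_iff)
  \<comment> \<open>The image of ad X has height zero, so the heights of a and b satisfy the
    equations of an eigenvector for the value 0; as z \<noteq> 0, both lie in N.\<close>
  have hh: "\<alpha> * h a = \<omega> * h b" "\<omega> * h a + \<alpha> * h b = 0"
    using hN[OF brN[of a]] hN[OF brN[of b]] by (simp_all add: e \<eta>l)
  have "(\<alpha> * \<alpha> + \<omega> * \<omega>) * h a = 0" "(\<alpha> * \<alpha> + \<omega> * \<omega>) * h b = 0"
    using hh by algebra+
  then have abN: "a \<in> N" "b \<in> N" using pos by (auto intro: Nh)
  obtain m where m: "\<forall>v\<in>N. (An ^^ m) v = 0" using jdN(8) by (auto simp: nilpotent_on_def)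
  have lAn: "linear (An ^^ i)" for i by (rule linear_funpow[OF jdN(2)])
  have AnN: "(An ^^ i) v \<in> N" if "v \<in> N" for i v using that jdN(4) by (induction i) auto
  have comm: "br X ((An ^^ i) v) = (An ^^ i) (br X v)" if "v \<in> N" for i v
  proof (induction i)
    case (Suc i)
    have "br X (An u) = An (br X u)" if "u \<in> N" for u
      using jdN(4,5,6) that by (simp add: linear_add[OF jdN(2)])
    from this[OF AnN[OF that, of i]] show ?case by (simp add: Suc)
  qed simp
  \<comment> \<open>The last nonzero image of the eigenvector under powers of \<open>An\<close> is
    killed by \<open>An\<close>; there \<open>As\<close> and ad X agree, and the eigenvalue
    survives.\<close>
  define j where "j = (LEAST j. (An ^^ j) a = 0 \<and> (An ^^ j) b = 0)"
  have j: "(An ^^ j) a = 0 \<and> (An ^^ j) b = 0"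
    unfolding j_def by (rule LeastI[of _ m]) (use m abN in blast)
  then have "j \<noteq> 0" using nz by (cases j) auto
  then obtain i where i: "j = Suc i" by (cases j) auto
  have "\<not> ((An ^^ i) a = 0 \<and> (An ^^ i) b = 0)"
    using not_less_Least[of i "\<lambda>j. (An ^^ j) a = 0 \<and> (An ^^ j) b = 0"] i by (simp add: j_def)
  then have nz': "(An ^^ i) a \<noteq> 0 \<or> (An ^^ i) b \<noteq> 0" by blast
  have As_eq: "As u = br X u" if "u \<in> N" "An u = 0" for u using jdN(5)[OF that(1)] that(2) by simp
  have "As ((An ^^ i) a) = \<alpha> *\<^sub>R (An ^^ i) a - \<omega> *\<^sub>R (An ^^ i) b"
    "As ((An ^^ i) b) = \<omega> *\<^sub>R (An ^^ i) a + \<alpha> *\<^sub>R (An ^^ i) b"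
    using j i by (simp_all add: As_eq AnN abN comm e linear_add[OF lAn] linear_diff[OF lAn] linear_scale[OF lAn])
  then show thesis using that AnN abN nz' \<alpha> by metis
qed

text \<open>The eigenvalue with nonzero real part excludes a skew matrix, hence flatness, and a
  nilpotent one, hence the nilsoliton case; the solvsoliton is normal.\<close>

private lemma normal_frame:
  assumes ss: "solvsoliton br0 g0"
  obtains P0 Q0 A0 where "frame br0 N g0 P0 Q0 A0" "mom A0 = 0" "sy A0 \<noteq> 0"
proof -
  have "inner_product g0" using ss by (simp add: solvsoliton_def)
  then obtain P0 Q0 A0 where fr: "frame br0 N g0 P0 Q0 A0" using frame_exists[OF lie0 ideal0] by blast
  note f = frame_facts[OF fr]
  obtain a b \<alpha> \<omega> where ab: "a \<in> N" "b \<in> N" "a \<noteq> 0 \<or> b \<noteq> 0" "\<alpha> \<noteq> 0"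
    "As a = \<alpha> *\<^sub>R a - \<omega> *\<^sub>R b" "As b = \<omega> *\<^sub>R a + \<alpha> *\<^sub>R b" using eigenpair by blast
  define s where "s = app P0 X \<bullet> e0"
  have s: "s \<noteq> 0" using X f(6) by (simp add: s_def)
  have PA: "app P0 (As w) = s *\<^sub>R app A0 (app P0 w)" if "w \<in> N" for w
    using f(8)[of X w] f(6)[of w] that by (simp add: br0_X s_def)
  define u v where "u = app P0 a" and "v = app P0 b"
  define p q where "p = \<alpha> / s" and "q = \<omega> / s"
  have uv: "u \<noteq> 0 \<or> v \<noteq> 0" using ab(3) f(4)[of a] f(4)[of b] by (auto simp: u_def v_def)
  have p: "p \<noteq> 0" using ab(4) s by (simp add: p_def)
  have "s *\<^sub>R app A0 u = \<alpha> *\<^sub>R u - \<omega> *\<^sub>R v" "s *\<^sub>R app A0 v = \<omega> *\<^sub>R u + \<alpha> *\<^sub>R v"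
    using PA[OF ab(1)] PA[OF ab(2)] by (simp_all add: ab(5,6) u_def v_def)
  then have "(1 / s) *\<^sub>R (s *\<^sub>R app A0 u) = (1 / s) *\<^sub>R (\<alpha> *\<^sub>R u - \<omega> *\<^sub>R v)"
    "(1 / s) *\<^sub>R (s *\<^sub>R app A0 v) = (1 / s) *\<^sub>R (\<omega> *\<^sub>R u + \<alpha> *\<^sub>R v)" by simp_all
  then have A0uv: "app A0 u = p *\<^sub>R u - q *\<^sub>R v" "app A0 v = q *\<^sub>R u + p *\<^sub>R v"
    using s by (simp_all add: p_def q_def algebra_simps)
  have "sy A0 \<noteq> 0"
  proof
    assume "sy A0 = 0"
    then have "tp A0 = - A0" by (simp add: sy_def eq_neg_iff_add_eq_0 add.commute)
    then have "app A0 x \<bullet> x = 0" for x using app_tp[of A0 x x] by (simp add: inner_commute)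
    from this[of u] this[of v] have "p * (u \<bullet> u) + p * (v \<bullet> v) = 0"
      by (simp add: A0uv inner_simps inner_commute)
    then have "u \<bullet> u + v \<bullet> v = 0" using p by (metis distrib_left mult_eq_0_iff)
    then show False using uv by (metis add_nonneg_eq_0_iff inner_eq_zero_iff inner_ge_zero)
  qed
  moreover have "mom A0 = 0"
  proof (rule ccontr)
    assume "mom A0 \<noteq> 0"
    then obtain r where r: "r > 0" "cm (mom A0) A0 = r *\<^sub>R A0"
      using ss solvsoliton_frame[OF fr] by blast
    obtain n where n: "A0 ^ n = 0" using eigen_nilpotent[OF r(2)] r(1) by auto
    have "x = 0 \<and> y = 0" if "app A0 x = p *\<^sub>R x - q *\<^sub>R y" "app A0 y = q *\<^sub>R x + p *\<^sub>R y"
      "app (A0 ^ k) x = 0" "app (A0 ^ k) y = 0" for k x y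
      using that(3,4)
    proof (induction k)
      case (Suc k)
      define x' y' where "x' = app (A0 ^ k) x" and "y' = app (A0 ^ k) y"
      have "p *\<^sub>R x' - q *\<^sub>R y' = app (A0 ^ Suc k) x" "q *\<^sub>R x' + p *\<^sub>R y' = app (A0 ^ Suc k) y"
        unfolding power_Suc2 app_simps(6) that(1,2) x'_def y'_def by simp_all
      then have z: "p *\<^sub>R x' - q *\<^sub>R y' = 0" "q *\<^sub>R x' + p *\<^sub>R y' = 0" using Suc.prems by simp_all
      have "p *\<^sub>R (p *\<^sub>R x' - q *\<^sub>R y') + q *\<^sub>R (q *\<^sub>R x' + p *\<^sub>R y') = (p * p + q * q) *\<^sub>R x'"
        "p *\<^sub>R (q *\<^sub>R x' + p *\<^sub>R y') - q *\<^sub>R (p *\<^sub>R x' - q *\<^sub>R y') = (p * p + q * q) *\<^sub>R y'"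
        by (simp_all add: algebra_simps)
      then have "(p * p + q * q) *\<^sub>R x' = 0" "(p * p + q * q) *\<^sub>R y' = 0" by (simp_all add: z)
      moreover have "p * p + q * q \<noteq> 0" using p by (simp add: sum_squares_eq_zero_iff)
      ultimately have "x' = 0" "y' = 0" by (metis scaleR_eq_0_iff)+
      then show ?case using Suc.IH by (simp add: x'_def y'_def)
    qed simp
    from this[OF A0uv, of n] show False using n uv by simp
  qed
  ultimately show thesis using that fr by blast
qed

lemma semisimple_solvsoliton_nonflat:
  "solvsoliton br0 g0 \<Longrightarrow> g0 \<in> nonflat_metrics br0"
  using normal_frame frame_nonflat by metis

lemma semisimple_solvsoliton_exists: "\<exists>g0\<in>nonflat_metrics br0. solvsoliton br0 g0"
proof -
  have "soliton_product As 0 N" by (rule soliton_product_semisimple[OF jdN(1) sN jdN(3,7)])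
  then have "soliton_product (br0 X) 0 N" by (rule soliton_product_cong) (rule br0_X)
  from solvsoliton_of_product[OF lie0 ideal0 X this] obtain g0 where "solvsoliton br0 g0" by auto
  then show ?thesis using semisimple_solvsoliton_nonflat by blast
qed

text \<open>In a frame of \<open>g0\<close> the original group has the matrix A0 + L with L
  nilpotent and commuting with A0 and its transpose. All conjugates of it stay below the value at
  A0, and metrics that shrink L approach this value.\<close>

lemma semisimple_pinching_sup:
  assumes ss: "solvsoliton br0 g0"
  shows "bdd_above (ricci_pinching br ` nonflat_metrics br)"
    and "(SUP g\<in>nonflat_metrics br. ricci_pinching br g) = ricci_pinching br0 g0"
proof -
  obtain P0 Q0 A0 where fr0: "frame br0 N g0 P0 Q0 A0" and n: "mom A0 = 0" and s: "sy A0 \<noteq> 0"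
    using normal_frame[OF ss] by blast
  note f = frame_facts[OF fr0]
  let ?\<nu> = "app Q0 e0"
  define t where "t = h ?\<nu>"
  \<comment> \<open>\<open>g0\<close> is also a metric on the original group, with the same P0 and
    Q0; only the bracket differs, and L records the difference.\<close>
  define L where "L = P0 * ad br ?\<nu> * Q0 - A0"
  have "frame br N g0 P0 Q0 (P0 * ad br ?\<nu> * Q0)"
    by (rule frame_of_hyperplane_frame(1)[OF lie ideal f(1,2,5,6)])
  then have frA: "frame br N g0 P0 Q0 (A0 + L)" by (simp add: L_def)
  have adL: "adm e0 L"
    using frame_facts(7)[OF frA] f(7) by (auto simp: adm_def)
  have A0_N: "app A0 (app P0 w) = t *\<^sub>R app P0 (As w)" if "w \<in> N" for w
  proof -
    have "app A0 (app P0 w) = app P0 (br0 ?\<nu> w)" using f(8)[of ?\<nu> w] f(6)[of w] that by (simp add: f(3))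
    then show ?thesis by (simp add: semidirect_bracket_def t_def hN that linear_scale[OF jdN(1)])
  qed
  have AL_N: "app (A0 + L) (app P0 w) = t *\<^sub>R app P0 (br X w)" if "w \<in> N" for w
  proof -
    have "app (A0 + L) (app P0 w) = app P0 (br ?\<nu> w)"
      using frame_facts(8)[OF frA, of ?\<nu> w] f(6)[of w] that by (simp add: f(3))
    also have "br ?\<nu> w = t *\<^sub>R br X w"
      using br_eq[OF lie ideal X, of ?\<nu> w] hN[OF that] by (simp add: t_def linear_scale[OF linX])
    finally show ?thesis by simp
  qed
  have L_N: "app L (app P0 w) = t *\<^sub>R app P0 (An w)" if "w \<in> N" for w
    using AL_N[OF that] A0_N[OF that] jdN(5)[OF that] by (simp add: algebra_simps)
  have decomp: "\<exists>w\<in>N. x = app P0 w + (x \<bullet> e0) *\<^sub>R e0" for x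
  proof -
    have "app Q0 (x - (x \<bullet> e0) *\<^sub>R e0) \<in> N" by (simp only: f(6,3)) (simp add: inner_simps)
    then show ?thesis by (intro bexI[of _ "app Q0 (x - (x \<bullet> e0) *\<^sub>R e0)"]) (simp_all only: f(3) diff_add_cancel)
  qed
  have e0z: "app A0 e0 = 0" "app L e0 = 0" using f(7) adL by (auto simp: adm_def)
  have AL: "cm A0 L = 0"
  proof (rule endo_eqI)
    fix x
    obtain w where w: "w \<in> N" "x = app P0 w + (x \<bullet> e0) *\<^sub>R e0" using decomp by blast
    have "app A0 (app L (app P0 w)) = app L (app A0 (app P0 w))"
      using w(1) by (simp add: A0_N L_N jdN(3,4,6))
    then have "app A0 (app L (app P0 w + (x \<bullet> e0) *\<^sub>R e0)) = app L (app A0 (app P0 w + (x \<bullet> e0) *\<^sub>R e0))"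
      by (simp add: e0z)
    then show "app (cm A0 L) x = app 0 x" unfolding w(2)[symmetric] by (simp add: cm_def)
  qed
  obtain m where m: "\<forall>v\<in>N. (An ^^ m) v = 0" using jdN(8) by (auto simp: nilpotent_on_def)
  have Lpow: "app (L ^ i) (app P0 w) = t ^ i *\<^sub>R app P0 ((An ^^ i) w)" if "w \<in> N" for i w
  proof (induction i)
    case (Suc i)
    have "(An ^^ i) w \<in> N" using that jdN(4) by (induction i) auto
    then show ?case by (simp add: Suc L_N mult.commute)
  qed simp
  have Lm: "L ^ Suc m = 0"
  proof (rule endo_eqI)
    fix x
    obtain w where w: "w \<in> N" "x = app P0 w + (x \<bullet> e0) *\<^sub>R e0" using decomp by blast
    have "(An ^^ Suc m) w = 0" using m w(1) jdN(2) by (simp add: linear_0)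
    then have "app (L ^ Suc m) (app P0 w) = 0" by (simp only: Lpow[OF w(1)]) simp
    moreover have "app (L ^ Suc m) e0 = 0" by (simp only: power_Suc2 app_simps(6) e0z app_linear)
    ultimately have "app (L ^ Suc m) (app P0 w + (x \<bullet> e0) *\<^sub>R e0) = 0" by (simp only: app_linear scaleR_zero_right add_0)
    then show "app (L ^ Suc m) x = app 0 x" unfolding w(2)[symmetric] by simp
  qed
  have trL: "tr L = 0" by (rule tr_nilpotent[OF Lm])
  have "cm (tp A0) L = 0" by (rule fuglede[OF n AL])
  then have SL: "cm (sy A0) L = 0" by (simp add: sy_def cm_linear AL)
  \<comment> \<open>L commutes with the symmetric part of A0, so their product is nilpotent as
    well.\<close>
  have trLS: "tr (L * sy A0) = 0"
  proof -
    have c: "sy A0 * L ^ i = L ^ i * sy A0" for i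
      using SL by (metis cm_def eq_iff_diff_eq_0 power_commuting_commutes)
    have "(L * sy A0) ^ i = L ^ i * sy A0 ^ i" for i
    proof (induction i)
      case (Suc i)
      have "(L * sy A0) ^ Suc i = L * (sy A0 * L ^ i) * sy A0 ^ i" by (simp add: Suc mult.assoc)
      then show ?case by (simp add: c mult.assoc)
    qed simp
    then have "(L * sy A0) ^ Suc m = 0" by (simp only: Lm mult_zero_left)
    then show ?thesis by (rule tr_nilpotent)
  qed
  have F0: "ricci_pinching br0 g0 = pinch A0" by (rule ricci_pinching_frame[OF fr0])
  have le: "ricci_pinching br g \<le> pinch A0" if g: "g \<in> nonflat_metrics br" for g
  proof -
    have "inner_product g" using g by (simp add: nonflat_metrics_def)
    then obtain P Q A where fr: "frame br N g P Q A" using frame_exists[OF lie ideal] by blast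
    obtain k k' c where k: "k * k' = 1" "k' * k = 1" "c \<noteq> 0" "A = c *\<^sub>R (k * (A0 + L) * k')"
      using frame_conj_frame[OF lie fr frA] by metis
    have "ricci_pinching br g = pinch (k * (A0 + L) * k')"
      unfolding ricci_pinching_frame[OF fr] k(4) by (rule pinch_scaleR[OF k(3)])
    also have "\<dots> \<le> pinch A0" by (rule pinch_conj_le_normal(2)[OF n s k(1,2) SL trLS trL])
    finally show ?thesis .
  qed
  then show bdd: "bdd_above (ricci_pinching br ` nonflat_metrics br)" by (intro bdd_aboveI[of _ "pinch A0"]) auto
  have shrink: "\<exists>(Z :: 'a endo) D g. mom Z = 0 \<and> tau Z = tau A0 \<and> norm Z = norm A0 \<and> norm D \<le> \<epsilon> * sqrt DIM('a) \<and>
      tr (Z + D) = tr A0 \<and> g \<in> nonflat_metrics br \<and> ricci_pinching br g = pinch (Z + D)" if \<epsilon>: "\<epsilon> > 0" for \<epsilon> :: real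
  proof -
    define G where "G x y = (\<Sum>i<Suc m. (1 / \<epsilon>) ^ (2 * i) * (app (L ^ i) x \<bullet> app (L ^ i) y))" for x y
    note shr = nilpotent_shrink[OF n AL Lm \<epsilon> adL, folded G_def]
    have sub: "subspace {x :: 'a. x \<bullet> e0 = 0}" by (auto simp: subspace_def inner_simps)
    have "dim {x :: 'a. e0 \<bullet> x = 0} = DIM('a) - 1"
      by (rule dim_hyperplane) (metis e0_inner inner_zero_left zero_neq_one)
    then have dim: "dim {x :: 'a. x \<bullet> e0 = 0} + 1 = DIM('a)"
      using DIM_positive[where 'a = 'a] by (simp add: inner_commute)
    obtain k k' where k: "k * k' = 1" "k' * k = 1" and Gk: "\<And>x y. G x y = app k x \<bullet> app k y"
      and ker: "\<And>x. x \<in> {x. x \<bullet> e0 = 0} \<longleftrightarrow> app k x \<bullet> e0 = 0"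
      using hyperplane_frame[OF shr(1) sub dim] by blast
    note inv = app_inverse[OF k]
    \<comment> \<open>For G, too, \<open>e0\<close> is a unit vector orthogonal to the hyperplane,
      so \<open>k\<close> preserves it up to the sign \<open>c\<close>.\<close>
    have "app k e0 = (app k e0 \<bullet> e0) *\<^sub>R e0"
    proof -
      define y where "y = app k e0 - (app k e0 \<bullet> e0) *\<^sub>R e0"
      have y: "y \<bullet> e0 = 0" by (simp add: y_def inner_simps)
      have "app k' y \<bullet> e0 = 0" using ker[of "app k' y"] y by (simp add: inv)
      then have "app k e0 \<bullet> y = 0" using Gk[of e0 "app k' y"] shr(2)[of "app k' y"] by (simp add: inv inner_commute)
      then have "y \<bullet> y = 0" using y by (simp add: y_def inner_simps inner_commute)
      then show ?thesis by (simp add: y_def)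
    qed
    then obtain c where c: "app k e0 = c *\<^sub>R e0" by blast
    have "app k e0 \<bullet> app k e0 = 1" using Gk[of e0 e0] shr(2)[of e0] by simp
    then have c1: "c * c = 1" by (simp add: c)
    then have c0: "c \<noteq> 0" by auto
    have k'e: "app k' e0 = c *\<^sub>R e0"
    proof -
      have "c *\<^sub>R app k' e0 = e0" using inv(2)[of e0] by (simp add: c)
      then have "c *\<^sub>R (c *\<^sub>R app k' e0) = c *\<^sub>R e0" by simp
      then show ?thesis by (simp add: c1)
    qed
    define g where "g x y = app (k * P0) x \<bullet> app (k * P0) y" for x y
    have PQ: "k * P0 * (Q0 * k') = 1" "Q0 * k' * (k * P0) = 1"
      using f(1,2) k by (metis mult.assoc mult_1_right)+
    have N: "x \<in> N \<longleftrightarrow> app (k * P0) x \<bullet> e0 = 0" for x using f(6)[of x] ker[of "app P0 x"] by simp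
    from frame_of_hyperplane_frame(1)[OF lie ideal PQ, of g, OF g_def N]
    have fr: "frame br N g (k * P0) (Q0 * k') (k * P0 * ad br (app (Q0 * k') e0) * (Q0 * k'))" .
    have "ad br (app (Q0 * k') e0) = c *\<^sub>R ad br ?\<nu>"
      by (rule endo_eqI) (use lie in \<open>simp add: app_ad[OF lie] k'e lie_algebra_def bilinear_lmul\<close>)
    then have "k * P0 * ad br (app (Q0 * k') e0) * (Q0 * k') = c *\<^sub>R (k * (P0 * ad br ?\<nu> * Q0) * k')"
      by (simp add: mult.assoc)
    also have "P0 * ad br ?\<nu> * Q0 = A0 + L" by (simp add: L_def)
    finally have fr': "frame br N g (k * P0) (Q0 * k') (c *\<^sub>R (k * (A0 + L) * k'))" using fr by simp
    have F: "ricci_pinching br g = pinch (k * (A0 + L) * k')"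
      unfolding ricci_pinching_frame[OF fr'] by (rule pinch_scaleR[OF c0])
    have "sy (k * (A0 + L) * k') \<noteq> 0" by (rule pinch_conj_le_normal(1)[OF n s k SL trLS trL])
    then have gC: "g \<in> nonflat_metrics br"
      using frame_nonflat[OF fr'] c0 by (simp add: sy_def scaleR_add_right[symmetric])
    have sum: "k * (A0 + L) * k' = k * A0 * k' + k * L * k'" by (simp add: algebra_simps)
    have trB: "tr (k * A0 * k' + k * L * k') = tr A0"
      unfolding sum[symmetric] tr_conj[OF k(2)] using trL by simp
    have FB: "ricci_pinching br g = pinch (k * A0 * k' + k * L * k')" using F by (simp only: sum)
    have "mom (k * A0 * k') = 0 \<and> tau (k * A0 * k') = tau A0 \<and> norm (k * A0 * k') = norm A0 \<and>
        norm (k * L * k') \<le> \<epsilon> * sqrt DIM('a) \<and> tr (k * A0 * k' + k * L * k') = tr A0 \<and>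
        g \<in> nonflat_metrics br \<and> ricci_pinching br g = pinch (k * A0 * k' + k * L * k')"
      using shr(3)[OF k Gk] gC trB FB by (simp only: simp_thms)
    then show ?thesis by blast
  qed
  define \<delta> where "\<delta> i = 1 / real (Suc i)" for i
  have "\<forall>i. \<exists>(Z :: 'a endo) D g. mom Z = 0 \<and> tau Z = tau A0 \<and> norm Z = norm A0 \<and> norm D \<le> \<delta> i * sqrt DIM('a) \<and>
      tr (Z + D) = tr A0 \<and> g \<in> nonflat_metrics br \<and> ricci_pinching br g = pinch (Z + D)"
    by (intro allI shrink) (simp add: \<delta>_def)
  then obtain Z D :: "nat \<Rightarrow> 'a endo" and g where "\<forall>i. mom (Z i) = 0 \<and> tau (Z i) = tau A0 \<and>
      norm (Z i) = norm A0 \<and> norm (D i) \<le> \<delta> i * sqrt DIM('a) \<and> tr (Z i + D i) = tr A0 \<and>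
      g i \<in> nonflat_metrics br \<and> ricci_pinching br (g i) = pinch (Z i + D i)"
    unfolding choice_iff by (elim exE)
  then have ZD: "\<And>i. mom (Z i) = 0" "\<And>i. tau (Z i) = tau A0" "\<And>i. norm (Z i) = norm A0"
    "\<And>i. norm (D i) \<le> \<delta> i * sqrt DIM('a)" "\<And>i. tr (Z i + D i) = tr A0"
    "\<And>i. g i \<in> nonflat_metrics br" "\<And>i. ricci_pinching br (g i) = pinch (Z i + D i)"
    by simp_all
  have "\<delta> \<longlonglongrightarrow> 0" unfolding \<delta>_def[abs_def] using LIMSEQ_inverse_real_of_nat by (simp add: inverse_eq_divide)
  then have "(\<lambda>i. \<delta> i * sqrt DIM('a)) \<longlonglongrightarrow> 0" by (rule tendsto_mult_left_zero)
  then have "D \<longlonglongrightarrow> 0" by (rule Lim_null_comparison[rotated]) (use ZD(4) in simp)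
  from pinch_perturbation[OF n s ZD(1,2,3) this ZD(5)]
  have lim: "(\<lambda>i. pinch (Z i + D i)) \<longlonglongrightarrow> pinch A0" .
  show "(SUP g\<in>nonflat_metrics br. ricci_pinching br g) = ricci_pinching br0 g0"
    unfolding F0
  proof (rule antisym)
    show "(SUP g\<in>nonflat_metrics br. ricci_pinching br g) \<le> pinch A0"
      using ZD(6) le by (intro cSUP_least) auto
    show "pinch A0 \<le> (SUP g\<in>nonflat_metrics br. ricci_pinching br g)"
    proof (rule LIMSEQ_le_const2[OF lim], intro exI allI impI)
      fix i
      show "pinch (Z i + D i) \<le> (SUP g\<in>nonflat_metrics br. ricci_pinching br g)"
        unfolding ZD(7)[symmetric] by (rule cSUP_upper[OF ZD(6) bdd])
    qed
  qed
qed

end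

theorem theorem1p5:
  fixes br :: "'a::euclidean_space \<Rightarrow> 'a \<Rightarrow> 'a" and N :: "'a set" and X :: 'a
  assumes "lie_algebra br" and "codim1_abelian_ideal br N" and "X \<notin> N"
  shows
    "(\<forall>g. local_maximum_on (nonflat_metrics br) (ricci_pinching br) g \<longrightarrow> ricci_soliton br N X g) \<and>
     (\<forall>g\<in>nonflat_metrics br.
        global_maximum_on (nonflat_metrics br) (ricci_pinching br) g \<longleftrightarrow> solvsoliton br g) \<and>
     ((\<exists>g\<in>nonflat_metrics br. ricci_soliton br N X g \<and> \<not> solvsoliton br g) \<longrightarrow>
      (\<exists>g\<in>nonflat_metrics br. ricci_soliton br N X g \<and>
         \<not> local_maximum_on (nonflat_metrics br) (ricci_pinching br) g)) \<and>
     (real_type br \<and> \<not> (\<exists>g. solvsoliton br g) \<longrightarrow>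
      (\<forall>As An. additive_jordan_decomposition N (br X) As An \<longrightarrow>
         (let br\<^sub>0 = semidirect_bracket N X As in
            (\<exists>g\<^sub>0\<in>nonflat_metrics br\<^sub>0. solvsoliton br\<^sub>0 g\<^sub>0) \<and>
            (\<forall>g\<^sub>0. solvsoliton br\<^sub>0 g\<^sub>0 \<longrightarrow>
               bdd_above (ricci_pinching br ` nonflat_metrics br) \<and>
               (SUP g\<in>nonflat_metrics br. ricci_pinching br g) = ricci_pinching br\<^sub>0 g\<^sub>0))))"
  unfolding Let_def
proof (intro conjI allI ballI impI)
  fix g assume "local_maximum_on (nonflat_metrics br) (ricci_pinching br) g"
  then show "ricci_soliton br N X g" by (rule local_maximum_structure(1)[OF assms])
next
  fix g assume "g \<in> nonflat_metrics br"
  then show "global_maximum_on (nonflat_metrics br) (ricci_pinching br) g \<longleftrightarrow> solvsoliton br g"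
    by (rule global_maximum_iff_solvsoliton[OF assms])
next
  assume "\<exists>g\<in>nonflat_metrics br. ricci_soliton br N X g \<and> \<not> solvsoliton br g"
  then show "\<exists>g\<in>nonflat_metrics br. ricci_soliton br N X g \<and>
         \<not> local_maximum_on (nonflat_metrics br) (ricci_pinching br) g"
    using ricci_soliton_not_local_maximum[OF assms] by (elim bexE conjE)
next
  fix As An
  assume rt: "real_type br \<and> \<not> (\<exists>g. solvsoliton br g)"
    and jd: "additive_jordan_decomposition N (br X) As An"
  let ?br0 = "semidirect_bracket N X As"
  note part4 = semisimple_solvsoliton_exists[OF assms conjunct1[OF rt] conjunct2[OF rt] jd]
    semisimple_pinching_sup[OF assms conjunct1[OF rt] conjunct2[OF rt] jd]
  show "\<exists>g0\<in>nonflat_metrics ?br0. solvsoliton ?br0 g0" by (rule part4(1))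
  fix g0 assume "solvsoliton ?br0 g0"
  then show "bdd_above (ricci_pinching br ` nonflat_metrics br)"
    and "(SUP g\<in>nonflat_metrics br. ricci_pinching br g) = ricci_pinching ?br0 g0"
    by (rule part4(2), rule part4(3))
qed

end
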